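(* Let $G=(V,E)$ be a connected, locally finite, quasi-transitive graph such that $p_c(G)<p_{2\to 2}(G)$, and write $p_c=p_c(G)$. Then there exist positive constants $\delta, c, C$ depending only on $G$ such that $$c|p-p_c|^2\leq \zeta(p)\leq C|p-p_c|^2$$ for every $p\in(p_c-\delta,p_c+\delta)$.
   Context: A graph is quasi-transitive if the action of its automorphism group on its vertex set has at most finitely many orbits. In Bernoulli-$p$ bond percolation on $G$, with law $\mathbf{P}_p$, each edge is independently open with probability $p$ and closed otherwise; clusters are the connected components of the random subgraph of open edges. $K_v$ is the cluster of $v$, and $E(K_v)$ is the set of edges of $G$ that have at least one endpoint in $K_v$. Define $$\zeta(p)=-\limsup_{n\to\infty}\frac1n\log\mathbf{P}_p\bigl(n\leq|E(K_v)|<\infty\bigr),$$ which does not depend on the choice of $v\in V$. The critical probability is $p_c(G)=\sup\{p\in[0,1]:\text{every cluster is finite } \mathbf{P}_p\text{-a.s.}\}$. The two-point matrix is $T_p(u,v)=\mathbf{P}_p(u\leftrightarrow v)$ (the probability that $u,v$ lie in the same cluster), $\|T_p\|_{2\to2}\in[0,\infty]$ is its $L^2(V)\to L^2(V)$ operator norm, and $p_{2\to2}(G)=\sup\{p\in[0,1]:\|T_p\|_{2\to2}<\infty\}$. *)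

theory Defs
  imports "HOL-Probability.Probability"
begin

section \<open>Simple graphs\<close>

text \<open>A graph is a vertex set \<open>V\<close> together with a set \<open>E\<close> of two-element subsets of \<open>V\<close>.\<close>

definition simple_graph :: "'v set \<Rightarrow> 'v set set \<Rightarrow> bool" where
  "simple_graph V E \<longleftrightarrow> E \<subseteq> {{u, v} | u v. u \<in> V \<and> v \<in> V \<and> u \<noteq> v}"

definition adjacency :: "'v set set \<Rightarrow> ('v \<times> 'v) set" where
  "adjacency E = {(u, v). {u, v} \<in> E}"

definition connected_graph :: "'v set \<Rightarrow> 'v set set \<Rightarrow> bool" where
  "connected_graph V E \<longleftrightarrow> V \<noteq> {} \<and> (\<forall>u\<in>V. \<forall>v\<in>V. (u, v) \<in> (adjacency E)\<^sup>*)"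

definition locally_finite_graph :: "'v set \<Rightarrow> 'v set set \<Rightarrow> bool" where
  "locally_finite_graph V E \<longleftrightarrow> (\<forall>v\<in>V. finite {e \<in> E. v \<in> e})"

definition graph_automorphism :: "'v set \<Rightarrow> 'v set set \<Rightarrow> ('v \<Rightarrow> 'v) \<Rightarrow> bool" where
  "graph_automorphism V E \<phi> \<longleftrightarrow>
     bij_betw \<phi> V V \<and> (\<forall>u\<in>V. \<forall>v\<in>V. {u, v} \<in> E \<longleftrightarrow> {\<phi> u, \<phi> v} \<in> E)"

definition vertex_orbit :: "'v set \<Rightarrow> 'v set set \<Rightarrow> 'v \<Rightarrow> 'v set" where
  "vertex_orbit V E v = {\<phi> v | \<phi>. graph_automorphism V E \<phi>}"

definition quasi_transitive_graph :: "'v set \<Rightarrow> 'v set set \<Rightarrow> bool" where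
  "quasi_transitive_graph V E \<longleftrightarrow> finite (vertex_orbit V E ` V)"


section \<open>Bernoulli bond percolation\<close>

text \<open>A configuration is a function \<open>\<omega>\<close> on edges, with \<open>\<omega> e\<close> true iff \<open>e\<close> is open.
  The library's \<open>bernoulli_pmf p\<close> truncates \<open>p\<close> to \<open>[0, 1]\<close>.\<close>

definition percolation :: "'v set set \<Rightarrow> real \<Rightarrow> ('v set \<Rightarrow> bool) measure" where
  "percolation E p = (\<Pi>\<^sub>M e\<in>E. measure_pmf (bernoulli_pmf p))"

definition cluster :: "'v set set \<Rightarrow> ('v set \<Rightarrow> bool) \<Rightarrow> 'v \<Rightarrow> 'v set" where
  "cluster E \<omega> v = {w. (v, w) \<in> (adjacency {e \<in> E. \<omega> e})\<^sup>*}"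

definition touching_edges :: "'v set set \<Rightarrow> 'v set \<Rightarrow> 'v set set" where
  "touching_edges E K = {e \<in> E. e \<inter> K \<noteq> {}}"

definition critical_probability :: "'v set \<Rightarrow> 'v set set \<Rightarrow> real" where
  "critical_probability V E =
     Sup {p \<in> {0..1}. AE \<omega> in percolation E p. \<forall>v\<in>V. finite (cluster E \<omega> v)}"

definition finite_cluster_tail :: "'v set set \<Rightarrow> real \<Rightarrow> 'v \<Rightarrow> nat \<Rightarrow> real" where
  "finite_cluster_tail E p v n =
     measure (percolation E p)
       {\<omega> \<in> space (percolation E p).
          finite (touching_edges E (cluster E \<omega> v)) \<and>
          n \<le> card (touching_edges E (cluster E \<omega> v))}"

text \<open>The real \<open>ln\<close> has \<open>ln 0 = 0\<close>; the rate function needs the convention \<open>log 0 = -\<infinity>\<close>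
  (for instance \<open>\<zeta>(0) = \<infinity>\<close>).\<close>

definition extended_log :: "real \<Rightarrow> ereal" where
  "extended_log x = (if x = 0 then -\<infinity> else ereal (ln x))"

definition zeta :: "'v set set \<Rightarrow> 'v \<Rightarrow> real \<Rightarrow> ereal" where
  "zeta E v p =
     - limsup (\<lambda>n. ereal (1 / real n) * extended_log (finite_cluster_tail E p v n))"


section \<open>The two-point matrix and its operator norm\<close>

definition two_point :: "'v set set \<Rightarrow> real \<Rightarrow> 'v \<Rightarrow> 'v \<Rightarrow> real" where
  "two_point E p u v =
     measure (percolation E p) {\<omega> \<in> space (percolation E p). v \<in> cluster E \<omega> u}"

definition square_summable :: "'v set \<Rightarrow> ('v \<Rightarrow> real) \<Rightarrow> bool" where
  "square_summable V f \<longleftrightarrow> (\<lambda>v. (f v)\<^sup>2) summable_on V"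

definition l2_norm :: "'v set \<Rightarrow> ('v \<Rightarrow> real) \<Rightarrow> real" where
  "l2_norm V f = sqrt (\<Sum>\<^sub>\<infinity>v\<in>V. (f v)\<^sup>2)"

definition matrix_apply :: "'v set \<Rightarrow> ('v \<Rightarrow> 'v \<Rightarrow> real) \<Rightarrow> ('v \<Rightarrow> real) \<Rightarrow> 'v \<Rightarrow> real" where
  "matrix_apply V M f u = (\<Sum>\<^sub>\<infinity>v\<in>V. M u v * f v)"

text \<open>The norm is \<open>\<infinity>\<close> (the infimum of the empty set) unless \<open>M\<close> defines a bounded operator on
  \<open>L\<^sup>2(V)\<close>; the summability conditions are needed because \<open>infsum\<close> is \<open>0\<close> on non-summable
  families.\<close>

definition l2_operator_norm :: "'v set \<Rightarrow> ('v \<Rightarrow> 'v \<Rightarrow> real) \<Rightarrow> ereal" where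
  "l2_operator_norm V M =
     Inf {ereal B | B. 0 \<le> B \<and>
       (\<forall>f. square_summable V f \<longrightarrow>
          (\<forall>u\<in>V. (\<lambda>v. M u v * f v) summable_on V) \<and>
          square_summable V (matrix_apply V M f) \<and>
          l2_norm V (matrix_apply V M f) \<le> B * l2_norm V f)}"

definition p_two_to_two :: "'v set \<Rightarrow> 'v set set \<Rightarrow> real" where
  "p_two_to_two V E = Sup {p \<in> {0..1}. l2_operator_norm V (two_point E p) < \<infinity>}"

end

theory Submission
  imports Defs
begin

text \<open>Everything rests on one exploration argument for \<open>p < p' = p + s - p s\<close>, where \<open>p'\<close>-percolation is the
  union of \<open>p\<close>-percolation and an independent sprinkling of density \<open>s\<close>. Let \<open>\<chi>\<close> be the susceptibility at \<open>p\<close>.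
  Since the two-point matrix is bounded on \<open>L\<^sup>2\<close>, every finite set \<open>H\<close> has at least \<open>c |H|\<close> boundary edges
  behind which the \<open>p\<close>-cluster off \<open>H\<close> has expected size at least \<open>c \<chi>\<close>. If the \<open>p'\<close>-cluster of \<open>v\<close> is the
  finite set \<open>H\<close>, then all these edges failed to be opened by the sprinkling, although they should have
  produced about \<open>s \<chi> |H|\<close> new vertices; for \<open>s \<chi>\<close> large this is a large deviation event, and
  \<open>E [exp (c |K| / \<chi>\<^sup>2); |K| < \<infinity>] < 1\<close> under \<open>p'\<close>. If all clusters are finite at \<open>p'\<close>, this is absurd, so that
  \<open>\<chi>\<close> is finite and at most \<open>C / (p\<^sub>c - p)\<close> for \<open>p < p\<^sub>c\<close>; combined with \<open>\<chi> \<ge> c / (p\<^sub>c - p)\<close> the same inequality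
  gives \<open>\<zeta>(p') \<ge> c (p' - p\<^sub>c)\<^sup>2\<close> above \<open>p\<^sub>c\<close>. Below \<open>p\<^sub>c\<close> the bound \<open>\<zeta> \<ge> c \<chi>\<^sup>-\<^sup>2\<close> is Azuma's inequality for the
  exploration martingale of \<open>|K|\<close>. For the upper bound, Cauchy--Schwarz compares the weights at \<open>p\<close> and at
  \<open>p\<^sub>c\<close>: \<open>P\<^sub>p(|E(K)| = m) \<ge> P\<^sub>c(|E(K)| = m)\<^sup>2 (1 + (p - p\<^sub>c)\<^sup>2 / (p (1 - p)))\<^sup>-\<^sup>m\<close>, and the critical probabilities do
  not decay exponentially because \<open>\<chi>\<close> diverges at \<open>p\<^sub>c\<close>.\<close>

section \<open>Finite Bernoulli expectations\<close>

text \<open>The scale chi^-2 arises as follows. A \<open>p\<close>-cluster has second moment of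
  order at most chi^3, so if its mean is of order chi, weighting it by \<open>exp (- l |C|)\<close>
  with l of order chi^-2 lowers the total mass by an amount of order l chi. A sprinkled good edge
  can therefore pay for a reward b of order s l chi. The final cluster H has at least c |H| good
  edges, and their rewards exceed 2 l |H| once s chi is large, which leaves a net factor exp (l
  |H|). The obstacle is that neither sharpness of the transition nor the rate of divergence of chi
  may be presupposed. Both come out of a collision: (p' - p) chi stays below a constant whenever
  clusters at p' are almost surely finite, while a perturbation argument bounds chi from below near
  the point where it ceases to be finite. Above the critical point the base density p is then taken
  so close to it that (p' - p) chi reaches the required constant. All estimates are made on finite
  edge sets, where expectations are polynomials in p and no measurability occurs; only the laws of
  finite clusters are carried over to infinite volume.\<close>

definition expect :: "'e set \<Rightarrow> real \<Rightarrow> ('e set \<Rightarrow> real) \<Rightarrow> real" where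
  "expect F p f = (\<Sum>S\<in>Pow F. p ^ card S * (1 - p) ^ card (F - S) * f S)"

lemma expect_empty [simp]: "expect {} p f = f {}"
  by (simp add: expect_def)

lemma expect_insert:
  assumes "finite F" "e \<notin> F"
  shows "expect (insert e F) p f
    = p * expect F p (\<lambda>S. f (insert e S)) + (1 - p) * expect F p f"
proof -
  let ?w = "\<lambda>G S. p ^ card S * (1 - p) ^ card (G - S) * f S"
  have inj: "inj_on (insert e) (Pow F)"
    using assms by (auto simp: inj_on_def)
  have disj: "Pow F \<inter> insert e ` Pow F = {}"
    using assms by auto
  have "expect (insert e F) p f = sum (?w (insert e F)) (Pow F) + sum (?w (insert e F)) (insert e ` Pow F)"
    unfolding expect_def Pow_insert using disj assms by (intro sum.union_disjoint) auto
  moreover have "sum (?w (insert e F)) (Pow F) = (1 - p) * expect F p f"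
    unfolding expect_def sum_distrib_left
  proof (rule sum.cong)
    fix S assume "S \<in> Pow F"
    then have "insert e F - S = insert e (F - S)" "e \<notin> F - S" "finite (F - S)"
      using assms by auto
    then show "?w (insert e F) S = (1 - p) * ?w F S"
      by simp
  qed simp
  moreover have "sum (?w (insert e F)) (insert e ` Pow F) = p * expect F p (\<lambda>S. f (insert e S))"
    unfolding expect_def sum_distrib_left sum.reindex[OF inj]
  proof (rule sum.cong)
    fix S assume "S \<in> Pow F"
    then have "insert e F - insert e S = F - S" "e \<notin> S" "finite S"
      using assms finite_subset by auto
    then show "(?w (insert e F) \<circ> insert e) S
        = p * (p ^ card S * (1 - p) ^ card (F - S) * f (insert e S))"
      by simp
  qed simp
  ultimately show ?thesis by simp
qed

lemma expect_cong:
  assumes "\<And>S. S \<subseteq> F \<Longrightarrow> f S = g S"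
  shows "expect F p f = expect F p g"
  unfolding expect_def by (rule sum.cong) (auto simp: assms)

lemma expect_mono:
  assumes "0 \<le> p" "p \<le> 1" "\<And>S. S \<subseteq> F \<Longrightarrow> f S \<le> g S"
  shows "expect F p f \<le> expect F p g"
  unfolding expect_def using assms by (intro sum_mono mult_left_mono) auto

lemma expect_add: "expect F p (\<lambda>S. f S + g S) = expect F p f + expect F p g"
  by (simp add: expect_def distrib_left sum.distrib)

lemma expect_diff: "expect F p (\<lambda>S. f S - g S) = expect F p f - expect F p g"
  by (simp add: expect_def right_diff_distrib sum_subtractf)

lemma expect_cmult: "expect F p (\<lambda>S. c * f S) = c * expect F p f"
  by (simp add: expect_def sum_distrib_left mult_ac)

lemma expect_sum: "expect F p (\<lambda>S. \<Sum>i\<in>I. f i S) = (\<Sum>i\<in>I. expect F p (f i))"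
proof -
  have "expect F p (\<lambda>S. \<Sum>i\<in>I. f i S)
      = (\<Sum>S\<in>Pow F. \<Sum>i\<in>I. p ^ card S * (1 - p) ^ card (F - S) * f i S)"
    by (simp add: expect_def sum_distrib_left)
  also have "\<dots> = (\<Sum>i\<in>I. expect F p (f i))"
    unfolding expect_def by (rule sum.swap)
  finally show ?thesis .
qed

lemma expect_const: "finite F \<Longrightarrow> expect F p (\<lambda>_. c) = c"
proof (induction F rule: finite_induct)
  case (insert e F)
  then show ?case by (simp add: expect_insert algebra_simps)
qed simp

lemma sprinkle_range:
  fixes p s :: real
  assumes "0 \<le> p" "p \<le> 1" "0 \<le> s" "s \<le> 1"
  shows "0 \<le> p + s - p * s" "p + s - p * s \<le> 1"
proof -
  have "0 \<le> p + s * (1 - p)" "0 \<le> (1 - p) * (1 - s)" using assms by simp_all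
  then show "0 \<le> p + s - p * s" "p + s - p * s \<le> 1" by (simp_all add: algebra_simps)
qed

lemma expect_prob_0: "finite F \<Longrightarrow> expect F 0 f = f {}"
  by (induction F arbitrary: f rule: finite_induct) (auto simp: expect_insert)

lemma expect_nonneg:
  assumes "0 \<le> p" "p \<le> 1" "\<And>S. S \<subseteq> F \<Longrightarrow> 0 \<le> f S"
  shows "0 \<le> expect F p f"
  unfolding expect_def using assms by (intro sum_nonneg mult_nonneg_nonneg) auto

lemma expect_union:
  assumes "finite A" "finite B" "A \<inter> B = {}"
  shows "expect (A \<union> B) p f = expect A p (\<lambda>S. expect B p (\<lambda>T. f (S \<union> T)))"
  using assms
proof (induction A arbitrary: f rule: finite_induct)
  case (insert e A)
  then have "expect (insert e (A \<union> B)) p f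
    = p * expect (A \<union> B) p (\<lambda>S. f (insert e S)) + (1 - p) * expect (A \<union> B) p f"
    by (intro expect_insert) auto
  with insert show ?case
    by (simp add: expect_insert)
qed simp

lemma expect_split:
  assumes "finite F" "A \<subseteq> F"
  shows "expect F p f = expect A p (\<lambda>S. expect (F - A) p (\<lambda>T. f (S \<union> T)))"
proof -
  have "A \<union> (F - A) = F" using assms by auto
  then show ?thesis
    using expect_union[of A "F - A" p f] assms finite_subset[of A F] by auto
qed

lemma expect_marginal:
  assumes "finite F" "A \<subseteq> F" "\<And>S T. S \<subseteq> A \<Longrightarrow> T \<subseteq> F - A \<Longrightarrow> f (S \<union> T) = g S"
  shows "expect F p f = expect A p g"
proof -
  have "expect F p f = expect A p (\<lambda>S. expect (F - A) p (\<lambda>T. g S))"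
    unfolding expect_split[OF assms(1,2)] by (intro expect_cong) (simp add: assms(3))
  then show ?thesis using assms by (simp add: expect_const)
qed

lemma expect_mono_set:
  assumes "0 \<le> p" "p \<le> 1" "finite G" "F \<subseteq> G" "\<And>S T. S \<subseteq> T \<Longrightarrow> T \<subseteq> G \<Longrightarrow> f S \<le> f T"
  shows "expect F p f \<le> expect G p f"
proof -
  have "expect F p f = expect F p (\<lambda>S. expect (G - F) p (\<lambda>T. f S))"
    using assms by (simp add: expect_const)
  also have "\<dots> \<le> expect F p (\<lambda>S. expect (G - F) p (\<lambda>T. f (S \<union> T)))"
    using assms(1-4) by (intro expect_mono assms(5)) auto
  also have "\<dots> = expect G p f"
    using expect_split[of G F p f] assms by simp
  finally show ?thesis .
qed

lemma expect_sprinkle: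
  assumes "finite F"
  shows "expect F (p + s - p * s) f = expect F p (\<lambda>S. expect F s (\<lambda>T. f (S \<union> T)))"
  using assms
proof (induction F arbitrary: f rule: finite_induct)
  case (insert e F)
  have [simp]: "insert e (insert e X) = insert e X" for X :: "'a set" by auto
  have "expect (insert e F) p (\<lambda>S. expect (insert e F) s (\<lambda>T. f (S \<union> T)))
    = p * expect F p (\<lambda>S. s * expect F s (\<lambda>T. f (insert e (S \<union> T)))
          + (1 - s) * expect F s (\<lambda>T. f (insert e (S \<union> T))))
    + (1 - p) * expect F p (\<lambda>S. s * expect F s (\<lambda>T. f (insert e (S \<union> T)))
          + (1 - s) * expect F s (\<lambda>T. f (S \<union> T)))"
    using insert(1,2) by (simp add: expect_insert)
  also have "\<dots> = (p + s - p * s) * expect F p (\<lambda>S. expect F s (\<lambda>T. f (insert e (S \<union> T))))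
     + (1 - (p + s - p * s)) * expect F p (\<lambda>S. expect F s (\<lambda>T. f (S \<union> T)))"
    by (simp only: expect_add expect_cmult) (simp add: algebra_simps)
  also have "\<dots> = expect (insert e F) (p + s - p * s) f"
    using insert(1,2) by (simp add: expect_insert insert.IH)
  finally show ?case by simp
qed simp

lemma expect_mono_p:
  assumes "0 \<le> p" "p \<le> q" "q \<le> 1" "finite F" "\<And>S T. S \<subseteq> T \<Longrightarrow> T \<subseteq> F \<Longrightarrow> f S \<le> f T"
  shows "expect F p f \<le> expect F q f"
  using assms(4,5)
proof (induction F arbitrary: f rule: finite_induct)
  case (insert e F)
  have sub: "expect F q (\<lambda>S. f S) \<le> expect F q (\<lambda>S. f (insert e S))"
    using assms insert by (intro expect_mono insert.prems) auto
  have "expect (insert e F) p f = p * expect F p (\<lambda>S. f (insert e S)) + (1 - p) * expect F p f"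
    using insert by (simp add: expect_insert)
  also have "\<dots> \<le> p * expect F q (\<lambda>S. f (insert e S)) + (1 - p) * expect F q f"
  proof (intro add_mono mult_left_mono insert.IH)
    show "\<And>S T. S \<subseteq> T \<Longrightarrow> T \<subseteq> F \<Longrightarrow> f (insert e S) \<le> f (insert e T)"
      by (rule insert.prems) auto
    show "\<And>S T. S \<subseteq> T \<Longrightarrow> T \<subseteq> F \<Longrightarrow> f S \<le> f T"
      by (rule insert.prems) auto
  qed (use assms in auto)
  also have "\<dots> \<le> q * expect F q (\<lambda>S. f (insert e S)) + (1 - q) * expect F q f"
  proof -
    have "0 \<le> (q - p) * (expect F q (\<lambda>S. f (insert e S)) - expect F q f)"
      using sub assms by auto
    then show ?thesis by (simp add: algebra_simps)
  qed
  also have "\<dots> = expect (insert e F) q f"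
    using insert by (simp add: expect_insert)
  finally show ?case .
qed simp

section \<open>Clusters in finite configurations\<close>

text \<open>A set of sources instead of one vertex lets an open edge leaving \<open>H\<close> be
  absorbed by adding its far end to the sources, so the explored part of a cluster can itself serve
  as \<open>H\<close>.\<close>

definition reach :: "'v set set \<Rightarrow> 'v set \<Rightarrow> 'v set" where
  "reach S H = (adjacency S)\<^sup>* `` H"

abbreviation rsize :: "'v set set \<Rightarrow> 'v set \<Rightarrow> real" where
  "rsize S H \<equiv> real (card (reach S H))"

definition pairs :: "'v set set \<Rightarrow> bool" where
  "pairs F \<longleftrightarrow> (\<forall>e\<in>F. \<exists>x y. e = {x, y} \<and> x \<noteq> y)"

lemma pairs_subset: "pairs F \<Longrightarrow> G \<subseteq> F \<Longrightarrow> pairs G"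
  by (auto simp: pairs_def)

lemma pairsE:
  assumes "pairs F" "e \<in> F" "x \<in> e"
  obtains y where "e = {x, y}" "x \<noteq> y"
  using assms unfolding pairs_def by (metis empty_iff insert_commute insert_iff)

lemma reach_refl: "H \<subseteq> reach S H"
  by (auto simp: reach_def)

lemma reach_closed: "x \<in> reach S H \<Longrightarrow> {x, y} \<in> S \<Longrightarrow> y \<in> reach S H"
  by (auto simp: reach_def adjacency_def intro: rtrancl_into_rtrancl)

lemma reach_least:
  assumes "H \<subseteq> X" "\<And>x y. x \<in> X \<Longrightarrow> {x, y} \<in> S \<Longrightarrow> y \<in> X"
  shows "reach S H \<subseteq> X"
proof
  fix w assume "w \<in> reach S H"
  then obtain v where v: "v \<in> H" "(v, w) \<in> (adjacency S)\<^sup>*" by (auto simp: reach_def)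
  show "w \<in> X"
    using v(2) by (induction rule: rtrancl_induct) (use assms v(1) in \<open>auto simp: adjacency_def\<close>)
qed

lemma reach_mono:
  assumes "S \<subseteq> T" "H \<subseteq> K"
  shows "reach S H \<subseteq> reach T K"
proof (rule reach_least)
  show "H \<subseteq> reach T K" using assms(2) reach_refl by (rule subset_trans)
  fix x y assume "x \<in> reach T K" "{x, y} \<in> S"
  then show "y \<in> reach T K" using assms(1) by (metis reach_closed subsetD)
qed

lemma reach_insert: "reach S (insert y H) = reach S {y} \<union> reach S H"
  by (auto simp: reach_def)

lemma reach_sym: "u \<in> reach S {v} \<longleftrightarrow> v \<in> reach S {u}"
proof -
  have "sym (adjacency S)" by (auto simp: sym_def adjacency_def insert_commute)
  then have "sym ((adjacency S)\<^sup>*)" by (rule sym_rtrancl)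
  then show ?thesis by (auto simp: reach_def sym_def)
qed

lemma reach_subset_Union: "reach S H \<subseteq> H \<union> \<Union>S"
  by (rule reach_least) auto

lemma finite_reach:
  assumes "finite H" "finite S" "pairs S"
  shows "finite (reach S H)"
proof -
  have "finite (\<Union>S)" using assms by (auto simp: pairs_def)
  then show ?thesis
    using reach_subset_Union[of S H] assms finite_subset by blast
qed

lemma reach_insert_edge:
  assumes "x \<in> H"
  shows "reach (insert {x, y} S) H = reach S (insert y H)"
proof (rule subset_antisym)
  show "reach (insert {x, y} S) H \<subseteq> reach S (insert y H)"
  proof (rule reach_least)
    show "H \<subseteq> reach S (insert y H)" using reach_refl[of "insert y H" S] by auto
    fix a b assume a: "a \<in> reach S (insert y H)" and "{a, b} \<in> insert {x, y} S"
    then consider "{a, b} = {x, y}" | "{a, b} \<in> S" by auto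
    then show "b \<in> reach S (insert y H)"
    proof cases
      case 1
      then have "b = x \<or> b = y" by (auto simp: doubleton_eq_iff)
      then show ?thesis using assms reach_refl[of "insert y H" S] by auto
    qed (use a reach_closed in metis)
  qed
  show "reach S (insert y H) \<subseteq> reach (insert {x, y} S) H"
  proof (rule reach_least)
    have "x \<in> reach (insert {x, y} S) H" using assms reach_refl[of H] by blast
    then have "y \<in> reach (insert {x, y} S) H" by (rule reach_closed) simp
    then show "insert y H \<subseteq> reach (insert {x, y} S) H" using reach_refl[of H] by blast
    show "\<And>a b. a \<in> reach (insert {x, y} S) H \<Longrightarrow> {a, b} \<in> S \<Longrightarrow> b \<in> reach (insert {x, y} S) H"
      by (rule reach_closed) auto
  qed
qed

lemma reach_no_touch:
  assumes "\<And>e. e \<in> S \<Longrightarrow> e \<inter> H = {}"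
  shows "reach S H = H"
proof (rule subset_antisym[OF _ reach_refl])
  show "reach S H \<subseteq> H"
    by (rule reach_least) (use assms in blast)+
qed

lemma touching_insert:
  "touching_edges (insert e F) K = (if e \<inter> K = {} then touching_edges F K else insert e (touching_edges F K))"
  by (auto simp: touching_edges_def)

lemma finite_touching: "finite F \<Longrightarrow> finite (touching_edges F K)"
  by (simp add: touching_edges_def)

lemma touching_subset: "touching_edges F K \<subseteq> F"
  by (auto simp: touching_edges_def)

text \<open>Whether the cluster of \<open>H\<close> is exactly \<open>K\<close> is decided by the
  edges touching \<open>K\<close>: the open ones must stay inside, and edges away from
  \<open>K\<close> are never met.\<close>

lemma reach_eq_iff_touching:
  assumes "\<And>e. e \<in> T \<Longrightarrow> e \<inter> K = {}"
  shows "reach (S \<union> T) H = K \<longleftrightarrow> reach S H = K"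
proof
  assume K: "reach S H = K"
  have "reach (S \<union> T) H \<subseteq> K"
  proof (rule reach_least)
    show "H \<subseteq> K" using K reach_refl[of H S] by simp
    fix x y assume "x \<in> K" "{x, y} \<in> S \<union> T"
    then show "y \<in> K" using assms[of "{x,y}"] K reach_closed[of x S H y] by auto
  qed
  moreover have "K \<subseteq> reach (S \<union> T) H" using K reach_mono[of S "S \<union> T" H H] by auto
  ultimately show "reach (S \<union> T) H = K" by auto
next
  assume K: "reach (S \<union> T) H = K"
  have "reach (S \<union> T) H \<subseteq> reach S H"
  proof (rule reach_least)
    show "H \<subseteq> reach S H" by (rule reach_refl)
    fix x y assume x: "x \<in> reach S H" and e: "{x, y} \<in> S \<union> T"
    then have "x \<in> K" using K reach_mono[of S "S \<union> T" H H] by auto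
    with e assms[of "{x, y}"] have "{x, y} \<in> S" by auto
    then show "y \<in> reach S H" using x by (rule reach_closed[rotated])
  qed
  then show "reach S H = K" using K reach_mono[of S "S \<union> T" H H] by auto
qed

text \<open>The spatial Markov property: the event that the cluster of \<open>y\<close> is
  \<open>C\<close> inspects only edges touching \<open>C\<close>, so all others are fresh. The proof
  sums over the finitely many possible values of \<open>C\<close>.\<close>

lemma cluster_markov:
  assumes U: "finite U"
  shows "expect U p (\<lambda>S. h (reach S {y}) (S - touching_edges S (reach S {y})))
    = expect U p (\<lambda>S. expect (U - touching_edges U (reach S {y})) p (h (reach S {y})))"
proof -
  define \<C> where "\<C> = (\<lambda>S. reach S {y}) ` Pow U"
  have fin: "finite \<C>" using U by (simp add: \<C>_def)
  have split: "expect U p (\<lambda>S. k (reach S {y}) S)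
      = (\<Sum>C\<in>\<C>. expect U p (\<lambda>S. of_bool (reach S {y} = C) * k C S))" for k
  proof -
    have "expect U p (\<lambda>S. k (reach S {y}) S)
        = expect U p (\<lambda>S. \<Sum>C\<in>\<C>. of_bool (reach S {y} = C) * k C S)"
    proof (rule expect_cong)
      fix S assume "S \<subseteq> U"
      then have "reach S {y} \<in> \<C>" by (auto simp: \<C>_def)
      then have "k (reach S {y}) S = (\<Sum>C\<in>\<C>. if reach S {y} = C then k C S else 0)"
        using fin by simp
      also have "\<dots> = (\<Sum>C\<in>\<C>. of_bool (reach S {y} = C) * k C S)"
        by (intro sum.cong) auto
      finally show "k (reach S {y}) S = (\<Sum>C\<in>\<C>. of_bool (reach S {y} = C) * k C S)" .
    qed
    then show ?thesis by (simp add: expect_sum)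
  qed
  have each: "expect U p (\<lambda>S. of_bool (reach S {y} = C) * h C (S - touching_edges S C))
    = expect U p (\<lambda>S. of_bool (reach S {y} = C) * expect (U - touching_edges U C) p (h C))" for C
  proof -
    let ?A = "touching_edges U C"
    have A: "?A \<subseteq> U" by (rule touching_subset)
    have iff: "reach (S \<union> T) {y} = C \<longleftrightarrow> reach S {y} = C" if "T \<subseteq> U - ?A" for S T
      using that by (intro reach_eq_iff_touching) (auto simp: touching_edges_def)
    have "expect U p (\<lambda>S. of_bool (reach S {y} = C) * h C (S - touching_edges S C))
       = expect ?A p (\<lambda>S. expect (U - ?A) p (\<lambda>T. of_bool (reach S {y} = C) * h C T))"
      unfolding expect_split[OF U A]
    proof (intro expect_cong)
      fix S T assume "S \<subseteq> ?A" and T: "T \<subseteq> U - ?A"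
      then have "S \<union> T - touching_edges (S \<union> T) C = T"
        by (auto simp: touching_edges_def)
      then show "of_bool (reach (S \<union> T) {y} = C) * h C (S \<union> T - touching_edges (S \<union> T) C)
        = of_bool (reach S {y} = C) * h C T"
        by (simp add: iff[OF T])
    qed
    also have "\<dots> = expect ?A p (\<lambda>S. of_bool (reach S {y} = C) * expect (U - ?A) p (h C))"
      by (simp add: expect_cmult)
    also have "\<dots> = expect U p (\<lambda>S. of_bool (reach S {y} = C) * expect (U - ?A) p (h C))"
      by (rule expect_marginal[symmetric, OF U A]) (simp add: iff)
    finally show ?thesis .
  qed
  show ?thesis
    unfolding split[of "\<lambda>C S. h C (S - touching_edges S C)"]
      split[of "\<lambda>C S. expect (U - touching_edges U C) p (h C)"]
    by (simp add: each)
qed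

section \<open>Edge-by-edge exploration\<close>

text \<open>A state consists of the unrevealed edges \<open>F\<close> and the vertices
  \<open>H\<close> reached so far. Revealing \<open>{x, y}\<close> deletes the edge and adds
  \<open>y\<close> if it is open; \<open>y\<close> may already lie in \<open>H\<close>, and then
  both branches coincide.\<close>

lemma exploration_induct [consumes 3, case_names stop step]:
  assumes "finite F" "pairs F" "finite H"
    and stop: "\<And>F H. finite F \<Longrightarrow> finite H \<Longrightarrow> (\<And>e. e \<in> F \<Longrightarrow> e \<inter> H = {}) \<Longrightarrow> P F H"
    and step: "\<And>F H x y. finite F \<Longrightarrow> pairs (insert {x, y} F) \<Longrightarrow> finite H \<Longrightarrow> {x, y} \<notin> F \<Longrightarrow> x \<in> H \<Longrightarrow>
        P F (insert y H) \<Longrightarrow> P F H \<Longrightarrow> P (insert {x, y} F) H"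
  shows "P F H"
  using assms(1-3)
proof (induction "card F" arbitrary: F H rule: less_induct)
  case less
  show ?case
  proof (cases "\<forall>e\<in>F. e \<inter> H = {}")
    case True
    then show ?thesis using less.prems by (intro stop) auto
  next
    case False
    then obtain e x where e: "e \<in> F" "x \<in> e" "x \<in> H" by auto
    then obtain y where y: "e = {x, y}" using less.prems(2) by (elim pairsE)
    have F: "F = insert {x, y} (F - {e})" using e y by auto
    have "card (F - {e}) < card F" using e less.prems(1) by (intro card_Diff1_less)
    then have "P (F - {e}) K" if "finite K" for K
      using less.prems that by (intro less.hyps) (auto intro: pairs_subset)
    then have "P (insert {x, y} (F - {e})) H"
      using less.prems e y F by (intro step) auto
    then show ?thesis using F by simp
  qed
qed

text \<open>The expected final cluster size given the state \<open>(F, H)\<close> of the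
  exploration, hence the value of the Doob martingale; for a single vertex, the finite-volume
  susceptibility.\<close>

definition esize :: "'v set set \<Rightarrow> real \<Rightarrow> 'v set \<Rightarrow> real" where
  "esize F p H = expect F p (\<lambda>S. rsize S H)"

lemma card_reach_mono:
  assumes "finite K" "finite T" "pairs T" "S \<subseteq> T" "H \<subseteq> K"
  shows "card (reach S H) \<le> card (reach T K)"
  using assms by (intro card_mono finite_reach reach_mono)

lemma esize_mono_set:
  assumes "0 \<le> p" "p \<le> 1" "finite G" "pairs G" "F \<subseteq> G" "finite H"
  shows "esize F p H \<le> esize G p H"
  unfolding esize_def
proof (rule expect_mono_set)
  fix S T assume "S \<subseteq> T" "T \<subseteq> G"
  then show "rsize S H \<le> rsize T H"
    using assms finite_subset pairs_subset by (auto intro!: card_reach_mono)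
qed (use assms in auto)

lemma esize_mono_p:
  assumes "0 \<le> p" "p \<le> q" "q \<le> 1" "finite F" "pairs F" "finite H"
  shows "esize F p H \<le> esize F q H"
  unfolding esize_def
proof (rule expect_mono_p)
  fix S T assume "S \<subseteq> T" "T \<subseteq> F"
  then show "rsize S H \<le> rsize T H"
    using assms finite_subset pairs_subset by (auto intro!: card_reach_mono)
qed (use assms in auto)

text \<open>Opening an edge to \<open>y\<close> adds at most the cluster of \<open>y\<close>, so the
  two possible values of the Doob martingale after a step differ by at most a one-vertex
  expectation.\<close>

lemma esize_insert_vertex:
  assumes "0 \<le> p" "p \<le> 1" "finite F" "pairs F" "finite H"
  shows "esize F p H \<le> esize F p (insert y H)"
    and "esize F p (insert y H) \<le> esize F p H + esize F p {y}"
proof -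
  have fin: "finite (reach S K)" if "S \<subseteq> F" "finite K" for S K
    using that assms finite_subset pairs_subset by (metis finite_reach)
  show "esize F p H \<le> esize F p (insert y H)"
    unfolding esize_def using assms(1,2)
  proof (rule expect_mono)
    fix S assume "S \<subseteq> F"
    then show "rsize S H \<le> real (card (reach S (insert y H)))"
      using fin[of S "insert y H"] assms reach_mono[of S S H "insert y H"]
      by (auto intro!: card_mono)
  qed
  show "esize F p (insert y H) \<le> esize F p H + esize F p {y}"
    unfolding esize_def expect_add[symmetric] using assms(1,2)
  proof (rule expect_mono)
    fix S assume "S \<subseteq> F"
    show "real (card (reach S (insert y H))) \<le> rsize S H + rsize S {y}"
      unfolding reach_insert[of S y H] of_nat_add[symmetric] of_nat_le_iff
      using card_Un_le[of "reach S {y}" "reach S H"] by simp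
  qed
qed

lemma esize_insert_edge:
  assumes "finite F" "{x, y} \<notin> F" "x \<in> H"
  shows "esize (insert {x, y} F) p H = p * esize F p (insert y H) + (1 - p) * esize F p H"
  unfolding esize_def using assms by (simp add: expect_insert reach_insert_edge)

lemma card_touching_insert:
  assumes "finite F" "e \<notin> F" "e \<inter> K \<noteq> {}"
  shows "card (touching_edges (insert e F) K) = Suc (card (touching_edges F K))"
proof -
  have "e \<notin> touching_edges F K" using assms(2) by (simp add: touching_edges_def)
  then show ?thesis
    using assms by (simp add: touching_insert finite_touching)
qed

lemma card_touching_le:
  assumes "finite F" "finite K" "\<And>v. card {e\<in>F. v \<in> e} \<le> d"
  shows "card (touching_edges F K) \<le> d * card K"
proof -
  have "touching_edges F K = (\<Union>v\<in>K. {e\<in>F. v \<in> e})"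
    by (auto simp: touching_edges_def)
  then have "card (touching_edges F K) \<le> (\<Sum>v\<in>K. card {e\<in>F. v \<in> e})"
    using card_UN_le[OF assms(2)] by metis
  also have "\<dots> \<le> (\<Sum>v\<in>K. d)" by (intro sum_mono assms)
  finally show ?thesis by (simp add: mult.commute)
qed

text \<open>Under \<open>q\<close>, the conditional \<open>p\<close>-expectation of the size of the final cluster drifts upwards by
  at most \<open>(q - p) \<xi>\<close> per revealed edge.\<close>

lemma exploration_drift:
  assumes p: "0 \<le> p" "p \<le> q" "q \<le> 1"
    and "finite F" "pairs F" "finite H" "\<And>y. esize F p {y} \<le> \<xi>"
  shows "expect F q (\<lambda>S. rsize S H
      - (q - p) * \<xi> * real (card (touching_edges F (reach S H)))) \<le> esize F p H"
  using assms(4-7)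
proof (induction rule: exploration_induct)
  case (stop F H)
  have reach: "reach S H = H" if "S \<subseteq> F" for S
    using that stop(3) by (intro reach_no_touch) auto
  have touch: "touching_edges F H = {}"
    using stop(3) by (auto simp: touching_edges_def)
  have "expect F q (\<lambda>S. rsize S H - (q - p) * \<xi> * real (card (touching_edges F (reach S H))))
      = expect F q (\<lambda>_. real (card H))" "esize F p H = expect F p (\<lambda>_. real (card H))"
    unfolding esize_def by (rule expect_cong, simp add: reach touch)+
  then show ?case using stop(1) by (simp add: expect_const)
next
  case (step F H x y)
  let ?e = "{x, y}"
  let ?f = "\<lambda>G K S. rsize S K - (q - p) * \<xi> * real (card (touching_edges G (reach S K)))"
  have p': "0 \<le> p" "p \<le> 1" using p by auto
  have xH: "x \<in> reach S K" if "x \<in> K" for S K using that by (rule subsetD[OF reach_refl])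
  have pF: "pairs F" using step.hyps(2) by (auto intro: pairs_subset)
  have "esize F p {z} \<le> esize (insert ?e F) p {z}" for z
    using step.hyps p' by (intro esize_mono_set) auto
  then have Hy: "esize F p {z} \<le> \<xi>" for z
    using step.prems[of z] by (meson order_trans)
  have open_edge: "?f (insert ?e F) H (insert ?e S) = ?f F (insert y H) S - (q - p) * \<xi>" for S
    using step xH[of "insert y H" S] by (simp add: reach_insert_edge card_touching_insert algebra_simps)
  have closed_edge: "?f (insert ?e F) H S = ?f F H S - (q - p) * \<xi>" for S
    using step xH[of H S] by (simp add: card_touching_insert algebra_simps)
  let ?X1 = "esize F p (insert y H)" and ?X0 = "esize F p H"
  have "expect (insert ?e F) q (?f (insert ?e F) H)
      = q * (expect F q (?f F (insert y H)) - (q - p) * \<xi>) + (1 - q) * (expect F q (?f F H) - (q - p) * \<xi>)"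
    unfolding expect_insert[OF step.hyps(1,4)] open_edge
    unfolding closed_edge expect_diff[of F q _ "\<lambda>_. (q - p) * \<xi>"] expect_const[OF step.hyps(1)] ..
  also have "\<dots> \<le> q * (?X1 - (q - p) * \<xi>) + (1 - q) * (?X0 - (q - p) * \<xi>)"
    using step.IH Hy p by (intro add_mono mult_left_mono diff_mono) auto
  \<comment> \<open>Revealing the edge with density \<open>q\<close> in place of \<open>p\<close>
    raises the expectation by \<open>(q - p) * (?X1 - ?X0)\<close>; subadditivity lets
    \<open>(q - p) * \<xi>\<close> compensate this.\<close>
  also have "\<dots> = p * ?X1 + (1 - p) * ?X0 + (q - p) * (?X1 - ?X0 - \<xi>)"
    by (simp add: algebra_simps)
  also have "\<dots> \<le> p * ?X1 + (1 - p) * ?X0"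
    using esize_insert_vertex(2)[OF p' step.hyps(1) pF step.hyps(3), of y] Hy[of y] p
    by (auto simp: mult_le_0_iff)
  also have "\<dots> = esize (insert ?e F) p H"
    using step by (simp add: esize_insert_edge)
  finally show ?case .
qed

text \<open>At most \<open>d\<close> edges are revealed per vertex of the cluster, so the drift
  bound is a linear inequality for \<open>esize F q {v}\<close>, a finite number because
  \<open>F\<close> is finite, and its last term is absorbed. Thus a finite susceptibility survives a
  small increase of the density.\<close>

lemma esize_perturb:
  assumes p: "0 \<le> p" "p \<le> q" "q \<le> 1" and F: "finite F" "pairs F"
    and "\<And>y. esize F p {y} \<le> \<xi>" and deg: "\<And>v. card {e\<in>F. v \<in> e} \<le> d"
    and small: "(q - p) * \<xi> * real d < 1"
  shows "esize F q {v} \<le> \<xi> / (1 - (q - p) * \<xi> * real d)"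
proof -
  have "0 \<le> esize F p {v}" unfolding esize_def using p by (intro expect_nonneg) auto
  then have xi: "0 \<le> (q - p) * \<xi>" using assms(6)[of v] p by auto
  have "esize F q {v} * (1 - (q - p) * \<xi> * real d)
      = expect F q (\<lambda>S. (1 - (q - p) * \<xi> * real d) * rsize S {v})"
    unfolding esize_def expect_cmult by simp
  also have "\<dots> \<le> expect F q (\<lambda>S. rsize S {v}
      - (q - p) * \<xi> * real (card (touching_edges F (reach S {v}))))"
  proof (rule expect_mono)
    fix S assume "S \<subseteq> F"
    then have "finite (reach S {v})" using F finite_subset pairs_subset by (metis finite_reach finite.simps)
    then have "real (card (touching_edges F (reach S {v}))) \<le> real d * rsize S {v}"
      using card_touching_le[OF F(1) _ deg] by (metis of_nat_le_iff of_nat_mult)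
    then have "(q - p) * \<xi> * real (card (touching_edges F (reach S {v})))
        \<le> (q - p) * \<xi> * (real d * rsize S {v})"
      using xi by (rule mult_left_mono)
    then show "(1 - (q - p) * \<xi> * real d) * rsize S {v}
        \<le> rsize S {v} - (q - p) * \<xi> * real (card (touching_edges F (reach S {v})))"
      by (simp add: algebra_simps)
  qed (use p in auto)
  also have "\<dots> \<le> esize F p {v}"
    using assms by (intro exploration_drift) auto
  also have "\<dots> \<le> \<xi>" by (rule assms)
  finally show ?thesis using small by (simp add: pos_le_divide_eq)
qed

section \<open>Exponential and second moments of the cluster size\<close>

lemma exp_le_quadratic:
  fixes x :: real
  assumes "x \<le> 1"
  shows "exp x \<le> 1 + x + x\<^sup>2"
proof (cases "0 \<le> x")
  case True
  then show ?thesis using exp_bound[of x] assms by simp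
next
  case False
  have "1 - x \<le> exp (- x)" using exp_ge_add_one_self[of "-x"] by simp
  then have "exp x \<le> 1 / (1 - x)"
    using False by (simp add: exp_minus field_simps)
  also have "\<dots> \<le> 1 + x + x\<^sup>2"
  proof -
    have "(1 + x + x\<^sup>2) * (1 - x) = 1 - x ^ 3" by (simp add: algebra_simps power2_eq_square power3_eq_cube)
    moreover have "x ^ 3 \<le> 0" using False by (simp add: power_le_zero_eq)
    ultimately show ?thesis using False by (simp add: pos_divide_le_eq)
  qed
  finally show ?thesis .
qed

text \<open>Moment generating function of a centred Bernoulli step of height \<open>a\<close>: the
  linear terms cancel and the variance is at most \<open>a\<^sup>2\<close>. The constant is not
  sharp.\<close>

lemma two_point_exp_bound:
  fixes p a :: real
  assumes "0 \<le> p" "p \<le> 1" "0 \<le> a" "a \<le> 1"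
  shows "p * exp ((1 - p) * a) + (1 - p) * exp (- p * a) \<le> exp (a\<^sup>2)"
proof -
  have "p * exp ((1 - p) * a) \<le> p * (1 + (1 - p) * a + ((1 - p) * a)\<^sup>2)"
    using assms by (intro mult_left_mono exp_le_quadratic) (auto intro: mult_le_one)
  moreover have "- p * a \<le> 1" using assms by (smt (verit) mult_nonneg_nonneg mult_minus_left)
  then have "(1 - p) * exp (- p * a) \<le> (1 - p) * (1 + - p * a + (- p * a)\<^sup>2)"
    using assms by (intro mult_left_mono exp_le_quadratic) auto
  moreover have "p * (1 + (1 - p) * a + ((1 - p) * a)\<^sup>2) + (1 - p) * (1 + - p * a + (- p * a)\<^sup>2)
      = 1 + p * (1 - p) * a\<^sup>2"
    by (simp add: algebra_simps power2_eq_square)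
  moreover have "p * (1 - p) * a\<^sup>2 \<le> 1 * a\<^sup>2"
    using assms by (intro mult_right_mono mult_le_one) auto
  moreover have "1 + a\<^sup>2 \<le> exp (a\<^sup>2)" by simp
  ultimately show ?thesis by linarith
qed

text \<open>The Doob martingale \<open>E (|K| | revealed edges)\<close> has increments at most \<open>\<xi>\<close>, so it cannot grow
  linearly with the number of revealed edges, which is comparable to \<open>|K|\<close> (Azuma's inequality).\<close>

lemma exploration_exp_bound:
  assumes p: "0 \<le> p" "p \<le> 1" and l: "0 \<le> l" "l * \<xi> \<le> 1"
    and "finite F" "pairs F" "finite H" "\<And>y. esize F p {y} \<le> \<xi>"
  shows "expect F p (\<lambda>S. exp (l * rsize S H
      - (l * \<xi>)\<^sup>2 * real (card (touching_edges F (reach S H))))) \<le> exp (l * esize F p H)"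
  using assms(5-8)
proof (induction rule: exploration_induct)
  case (stop F H)
  have reach: "reach S H = H" if "S \<subseteq> F" for S
    using that stop(3) by (intro reach_no_touch) auto
  have touch: "touching_edges F H = {}"
    using stop(3) by (auto simp: touching_edges_def)
  have "expect F p (\<lambda>S. exp (l * rsize S H
        - (l * \<xi>)\<^sup>2 * real (card (touching_edges F (reach S H)))))
      = expect F p (\<lambda>_. exp (l * real (card H)))" "esize F p H = expect F p (\<lambda>_. real (card H))"
    unfolding esize_def by (rule expect_cong, simp add: reach touch)+
  then show ?case using stop(1) by (simp add: expect_const)
next
  case (step F H x y)
  let ?e = "{x, y}" and ?b = "(l * \<xi>)\<^sup>2"
  let ?f = "\<lambda>G K S. exp (l * rsize S K - ?b * real (card (touching_edges G (reach S K))))"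
  have xH: "x \<in> reach S K" if "x \<in> K" for S K using that by (rule subsetD[OF reach_refl])
  have pF: "pairs F" using step.hyps(2) by (auto intro: pairs_subset)
  have "esize F p {z} \<le> esize (insert ?e F) p {z}" for z
    using step.hyps p by (intro esize_mono_set) auto
  then have Hy: "esize F p {z} \<le> \<xi>" for z
    using step.prems[of z] by (meson order_trans)
  have open_edge: "?f (insert ?e F) H (insert ?e S) = exp (- ?b) * ?f F (insert y H) S" for S
    using step xH[of "insert y H" S]
    by (simp add: reach_insert_edge card_touching_insert algebra_simps flip: exp_add)
  have closed_edge: "?f (insert ?e F) H S = exp (- ?b) * ?f F H S" for S
    using step xH[of H S] by (simp add: card_touching_insert algebra_simps flip: exp_add)
  let ?X1 = "esize F p (insert y H)" and ?X0 = "esize F p H" and ?Y = "esize (insert ?e F) p H"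
  have X: "?Y = p * ?X1 + (1 - p) * ?X0"
    by (rule esize_insert_edge[OF step.hyps(1,4,5)])
  define a where "a = l * (?X1 - ?X0)"
  have "0 \<le> ?X1 - ?X0" "?X1 - ?X0 \<le> \<xi>"
    using esize_insert_vertex[OF p step.hyps(1) pF step.hyps(3), of y] Hy[of y] by auto
  then have a: "0 \<le> a" "a \<le> l * \<xi>" using l by (auto simp: a_def intro: mult_left_mono)
  have "expect (insert ?e F) p (?f (insert ?e F) H)
      = exp (- ?b) * (p * expect F p (?f F (insert y H)) + (1 - p) * expect F p (?f F H))"
    unfolding expect_insert[OF step.hyps(1,4)] open_edge
    unfolding closed_edge by (simp only: expect_cmult) (simp add: algebra_simps)
  also have "\<dots> \<le> exp (- ?b) * (p * exp (l * ?X1) + (1 - p) * exp (l * ?X0))"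
    using step.IH Hy p by (intro add_mono mult_left_mono) auto
  also have "p * exp (l * ?X1) + (1 - p) * exp (l * ?X0)
      = exp (l * ?Y) * (p * exp ((1 - p) * a) + (1 - p) * exp (- p * a))"
  proof -
    have "l * ?X1 = l * ?Y + (1 - p) * a" "l * ?X0 = l * ?Y + (- p * a)"
      by (simp_all add: X a_def algebra_simps)
    then show ?thesis by (simp only: exp_add) (simp add: algebra_simps)
  qed
  also have "exp (- ?b) * (exp (l * ?Y) * (p * exp ((1 - p) * a) + (1 - p) * exp (- p * a)))
      \<le> exp (- ?b) * (exp (l * ?Y) * exp (a\<^sup>2))"
    using a l p by (intro mult_left_mono two_point_exp_bound) auto
  also have "\<dots> \<le> exp (- ?b) * (exp (l * ?Y) * exp ?b)"
    using a by (intro mult_left_mono) (auto intro: power_mono)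
  also have "\<dots> = exp (l * ?Y)" by (simp flip: exp_add)
  finally show ?case .
qed

lemma exp_moment_bound:
  assumes p: "0 \<le> p" "p \<le> 1" and F: "finite F" "pairs F"
    and xi: "\<And>y. esize F p {y} \<le> \<xi>" "1 \<le> \<xi>"
    and deg: "\<And>v. card {e\<in>F. v \<in> e} \<le> d" and d: "1 \<le> d"
  defines "m \<equiv> 1 / (4 * real d * \<xi>\<^sup>2)"
  shows "expect F p (\<lambda>S. exp (m * rsize S {v})) \<le> exp (2 * m * \<xi>)"
proof -
  \<comment> \<open>This \<open>l\<close> maximises \<open>l - (l * \<xi>)\<^sup>2 * d\<close>, and
    the maximum is \<open>m\<close>. The factor \<open>d\<close> appears because the compensator
    counts edges and the exponent vertices.\<close>
  define l where "l = 2 * m"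
  have m: "0 < m" using xi d by (simp add: m_def)
  have "1 * 1 \<le> 2 * real d * \<xi>" using xi d by (intro mult_mono) auto
  then have l1: "l * \<xi> \<le> 1"
    using xi(2) d by (simp add: l_def m_def power2_eq_square field_simps)
  have ld: "l - (l * \<xi>)\<^sup>2 * real d = m"
    using xi(2) d by (simp add: l_def m_def power2_eq_square field_simps)
  have "expect F p (\<lambda>S. exp (m * rsize S {v}))
     \<le> expect F p (\<lambda>S. exp (l * rsize S {v}
      - (l * \<xi>)\<^sup>2 * real (card (touching_edges F (reach S {v})))))"
  proof (rule expect_mono)
    fix S assume "S \<subseteq> F"
    then have "finite (reach S {v})" using F finite_subset pairs_subset by (metis finite_reach finite.simps)
    then have "real (card (touching_edges F (reach S {v}))) \<le> real d * rsize S {v}"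
      using card_touching_le[OF F(1) _ deg] by (metis of_nat_le_iff of_nat_mult)
    then have "(l * \<xi>)\<^sup>2 * real (card (touching_edges F (reach S {v})))
        \<le> (l * \<xi>)\<^sup>2 * (real d * rsize S {v})"
      by (rule mult_left_mono) simp
    moreover have "m * rsize S {v}
        = l * rsize S {v} - (l * \<xi>)\<^sup>2 * (real d * rsize S {v})"
      unfolding ld[symmetric] by (simp add: algebra_simps)
    ultimately show "exp (m * rsize S {v}) \<le> exp (l * rsize S {v}
      - (l * \<xi>)\<^sup>2 * real (card (touching_edges F (reach S {v}))))"
      by simp
  qed (use p in auto)
  also have "\<dots> \<le> exp (l * esize F p {v})"
    using p F xi l1 m by (intro exploration_exp_bound) (auto simp: l_def)
  also have "\<dots> \<le> exp (2 * m * \<xi>)"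
    using xi(1)[of v] m by (simp add: l_def)
  finally show ?thesis .
qed

text \<open>Comparing the quadratic term of \<open>exp (m |K|)\<close> with
  \<open>exp (2 m \<xi>) \<le> 1 + 4 m \<xi>\<close> gives \<open>8 \<xi> / m\<close>. The power 3
  is that of the tree-graph bound, and it fixes the tilting scale used after sprinkling.\<close>

lemma second_moment_bound:
  assumes p: "0 \<le> p" "p \<le> 1" and F: "finite F" "pairs F"
    and xi: "\<And>y. esize F p {y} \<le> \<xi>" "1 \<le> \<xi>"
    and deg: "\<And>v. card {e\<in>F. v \<in> e} \<le> d" and d: "1 \<le> d"
  shows "expect F p (\<lambda>S. (rsize S {v})\<^sup>2) \<le> 32 * real d * \<xi> ^ 3"
proof -
  define m where "m = 1 / (4 * real d * \<xi>\<^sup>2)"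
  have m: "0 < m" using xi d by (simp add: m_def)
  have "1 * 1 \<le> real d * \<xi>" using xi d by (intro mult_mono) auto
  then have m1: "2 * m * \<xi> \<le> 1"
    using xi(2) d by (simp add: m_def power2_eq_square field_simps)
  have quad: "1 + x\<^sup>2 / 2 \<le> exp x" if "0 \<le> x" for x :: real
    using exp_lower_Taylor_quadratic[OF that] that by simp
  have "m\<^sup>2 / 2 * expect F p (\<lambda>S. (rsize S {v})\<^sup>2) + 1
      = expect F p (\<lambda>S. m\<^sup>2 / 2 * (rsize S {v})\<^sup>2 + 1)"
    by (simp only: expect_add expect_cmult expect_const[OF F(1)])
  also have "\<dots> \<le> expect F p (\<lambda>S. exp (m * rsize S {v}))"
    using p
  proof (rule expect_mono)
    fix S
    show "m\<^sup>2 / 2 * (rsize S {v})\<^sup>2 + 1 \<le> exp (m * rsize S {v})"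
      using quad[of "m * rsize S {v}"] m by (simp add: power_mult_distrib)
  qed
  also have "\<dots> \<le> exp (2 * m * \<xi>)"
    unfolding m_def using assms by (intro exp_moment_bound) auto
  also have "\<dots> \<le> 1 + 2 * m * \<xi> + (2 * m * \<xi>)\<^sup>2" using m1 by (rule exp_le_quadratic)
  also have "(2 * m * \<xi>)\<^sup>2 \<le> 2 * m * \<xi>"
    using m1 m xi(2) unfolding power2_eq_square by (intro mult_left_le) auto
  finally have "m\<^sup>2 * expect F p (\<lambda>S. (rsize S {v})\<^sup>2) \<le> m * (8 * \<xi>)"
    by (simp add: mult_ac)
  then have "m * expect F p (\<lambda>S. (rsize S {v})\<^sup>2) \<le> 8 * \<xi>"
    using m by (simp add: power2_eq_square mult.assoc)
  then show ?thesis
    using xi(2) d by (simp add: m_def field_simps power2_eq_square power3_eq_cube)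
qed

section \<open>Long-range boundary edges\<close>

definition tau :: "'v set set \<Rightarrow> real \<Rightarrow> 'v \<Rightarrow> 'v \<Rightarrow> real" where
  "tau F p u v = expect F p (\<lambda>S. of_bool (v \<in> reach S {u}))"

definition off :: "'v set set \<Rightarrow> 'v set \<Rightarrow> 'v set set" where
  "off F H = {e \<in> F. e \<inter> H = {}}"

definition bd :: "'v set set \<Rightarrow> 'v set \<Rightarrow> ('v \<times> 'v) set" where
  "bd F H = (SIGMA z:H. {y. y \<notin> H \<and> {z, y} \<in> F})"

text \<open>The outer end is tested in \<open>off F H\<close>, so \<open>\<theta>\<close> bounds
  from below the expected number of vertices that \<open>p\<close>-percolation would add to
  \<open>H\<close> behind the edge. Edges are collected rather than oriented pairs because the
  exploration counts them as they are revealed.\<close>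

definition good :: "'v set set \<Rightarrow> real \<Rightarrow> real \<Rightarrow> 'v set \<Rightarrow> 'v set set" where
  "good F p \<theta> H = {e \<in> F. \<exists>z y. e = {z, y} \<and> z \<in> H \<and> y \<notin> H \<and> \<theta> \<le> esize (off F H) p {y}}"

lemma off_subset: "off F H \<subseteq> F" by (auto simp: off_def)

lemma tau_nonneg: "0 \<le> p \<Longrightarrow> p \<le> 1 \<Longrightarrow> 0 \<le> tau F p u v"
  unfolding tau_def by (intro expect_nonneg) auto

lemma tau_sym: "tau F p u v = tau F p v u"
  unfolding tau_def reach_sym[of v] ..

lemma tau_mono_set:
  assumes "0 \<le> p" "p \<le> 1" "finite G" "F \<subseteq> G"
  shows "tau F p u v \<le> tau G p u v"
  unfolding tau_def
proof (rule expect_mono_set)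
  fix S T :: "'a set set" assume "S \<subseteq> T"
  then show "(of_bool (v \<in> reach S {u}) :: real) \<le> of_bool (v \<in> reach T {u})"
    using reach_mono[of S T "{u}" "{u}"] by auto
qed (use assms in auto)

lemma tau_mono_p:
  assumes "0 \<le> p" "p \<le> q" "q \<le> 1" "finite F"
  shows "tau F p u v \<le> tau F q u v"
  unfolding tau_def
proof (rule expect_mono_p)
  fix S T :: "'a set set" assume "S \<subseteq> T"
  then show "(of_bool (v \<in> reach S {u}) :: real) \<le> of_bool (v \<in> reach T {u})"
    using reach_mono[of S T "{u}" "{u}"] by auto
qed (use assms in auto)

lemma sum_tau_eq:
  assumes "finite W"
  shows "(\<Sum>u\<in>W. tau F p x u) = expect F p (\<lambda>S. real (card (reach S {x} \<inter> W)))"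
proof -
  have "(\<Sum>u\<in>W. of_bool (u \<in> reach S {x})) = real (card (reach S {x} \<inter> W))" for S
    using assms by (simp add: of_bool_def sum.If_cases Int_commute)
  then show ?thesis
    unfolding tau_def by (simp flip: expect_sum)
qed

lemma sum_tau_le:
  assumes "0 \<le> p" "p \<le> 1" "finite F" "pairs F" "finite W"
  shows "(\<Sum>u\<in>W. tau F p x u) \<le> esize F p {x}"
  unfolding sum_tau_eq[OF assms(5)] esize_def using assms(1,2)
proof (rule expect_mono)
  fix S assume "S \<subseteq> F"
  then have "finite (reach S {x})" using assms finite_subset pairs_subset by (metis finite_reach finite.simps)
  then show "real (card (reach S {x} \<inter> W)) \<le> rsize S {x}"
    by (auto intro: card_mono)
qed

lemma esize_eq_sum_tau:
  assumes "finite W" "{x} \<union> \<Union>F \<subseteq> W"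
  shows "esize F p {x} = (\<Sum>u\<in>W. tau F p x u)"
  unfolding sum_tau_eq[OF assms(1)] esize_def
proof (rule expect_cong)
  fix S assume "S \<subseteq> F"
  then have "reach S {x} \<subseteq> W" using reach_subset_Union[of S "{x}"] assms(2) by blast
  then show "rsize S {x} = real (card (reach S {x} \<inter> W))"
    by (simp add: Int_absorb2)
qed

lemma finite_bd:
  assumes "finite F" "finite H"
  shows "finite {y. y \<notin> H \<and> {z, y} \<in> F}" "card {y. y \<notin> H \<and> {z, y} \<in> F} \<le> card {e \<in> F. z \<in> e}"
    "finite (bd F H)"
proof -
  have inj: "inj_on (\<lambda>y. {z, y}) {y. y \<notin> H \<and> {z, y} \<in> F}" for z
    by (auto simp: inj_on_def doubleton_eq_iff)
  have sub: "(\<lambda>y. {z, y}) ` {y. y \<notin> H \<and> {z, y} \<in> F} \<subseteq> {e \<in> F. z \<in> e}" for z by auto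
  show fin: "finite {y. y \<notin> H \<and> {z, y} \<in> F}" for z
    using inj_on_finite[OF inj sub] assms by simp
  show "card {y. y \<notin> H \<and> {z, y} \<in> F} \<le> card {e \<in> F. z \<in> e}"
    using card_inj_on_le[OF inj sub] assms by simp
  show "finite (bd F H)"
    unfolding bd_def using assms fin by auto
qed

lemma sum_bd_le:
  assumes "finite F" "finite H" "\<And>v. card {e\<in>F. v \<in> e} \<le> d" "\<And>z. z \<in> H \<Longrightarrow> 0 \<le> (f z :: real)"
  shows "(\<Sum>(z, y)\<in>bd F H. f z) \<le> real d * (\<Sum>z\<in>H. f z)"
proof -
  have "(\<Sum>(z, y)\<in>bd F H. f z) = (\<Sum>z\<in>H. \<Sum>y\<in>{y. y \<notin> H \<and> {z, y} \<in> F}. f z)"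
    unfolding bd_def using assms finite_bd(1)[OF assms(1,2)] by (subst sum.Sigma) auto
  also have "\<dots> = (\<Sum>z\<in>H. real (card {y. y \<notin> H \<and> {z, y} \<in> F}) * f z)" by simp
  also have "\<dots> \<le> (\<Sum>z\<in>H. real d * f z)"
    using order_trans[OF finite_bd(2)[OF assms(1,2)] assms(3)] assms(4)
    by (intro sum_mono mult_right_mono) auto
  finally show ?thesis by (simp add: sum_distrib_left)
qed

text \<open>Follow the path from \<open>x\<close> to its first vertex in \<open>C\<close>. The edge
  used there is not in \<open>S\<close>, as its other end would then lie in \<open>C\<close>, so it
  comes from \<open>H\<close>; all earlier edges avoid \<open>C\<close>. The proof is by
  contradiction: without such an edge, the set reached while avoiding \<open>C\<close> is
  closed.\<close>

lemma reach_exit: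
  assumes x: "x \<in> H" and u: "u \<notin> H" and S: "\<And>e. e \<in> S \<Longrightarrow> e \<inter> H = {}"
    and T: "\<And>e. e \<in> T \<Longrightarrow> e \<inter> H \<noteq> {}" and conn: "u \<in> reach (S \<union> T) {x}"
  defines "C \<equiv> reach S {u}"
  shows "\<exists>z y. z \<in> H \<and> y \<notin> H \<and> {z, y} \<in> T \<and> y \<in> C
    \<and> z \<in> reach ((S - touching_edges S C) \<union> (T - touching_edges T C)) {x}"
proof (rule ccontr)
  assume no: "\<not> ?thesis"
  let ?R = "(S - touching_edges S C) \<union> (T - touching_edges T C)"
  have "C \<subseteq> - H" unfolding C_def
    by (rule reach_least) (use u S in blast)+
  then have CH: "C \<inter> H = {}" by auto
  have R: "e \<inter> C = {}" if "e \<in> ?R" for e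
    using that by (auto simp: touching_edges_def)
  have "reach ?R {x} \<subseteq> - C"
    by (rule reach_least) (use x CH R in blast)+
  then have XC: "reach ?R {x} \<inter> C = {}" by auto
  have "reach (S \<union> T) {x} \<subseteq> reach ?R {x}"
  proof (rule reach_least[OF reach_refl])
    fix a b assume a: "a \<in> reach ?R {x}" and e: "{a, b} \<in> S \<union> T"
    show "b \<in> reach ?R {x}"
    proof (cases "{a, b} \<inter> C = {}")
      case True
      then have "{a, b} \<in> ?R" using e by (auto simp: touching_edges_def)
      then show ?thesis using a reach_closed by metis
    next
      case False
      then have b: "b \<in> C" "a \<notin> C" using a XC by auto
      then have "{b, a} \<notin> S" using reach_closed[of b S "{u}" a] by (auto simp: C_def)
      then have "{a, b} \<in> T" using e by (auto simp: insert_commute)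
      moreover have "b \<notin> H" using b CH by auto
      ultimately have "a \<in> H" using T[of "{a, b}"] by auto
      then show ?thesis using no \<open>{a, b} \<in> T\<close> \<open>b \<notin> H\<close> b a by blast
    qed
  qed
  then have "u \<in> reach ?R {x}" using conn by auto
  moreover have "u \<in> C" unfolding C_def using reach_refl[of "{u}" S] by simp
  ultimately show False using XC by auto
qed

text \<open>The cluster of \<open>u\<close> off \<open>H\<close> is explored first; a path from \<open>x\<close> enters it through an edge
  leaving \<open>H\<close>, and up to that edge it only uses edges that the exploration has not seen.\<close>

lemma tau_exit:
  assumes p: "0 \<le> p" "p \<le> 1" and F: "finite F" and "finite H" "x \<in> H" "u \<notin> H"
  shows "tau F p x u \<le> (\<Sum>(z, y)\<in>bd F H. tau F p x z * tau (off F H) p y u)"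
proof -
  let ?U = "off F H" and ?V = "F - off F H"
  have UF: "?U \<subseteq> F" by (rule off_subset)
  have finU: "finite ?U" "finite ?V" using UF F finite_subset by auto
  \<comment> \<open>The probability that \<open>x\<close> reaches \<open>z\<close> without edges of
    \<open>T\<close> touching \<open>C\<close>, when \<open>S'\<close> is the open part off
    \<open>H\<close> that the exploration of \<open>C\<close> has not seen.\<close>
  define h where "h z C S' = expect ?V p (\<lambda>T. of_bool (z \<in> reach (S' \<union> (T - touching_edges T C)) {x}))"
    for z C S'
  have h: "expect (?U - touching_edges ?U C) p (h z C) \<le> tau F p x z" for z C
  proof -
    let ?U' = "?U - touching_edges ?U C"
    have "expect ?U' p (h z C) \<le> expect ?U' p (\<lambda>S. expect ?V p (\<lambda>T. of_bool (z \<in> reach (S \<union> T) {x})))"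
      unfolding h_def using p
    proof (intro expect_mono)
      fix S T :: "'a set set"
      show "(of_bool (z \<in> reach (S \<union> (T - touching_edges T C)) {x}) :: real) \<le> of_bool (z \<in> reach (S \<union> T) {x})"
        using reach_mono[of "S \<union> (T - touching_edges T C)" "S \<union> T" "{x}" "{x}"] by auto
    qed auto
    also have "\<dots> = tau (?U' \<union> ?V) p x z"
      unfolding tau_def using finU by (subst expect_union) auto
    also have "\<dots> \<le> tau F p x z"
      using p F UF by (intro tau_mono_set) auto
    finally show ?thesis .
  qed
  have "tau F p x u = expect ?U p (\<lambda>S. expect ?V p (\<lambda>T. of_bool (u \<in> reach (S \<union> T) {x})))"
    unfolding tau_def by (rule expect_split[OF F UF])
  also have "\<dots> \<le> expect ?U p (\<lambda>S. expect ?V p (\<lambda>T. \<Sum>(z, y)\<in>bd F H. of_bool (y \<in> reach S {u})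
      * of_bool (z \<in> reach ((S - touching_edges S (reach S {u})) \<union> (T - touching_edges T (reach S {u}))) {x})))"
    using p
  proof (intro expect_mono)
    fix S T assume S: "S \<subseteq> ?U" and T: "T \<subseteq> ?V"
    let ?f = "\<lambda>(z, y). of_bool (y \<in> reach S {u})
      * of_bool (z \<in> reach ((S - touching_edges S (reach S {u})) \<union> (T - touching_edges T (reach S {u}))) {x}) :: real"
    have nonneg: "0 \<le> ?f i" for i by (auto split: prod.split)
    show "of_bool (u \<in> reach (S \<union> T) {x}) \<le> sum ?f (bd F H)"
    proof (cases "u \<in> reach (S \<union> T) {x}")
      case True
      obtain z y where zy: "z \<in> H" "y \<notin> H" "{z, y} \<in> T" "y \<in> reach S {u}"
        "z \<in> reach ((S - touching_edges S (reach S {u})) \<union> (T - touching_edges T (reach S {u}))) {x}"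
        using reach_exit[OF assms(5,6) _ _ True] S T unfolding off_def by blast
      then have "(z, y) \<in> bd F H" using T by (auto simp: bd_def)
      then have "?f (z, y) \<le> sum ?f (bd F H)"
        using nonneg finite_bd(3)[OF F assms(4)] by (intro member_le_sum) auto
      then show ?thesis using zy by simp
    qed (use nonneg in \<open>auto intro: sum_nonneg\<close>)
  qed auto
  also have "\<dots> = (\<Sum>(z, y)\<in>bd F H. expect ?U p (\<lambda>S. of_bool (y \<in> reach S {u})
      * h z (reach S {u}) (S - touching_edges S (reach S {u}))))"
    unfolding h_def by (simp add: case_prod_unfold expect_sum expect_cmult)
  \<comment> \<open>Given the cluster of \<open>u\<close>, the remaining edges off \<open>H\<close>
    are fresh, which decouples the two connection events.\<close>
  also have "\<dots> = (\<Sum>(z, y)\<in>bd F H. expect ?U p (\<lambda>S. expect (?U - touching_edges ?U (reach S {u})) p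
      (\<lambda>S'. of_bool (y \<in> reach S {u}) * h z (reach S {u}) S')))"
    by (intro sum.cong refl, clarify) (rule cluster_markov[OF finU(1), of p "\<lambda>C S'. of_bool (_ \<in> C) * h _ C S'"])
  also have "\<dots> \<le> (\<Sum>(z, y)\<in>bd F H. tau F p x z * tau ?U p y u)"
  proof (intro sum_mono, clarify)
    fix z y
    have "expect ?U p (\<lambda>S. expect (?U - touching_edges ?U (reach S {u})) p
        (\<lambda>S'. of_bool (y \<in> reach S {u}) * h z (reach S {u}) S'))
      \<le> expect ?U p (\<lambda>S. tau F p x z * of_bool (y \<in> reach S {u}))"
      using p
    proof (rule expect_mono)
      fix S
      show "expect (?U - touching_edges ?U (reach S {u})) p (\<lambda>S'. of_bool (y \<in> reach S {u}) * h z (reach S {u}) S')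
        \<le> tau F p x z * of_bool (y \<in> reach S {u})"
        using h by (simp add: expect_cmult)
    qed
    also have "\<dots> = tau F p x z * tau ?U p y u"
      unfolding expect_cmult tau_sym[of ?U p y u] by (simp add: tau_def)
    finally show "expect ?U p (\<lambda>S. expect (?U - touching_edges ?U (reach S {u})) p
        (\<lambda>S'. of_bool (y \<in> reach S {u}) * h z (reach S {u}) S')) \<le> tau F p x z * tau ?U p y u" .
  qed
  finally show ?thesis .
qed

lemma card_good_eq:
  assumes "finite F"
  shows "card (good F p \<theta> H) = card {(z, y)\<in>bd F H. \<theta> \<le> esize (off F H) p {y}}"
proof -
  have "bij_betw (\<lambda>(z, y). {z, y}) {(z, y)\<in>bd F H. \<theta> \<le> esize (off F H) p {y}} (good F p \<theta> H)"
    unfolding bij_betw_def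
  proof
    show "inj_on (\<lambda>(z, y). {z, y}) {(z, y)\<in>bd F H. \<theta> \<le> esize (off F H) p {y}}"
      by (auto simp: inj_on_def bd_def doubleton_eq_iff)
    show "(\<lambda>(z, y). {z, y}) ` {(z, y)\<in>bd F H. \<theta> \<le> esize (off F H) p {y}} = good F p \<theta> H"
      by (auto simp: bd_def good_def image_def)
  qed
  then show ?thesis by (simp add: bij_betw_same_card)
qed

text \<open>By \<open>L\<^sup>2\<close>-boundedness the mass sent out by \<open>H\<close> cannot concentrate on few boundary edges.\<close>

lemma card_good_ge:
  assumes p: "0 \<le> p" "p \<le> 1" and F: "finite F" "pairs F" and H: "finite H"
    and deg: "\<And>v. card {e\<in>F. v \<in> e} \<le> d" and d: "1 \<le> d"
    and xi: "\<And>y. esize F p {y} \<le> \<xi>" and low: "\<And>x. x \<in> H \<Longrightarrow> a * \<xi> \<le> esize F p {x}"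
    and B: "0 < B" and L2: "\<And>W. finite W \<Longrightarrow> (\<Sum>u\<in>W. (\<Sum>x\<in>H. tau F p x u)\<^sup>2) \<le> B\<^sup>2 * real (card H)"
    and a: "0 < a" "2 * B \<le> a * \<xi>"
  shows "a\<^sup>2 / (16 * real d * B\<^sup>2) * real (card H) \<le> real (card (good F p (a / (4 * real d * B) * \<xi>) H))"
proof -
  define g where "g u = (\<Sum>x\<in>H. tau F p x u)" for u
  define eff where "eff y = esize (off F H) p {y}" for y
  \<comment> \<open>With this threshold the edges that are not good carry at most
    \<open>a * \<xi> / 4\<close> of the outgoing mass per vertex of \<open>H\<close>.\<close>
  define \<theta> where "\<theta> = a / (4 * real d * B) * \<xi>"
  define gb where "gb = {(z, y)\<in>bd F H. \<theta> \<le> eff y}"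
  define W where "W = H \<union> \<Union>F"
  have xipos: "0 < \<xi>" using a B by (smt (verit) zero_less_mult_pos)
  have finbd: "finite (bd F H)" by (rule finite_bd(3)[OF F(1) H])
  have finW: "finite W" using F H by (auto simp: W_def pairs_def)
  have g0: "0 \<le> g u" for u unfolding g_def by (intro sum_nonneg tau_nonneg p)
  have eff: "eff y \<le> \<xi>" for y
    unfolding eff_def using esize_mono_set[OF p F off_subset, of "{y}" H] xi[of y] by simp
  have amgm: "r \<le> (t * r\<^sup>2 + 1 / t) / 2" if "0 < t" for r t :: real
  proof -
    have "0 \<le> (t * r - 1)\<^sup>2 / t" using that by simp
    also have "(t * r - 1)\<^sup>2 / t = t * r\<^sup>2 - 2 * r + 1 / t"
      using that by (simp add: power2_eq_square field_simps)
    finally show ?thesis by simp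
  qed
  have L2H: "(\<Sum>u\<in>H. (g u)\<^sup>2) \<le> B\<^sup>2 * real (card H)"
    unfolding g_def by (rule L2[OF H])
  have gH: "(\<Sum>u\<in>H. g u) \<le> B * real (card H)"
  proof -
    have "(\<Sum>u\<in>H. g u) \<le> (\<Sum>u\<in>H. (1 / B * (g u)\<^sup>2 + B) / 2)"
      using amgm[of "1 / B"] B by (intro sum_mono) auto
    also have "\<dots> = (1 / B * (\<Sum>u\<in>H. (g u)\<^sup>2) + B * real (card H)) / 2"
      by (simp add: sum_divide_distrib[symmetric] sum.distrib sum_distrib_left mult.commute)
    also have "\<dots> \<le> (1 / B * (B\<^sup>2 * real (card H)) + B * real (card H)) / 2"
      using L2H B by (intro divide_right_mono add_right_mono mult_left_mono) auto
    also have "\<dots> = B * real (card H)" using B by (simp add: power2_eq_square)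
    finally show ?thesis .
  qed
  have out: "(\<Sum>u\<in>W - H. g u) \<le> (\<Sum>(z, y)\<in>bd F H. g z * eff y)"
  proof -
    have "(\<Sum>u\<in>W - H. g u) \<le> (\<Sum>u\<in>W - H. \<Sum>x\<in>H. \<Sum>(z, y)\<in>bd F H. tau F p x z * tau (off F H) p y u)"
      unfolding g_def by (intro sum_mono tau_exit p F H) auto
    also have "\<dots> = (\<Sum>u\<in>W - H. \<Sum>(z, y)\<in>bd F H. g z * tau (off F H) p y u)"
      unfolding g_def by (subst sum.swap) (simp add: case_prod_unfold sum_distrib_right)
    also have "\<dots> = (\<Sum>(z, y)\<in>bd F H. g z * (\<Sum>u\<in>W - H. tau (off F H) p y u))"
      by (subst sum.swap) (simp add: case_prod_unfold sum_distrib_left)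
    also have "\<dots> \<le> (\<Sum>(z, y)\<in>bd F H. g z * eff y)"
    proof (intro sum_mono, clarify)
      fix z y
      show "g z * (\<Sum>u\<in>W - H. tau (off F H) p y u) \<le> g z * eff y"
        unfolding eff_def using F off_subset[of F H] finW p
        by (intro mult_left_mono sum_tau_le g0) (auto intro: finite_subset pairs_subset)
    qed
    finally show ?thesis .
  qed
  have th0: "0 \<le> \<theta>" using a B xipos by (simp add: \<theta>_def)
  have split: "(\<Sum>(z, y)\<in>bd F H. g z * eff y) \<le> \<theta> * (\<Sum>(z, y)\<in>bd F H. g z) + \<xi> * (\<Sum>(z, y)\<in>gb. g z)"
  proof -
    have "(\<Sum>(z, y)\<in>bd F H. g z * eff y)
       \<le> (\<Sum>(z, y)\<in>bd F H. \<theta> * g z + (if \<theta> \<le> eff y then \<xi> * g z else 0))"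
    proof (intro sum_mono, clarify)
      fix z y
      show "g z * eff y \<le> \<theta> * g z + (if \<theta> \<le> eff y then \<xi> * g z else 0)"
      proof (cases "\<theta> \<le> eff y")
        case True
        have "g z * eff y \<le> g z * \<xi>" using eff g0 by (intro mult_left_mono) auto
        moreover have "0 \<le> \<theta> * g z" using th0 g0 by simp
        ultimately show ?thesis using True by (simp add: mult.commute)
      next
        case False
        then have "g z * eff y \<le> g z * \<theta>" using g0 by (intro mult_left_mono) auto
        then show ?thesis using False by (simp add: mult.commute)
      qed
    qed
    also have "\<dots> = \<theta> * (\<Sum>(z, y)\<in>bd F H. g z) + (\<Sum>(z, y)\<in>bd F H. if \<theta> \<le> eff y then \<xi> * g z else 0)"
      by (simp add: case_prod_unfold sum.distrib sum_distrib_left)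
    also have "(\<Sum>(z, y)\<in>bd F H. if \<theta> \<le> eff y then \<xi> * g z else 0) = \<xi> * (\<Sum>(z, y)\<in>gb. g z)"
      unfolding gb_def sum_distrib_left case_prod_unfold
      using finbd by (subst sum.inter_filter[symmetric]) auto
    finally show ?thesis .
  qed
  \<comment> \<open>Chosen so that the squares in the bound over the good edges contribute at most
    \<open>a * \<xi> / 8\<close> per vertex of \<open>H\<close>.\<close>
  define t where "t = a / (4 * real d * B\<^sup>2)"
  have t: "0 < t" using a B d by (simp add: t_def)
  have gbd: "(\<Sum>(z, y)\<in>bd F H. g z) \<le> real d * (B * real (card H))"
    using sum_bd_le[OF F(1) H deg, of g] g0 gH d by (smt (verit) mult_left_mono of_nat_0_le_iff)
  have ggb: "(\<Sum>(z, y)\<in>gb. g z) \<le> (t * (real d * (B\<^sup>2 * real (card H))) + real (card gb) / t) / 2"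
  proof -
    have "(\<Sum>(z, y)\<in>gb. g z) \<le> (\<Sum>(z, y)\<in>gb. (t * (g z)\<^sup>2 + 1 / t) / 2)"
      using amgm[OF t] by (intro sum_mono) auto
    also have "\<dots> = (t * (\<Sum>(z, y)\<in>gb. (g z)\<^sup>2) + real (card gb) / t) / 2"
      by (simp add: case_prod_unfold sum_divide_distrib[symmetric] sum.distrib sum_distrib_left)
    also have "(\<Sum>(z, y)\<in>gb. (g z)\<^sup>2) \<le> (\<Sum>(z, y)\<in>bd F H. (g z)\<^sup>2)"
      using finbd by (intro sum_mono2) (auto simp: gb_def)
    also have "\<dots> \<le> real d * (\<Sum>z\<in>H. (g z)\<^sup>2)"
      by (rule sum_bd_le[OF F(1) H deg]) auto
    also have "\<dots> \<le> real d * (B\<^sup>2 * real (card H))"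
      using L2H by (intro mult_left_mono) auto
    finally show ?thesis using t by (simp add: divide_right_mono mult_left_mono)
  qed
  \<comment> \<open>The mass budget: at most a half stays in \<open>H\<close>, a quarter leaves
    through edges that are not good and an eighth is the quadratic term, so the last eighth must be
    covered by the number of good edges.\<close>
  have "a * \<xi> * real (card H) = (\<Sum>x\<in>H. a * \<xi>)" by simp
  also have "\<dots> \<le> (\<Sum>x\<in>H. \<Sum>u\<in>W. tau F p x u)"
  proof (rule sum_mono)
    fix x assume x: "x \<in> H"
    have "esize F p {x} = (\<Sum>u\<in>W. tau F p x u)"
      using x by (intro esize_eq_sum_tau finW) (auto simp: W_def)
    then show "a * \<xi> \<le> (\<Sum>u\<in>W. tau F p x u)" using low[OF x] by simp
  qed
  also have "\<dots> = (\<Sum>u\<in>W. g u)" unfolding g_def by (rule sum.swap)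
  also have "\<dots> = (\<Sum>u\<in>W - H. g u) + (\<Sum>u\<in>H. g u)"
    using finW by (intro sum.subset_diff) (auto simp: W_def)
  also have "\<dots> \<le> (\<theta> * (real d * (B * real (card H)))
      + \<xi> * ((t * (real d * (B\<^sup>2 * real (card H))) + real (card gb) / t) / 2)) + B * real (card H)"
    using out split gH mult_left_mono[OF gbd th0] mult_left_mono[OF ggb, of \<xi>] xipos by linarith
  also have "\<theta> * (real d * (B * real (card H))) = a * \<xi> / 4 * real (card H)"
    using d B by (simp add: \<theta>_def)
  also have "t * (real d * (B\<^sup>2 * real (card H))) = a / 4 * real (card H)"
    using d B by (simp add: t_def)
  also have "B * real (card H) \<le> a * \<xi> / 2 * real (card H)"
    using a by (intro mult_right_mono) auto
  finally have fin: "a * \<xi> * real (card H) \<le> a * \<xi> / 4 * real (card H)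
      + \<xi> * ((a / 4 * real (card H) + real (card gb) / t) / 2) + a * \<xi> / 2 * real (card H)"
    by simp
  define X Y where "X = a * \<xi> * real (card H)" and "Y = \<xi> * (real (card gb) / t)"
  have "X \<le> X / 4 + (X / 8 + Y / 2) + X / 2"
    using fin by (simp add: X_def Y_def add_divide_distrib distrib_left mult_ac)
  then have "X / 8 \<le> Y / 2" by linarith
  then have "\<xi> * (a / 8 * real (card H)) \<le> \<xi> * (real (card gb) / t / 2)"
    by (simp add: X_def Y_def mult_ac)
  then have "a / 8 * real (card H) \<le> real (card gb) / t / 2"
    using xipos by (simp only: mult_le_cancel_left_pos)
  then have "a / 4 * t * real (card H) \<le> real (card gb)"
    using t by (simp add: field_simps)
  moreover have "a / 4 * t = a\<^sup>2 / (16 * real d * B\<^sup>2)"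
    by (simp add: t_def power2_eq_square)
  moreover have "card gb = card (good F p \<theta> H)"
    unfolding card_good_eq[OF F(1)] gb_def eff_def ..
  ultimately show ?thesis by (simp add: \<theta>_def)
qed

section \<open>Finite clusters after sprinkling\<close>

text \<open>Edges of \<open>S\<close> touching \<open>C\<close> lead nowhere new once all of
  \<open>C\<close> is a source, so they may be dropped; edges of \<open>X\<close> touching
  \<open>C\<close> may still lead out of it and are kept.\<close>

lemma reach_reveal:
  fixes S X :: "'v set set" and y :: 'v
  defines "C \<equiv> reach S {y}"
  shows "reach (S \<union> X) (insert y H) = reach ((S - touching_edges S C) \<union> X) (H \<union> C)"
proof (rule subset_antisym)
  let ?R = "reach ((S - touching_edges S C) \<union> X) (H \<union> C)"
  have yC: "y \<in> C" using reach_refl[of "{y}" S] by (simp add: C_def)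
  have HC: "H \<union> C \<subseteq> ?R" by (rule reach_refl)
  show "reach (S \<union> X) (insert y H) \<subseteq> ?R"
  proof (rule reach_least)
    show "insert y H \<subseteq> ?R" using HC yC by auto
    fix a b assume a: "a \<in> ?R" and e: "{a, b} \<in> S \<union> X"
    show "b \<in> ?R"
    proof (cases "{a, b} \<in> touching_edges S C")
      case True
      then have "{a, b} \<in> S" "a \<in> C \<or> b \<in> C" by (auto simp: touching_edges_def)
      then have "b \<in> C" using reach_closed[of a S "{y}" b] by (auto simp: C_def)
      then show ?thesis using HC by auto
    next
      case False
      then show ?thesis using a e by (intro reach_closed[OF a]) (simp add: touching_edges_def)
    qed
  qed
  show "?R \<subseteq> reach (S \<union> X) (insert y H)"
  proof (rule reach_least)
    have "C \<subseteq> reach (S \<union> X) (insert y H)" unfolding C_def by (rule reach_mono) auto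
    then show "H \<union> C \<subseteq> reach (S \<union> X) (insert y H)"
      using reach_refl[of "insert y H" "S \<union> X"] by auto
    fix a b assume "a \<in> reach (S \<union> X) (insert y H)" "{a, b} \<in> S - touching_edges S C \<union> X"
    then show "b \<in> reach (S \<union> X) (insert y H)" using reach_closed[of a _ _ b] by auto
  qed
qed

text \<open>Every edge off \<open>H\<close> is open with probability \<open>q = p + s - p s\<close>; its \<open>p\<close>-open part is revealed
  around \<open>y\<close>, after which the edges touching the \<open>p\<close>-cluster \<open>C\<close> of \<open>y\<close> are still open with
  probability \<open>s\<close>.\<close>

lemma expect_reveal:
  assumes F: "finite F" and A: "finite A" "A \<inter> off F H = {}"
  shows "expect (off F H) (p + s - p * s) (\<lambda>S. expect A s (\<lambda>T. \<Phi> (reach (S \<union> T) (insert y H))))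
    = expect (off F H) p (\<lambda>S. expect (off F (H \<union> reach S {y})) (p + s - p * s)
        (\<lambda>S'. expect (A \<union> touching_edges (off F H) (reach S {y})) s
          (\<lambda>T. \<Phi> (reach (S' \<union> T) (H \<union> reach S {y})))))"
proof -
  let ?U = "off F H" and ?q = "p + s - p * s"
  have U: "finite ?U" using F by (simp add: off_def)
  \<comment> \<open>\<open>S'\<close> is the \<open>p\<close>-open part not touching
    \<open>C\<close>, \<open>S2\<close> the sprinkling off \<open>H\<close>, and \<open>T\<close>
    the sprinkling on the pending edges.\<close>
  define h where "h C S' = expect ?U s (\<lambda>S2. expect A s (\<lambda>T. \<Phi> (reach (S' \<union> S2 \<union> T) (H \<union> C))))" for C S'
  have offeq: "off F (H \<union> C) = ?U - touching_edges ?U C" for C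
    by (auto simp: off_def touching_edges_def)
  have "expect ?U ?q (\<lambda>S. expect A s (\<lambda>T. \<Phi> (reach (S \<union> T) (insert y H))))
     = expect ?U p (\<lambda>S. h (reach S {y}) (S - touching_edges S (reach S {y})))"
    unfolding expect_sprinkle[OF U] h_def Un_assoc
    unfolding reach_reveal[of _ _ y H] ..
  also have "\<dots> = expect ?U p (\<lambda>S. expect (?U - touching_edges ?U (reach S {y})) p (h (reach S {y})))"
    by (rule cluster_markov[OF U])
  also have "\<dots> = expect ?U p (\<lambda>S. expect (off F (H \<union> reach S {y})) ?q
        (\<lambda>S'. expect (A \<union> touching_edges ?U (reach S {y})) s (\<lambda>T. \<Phi> (reach (S' \<union> T) (H \<union> reach S {y})))))"
  proof (rule expect_cong)
    fix S
    let ?C = "reach S {y}"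
    let ?T = "touching_edges ?U ?C"
    have T: "?T \<subseteq> ?U" "finite ?T" "A \<inter> ?T = {}"
      using A U touching_subset[of ?U ?C] by (auto intro: finite_subset)
    have UT: "finite (?U - ?T)" "(?U - ?T) \<union> ?T = ?U" using U T by auto
    \<comment> \<open>On edges away from \<open>?C\<close> both layers are unknown and recombine to
      density \<open>?q\<close>; on edges touching \<open>?C\<close> only the sprinkled layer is
      left, and they join \<open>A\<close>.\<close>
    have "h ?C S' = expect (?U - ?T) s (\<lambda>S2. expect (A \<union> ?T) s (\<lambda>T. \<Phi> (reach (S' \<union> S2 \<union> T) (H \<union> ?C))))" for S'
    proof -
      have "h ?C S' = expect (?U - ?T) s (\<lambda>S2. expect ?T s (\<lambda>S3. expect A s
          (\<lambda>T. \<Phi> (reach (S' \<union> (S2 \<union> S3) \<union> T) (H \<union> ?C)))))"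
        unfolding h_def using expect_union[OF UT(1) T(2), of s] UT(2) by auto
      also have "\<dots> = expect (?U - ?T) s (\<lambda>S2. expect (?T \<union> A) s (\<lambda>T. \<Phi> (reach (S' \<union> S2 \<union> T) (H \<union> ?C))))"
        using T A by (subst expect_union) (auto simp: Un_assoc)
      finally show ?thesis by (simp add: Un_commute)
    qed
    then have "expect (?U - ?T) p (h ?C)
      = expect (?U - ?T) p (\<lambda>S'. expect (?U - ?T) s (\<lambda>S2. expect (A \<union> ?T) s (\<lambda>T. \<Phi> (reach (S' \<union> S2 \<union> T) (H \<union> ?C)))))"
      by (intro expect_cong)
    also have "\<dots> = expect (off F (H \<union> ?C)) ?q (\<lambda>S'. expect (A \<union> ?T) s (\<lambda>T. \<Phi> (reach (S' \<union> T) (H \<union> ?C))))"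
      unfolding offeq expect_sprinkle[OF UT(1)] ..
    finally show "expect (?U - ?T) p (h ?C)
      = expect (off F (H \<union> ?C)) ?q (\<lambda>S'. expect (A \<union> ?T) s (\<lambda>T. \<Phi> (reach (S' \<union> T) (H \<union> ?C))))" .
  qed
  finally show ?thesis .
qed

text \<open>Enlarging \<open>K\<close> shrinks \<open>off F K\<close>, so an edge that is good for
  the final cluster already passed the threshold when it was met at the earlier stage
  \<open>H\<close>. Hence a weight defined through the final cluster can be paid for during the
  exploration.\<close>

lemma good_edge_bound:
  assumes p: "0 \<le> p" "p \<le> 1" and F: "finite F" "pairs F" and HK: "H \<subseteq> K"
    and xy: "x \<in> H" "{x, y} \<in> good F p \<theta> K"
  shows "y \<notin> K" "\<theta> \<le> esize (off F H) p {y}"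
proof -
  obtain z w where zw: "{x, y} = {z, w}" "z \<in> K" "w \<notin> K" "\<theta> \<le> esize (off F K) p {w}"
    using xy(2) by (auto simp: good_def)
  have w: "w = y" using zw(1,3) xy(1) HK by (auto simp: doubleton_eq_iff)
  show "y \<notin> K" using zw w by simp
  have "esize (off F K) p {y} \<le> esize (off F H) p {y}"
    using HK F off_subset[of F H] p by (intro esize_mono_set) (auto simp: off_def intro: pairs_subset)
  then show "\<theta> \<le> esize (off F H) p {y}" using zw(4) w by simp
qed

text \<open>The sprinkled cluster is explored in blocks: \<open>H\<close> is a union of fully explored \<open>p\<close>-clusters and
  \<open>A\<close> is the set of edges touching \<open>H\<close> whose sprinkled state is unknown. Revealing an edge that is good
  for the final cluster costs \<open>exp b\<close> and gains because its block is likely to be large.\<close>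

lemma sprinkled_cluster_weight:
  fixes F :: "'v set set"
  assumes p: "0 \<le> p" "p \<le> 1" and s: "0 \<le> s" "s \<le> 1" and F: "finite F" "pairs F"
    and l: "0 \<le> l" and b: "0 \<le> b"
    and gain: "\<And>H y. finite H \<Longrightarrow> \<theta> \<le> esize (off F H) p {y} \<Longrightarrow>
      exp b * (1 - s * (1 - expect (off F H) p (\<lambda>S. exp (- l * rsize S {y})))) \<le> 1"
  defines "wt \<equiv> \<lambda>K D. exp (- l * real (card K) + b * real (card (good F p \<theta> K \<inter> D)))"
  assumes A: "A \<subseteq> F" "\<And>e. e \<in> A \<Longrightarrow> e \<inter> H \<noteq> {}" and H: "finite H"
  shows "expect (off F H) (p + s - p * s) (\<lambda>S. expect A s (\<lambda>T. wt (reach (S \<union> T) H) (A \<union> off F H)))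
    \<le> exp (- l * real (card H))"
  using A H
proof (induction "card (A \<union> off F H)" arbitrary: A H rule: less_induct)
  case less
  note A = less.prems(1,2) and H = less.prems(3)
  let ?U = "off F H" and ?q = "p + s - p * s"
  have q: "0 \<le> ?q" "?q \<le> 1" by (rule sprinkle_range[OF p s])+
  have U: "finite ?U" "pairs ?U" using F off_subset[of F H] by (auto intro: finite_subset pairs_subset)
  have finA: "finite A" using A F finite_subset by auto
  have disj: "A \<inter> ?U = {}" using A(2) by (auto simp: off_def)
  have finF: "finite G" if "G \<subseteq> F" for G using that F finite_subset by auto
  have L1: "expect ?U p (\<lambda>S. exp (- l * rsize S {y})) \<le> 1" for y
  proof -
    have "expect ?U p (\<lambda>S. exp (- l * rsize S {y})) \<le> expect ?U p (\<lambda>_. 1)"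
      using p l by (intro expect_mono) auto
    then show ?thesis using U by (simp add: expect_const)
  qed
  show ?case
  proof (cases "A = {}")
    \<comment> \<open>Nothing is pending, so the cluster is \<open>H\<close>, and none of the edges
      still counted in the weight meets it.\<close>
    case True
    have "reach S H = H" if "S \<subseteq> ?U" for S
      using that by (intro reach_no_touch) (auto simp: off_def)
    moreover have "good F p \<theta> H \<inter> ?U = {}" by (auto simp: good_def off_def)
    ultimately have "expect ?U ?q (\<lambda>S. expect A s (\<lambda>T. wt (reach (S \<union> T) H) (A \<union> ?U)))
        = expect ?U ?q (\<lambda>_. exp (- l * real (card H)))"
      unfolding True wt_def by (intro expect_cong) simp
    then show ?thesis using U by (simp add: expect_const)
  next
    case False
    then obtain e where e: "e \<in> A" by auto
    then obtain x where x: "x \<in> e" "x \<in> H" using A(2)[of e] by auto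
    obtain y where y: "e = {x, y}" using pairsE[OF F(2) _ x(1)] e A(1) by blast
    define A' where "A' = A - {e}"
    have AA': "A = insert e A'" "e \<notin> A'" "finite A'" "A' \<subseteq> F" "A' \<inter> ?U = {}"
      using e A finA disj by (auto simp: A'_def)
    have "A' \<union> ?U \<subset> A \<union> ?U" using AA' e disj by auto
    then have smaller: "card (A' \<union> ?U) < card (A \<union> ?U)"
      using finA U by (intro psubset_card_mono) auto
    have touchA': "f \<inter> H \<noteq> {}" if "f \<in> A'" for f using that A(2) by (auto simp: A'_def)
    have wt0: "0 \<le> wt K D" for K D by (simp add: wt_def)
    have closed: "expect ?U ?q (\<lambda>S. expect A' s (\<lambda>T. wt (reach (S \<union> T) H) (A' \<union> ?U)))
        \<le> exp (- l * real (card H))"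
      using smaller AA'(4) touchA' H by (rule less.hyps)
    have ins: "expect ?U ?q (\<lambda>S. expect A s (\<lambda>T. wt (reach (S \<union> T) H) D))
      = s * expect ?U ?q (\<lambda>S. expect A' s (\<lambda>T. wt (reach (S \<union> T) (insert y H)) D))
      + (1 - s) * expect ?U ?q (\<lambda>S. expect A' s (\<lambda>T. wt (reach (S \<union> T) H) D))" for D
      unfolding AA'(1) expect_insert[OF AA'(3,2)] expect_add expect_cmult Un_insert_right
      unfolding y reach_insert_edge[OF x(2)] ..
    show ?thesis
    proof (cases "y \<in> H")
      \<comment> \<open>An edge with both ends in \<open>H\<close> does not change the cluster and
        is not good for any set containing \<open>H\<close>.\<close>
      case True
      have "wt (reach (S \<union> T) H) (A \<union> ?U) = wt (reach (S \<union> T) H) (A' \<union> ?U)" for S T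
      proof -
        have "e \<notin> good F p \<theta> (reach (S \<union> T) H)"
          using good_edge_bound(1)[OF p F reach_refl x(2), of y] True reach_refl[of H "S \<union> T"] y by auto
        then show ?thesis unfolding wt_def AA'(1) by auto
      qed
      then show ?thesis
        using closed True unfolding ins by (simp add: insert_absorb algebra_simps)
    next
      case False
      \<comment> \<open>The reward is charged only if \<open>y\<close> passes the threshold now,
        which is necessary for \<open>e\<close> to be good in the end.\<close>
      define b' where "b' = (if \<theta> \<le> esize ?U p {y} then b else 0)"
      define L where "L = expect ?U p (\<lambda>S. exp (- l * rsize S {y}))"
      have wt_le: "wt (reach (S \<union> T) K) (A \<union> ?U) \<le> exp b' * wt (reach (S \<union> T) K) (A' \<union> ?U)"
        if K: "H \<subseteq> K" for S T K
      proof -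
        let ?K = "reach (S \<union> T) K" and ?D = "A' \<union> ?U"
        have "b * real (card (good F p \<theta> ?K \<inter> (A \<union> ?U))) \<le> b' + b * real (card (good F p \<theta> ?K \<inter> ?D))"
        proof (cases "e \<in> good F p \<theta> ?K")
          case True
          have "H \<subseteq> ?K" using that reach_refl by (rule subset_trans)
          then have "b' = b" using good_edge_bound(2)[OF p F _ x(2), of ?K y] True y by (simp add: b'_def)
          moreover have "card (good F p \<theta> ?K \<inter> (A \<union> ?U)) \<le> Suc (card (good F p \<theta> ?K \<inter> ?D))"
          proof -
            have "good F p \<theta> ?K \<inter> (A \<union> ?U) \<subseteq> insert e (good F p \<theta> ?K \<inter> ?D)" using AA' by auto
            moreover have "finite (good F p \<theta> ?K \<inter> ?D)" using AA' U by auto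
            then have "card (insert e (good F p \<theta> ?K \<inter> ?D)) \<le> Suc (card (good F p \<theta> ?K \<inter> ?D))"
              by (simp add: card_insert_if)
            ultimately show ?thesis
              using \<open>finite (good F p \<theta> ?K \<inter> ?D)\<close> card_mono[of "insert e (good F p \<theta> ?K \<inter> ?D)"]
              by (meson finite_insert order_trans)
          qed
          ultimately show ?thesis
            using b mult_left_mono[of "real (card (good F p \<theta> ?K \<inter> (A \<union> ?U)))"
                "1 + real (card (good F p \<theta> ?K \<inter> ?D))" b]
            by (simp add: distrib_left)
        next
          case False
          then have "good F p \<theta> ?K \<inter> (A \<union> ?U) = good F p \<theta> ?K \<inter> ?D" using AA' by auto
          then show ?thesis using b by (simp add: b'_def)
        qed
        then show ?thesis unfolding wt_def by (simp flip: exp_add)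
      qed
      \<comment> \<open>If \<open>e\<close> is opened, the whole \<open>p\<close>-cluster of
        \<open>y\<close> is merged into \<open>H\<close> and the edges touching it become pending;
        the state is still smaller than before, because \<open>e\<close> itself is gone.\<close>
      have opened: "expect ?U ?q (\<lambda>S. expect A' s (\<lambda>T. wt (reach (S \<union> T) (insert y H)) (A' \<union> ?U)))
        \<le> exp (- l * real (card H)) * L"
      proof -
        have "expect ?U ?q (\<lambda>S. expect A' s (\<lambda>T. wt (reach (S \<union> T) (insert y H)) (A' \<union> ?U)))
          = expect ?U p (\<lambda>S. expect (off F (H \<union> reach S {y})) ?q
            (\<lambda>S'. expect (A' \<union> touching_edges ?U (reach S {y})) s
              (\<lambda>T. wt (reach (S' \<union> T) (H \<union> reach S {y})) (A' \<union> ?U))))"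
          using AA' F(1) by (intro expect_reveal) auto
        also have "\<dots> \<le> expect ?U p (\<lambda>S. exp (- l * real (card H)) * exp (- l * rsize S {y}))"
          using p
        proof (rule expect_mono)
          fix S assume S: "S \<subseteq> ?U"
          let ?C = "reach S {y}"
          let ?A = "A' \<union> touching_edges ?U ?C"
          have C: "finite ?C" using S U by (intro finite_reach) (auto intro: finite_subset pairs_subset)
          have "?C \<subseteq> - H"
            by (rule reach_least) (use False S in \<open>auto simp: off_def\<close>)
          then have card: "card (H \<union> ?C) = card H + card ?C"
            using H C by (intro card_Un_disjoint) auto
          have D: "?A \<union> off F (H \<union> ?C) = A' \<union> ?U"
            by (auto simp: off_def touching_edges_def)
          have "expect (off F (H \<union> ?C)) ?q (\<lambda>S'. expect ?A s
              (\<lambda>T. wt (reach (S' \<union> T) (H \<union> ?C)) (?A \<union> off F (H \<union> ?C)))) \<le> exp (- l * real (card (H \<union> ?C)))"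
          proof (rule less.hyps)
            show "card (?A \<union> off F (H \<union> ?C)) < card (A \<union> ?U)" unfolding D by (rule smaller)
            show "?A \<subseteq> F" using AA'(4) touching_subset[of ?U ?C] off_subset[of F H] by auto
            show "f \<inter> (H \<union> ?C) \<noteq> {}" if "f \<in> ?A" for f
              using that touchA'[of f] by (auto simp: touching_edges_def)
            show "finite (H \<union> ?C)" using H C by auto
          qed
          then show "expect (off F (H \<union> ?C)) ?q (\<lambda>S'. expect ?A s
              (\<lambda>T. wt (reach (S' \<union> T) (H \<union> ?C)) (A' \<union> ?U)))
            \<le> exp (- l * real (card H)) * exp (- l * real (card ?C))"
            unfolding D card by (simp add: algebra_simps flip: exp_add)
        qed
        also have "\<dots> = exp (- l * real (card H)) * L" by (simp add: expect_cmult L_def)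
        finally show ?thesis .
      qed
      have "expect ?U ?q (\<lambda>S. expect A s (\<lambda>T. wt (reach (S \<union> T) H) (A \<union> ?U)))
        \<le> s * (exp b' * (exp (- l * real (card H)) * L)) + (1 - s) * (exp b' * exp (- l * real (card H)))"
      proof -
        have "expect ?U ?q (\<lambda>S. expect A' s (\<lambda>T. wt (reach (S \<union> T) K) (A \<union> ?U)))
          \<le> exp b' * expect ?U ?q (\<lambda>S. expect A' s (\<lambda>T. wt (reach (S \<union> T) K) (A' \<union> ?U)))"
          if "H \<subseteq> K" for K
          unfolding expect_cmult[symmetric] using q s wt_le[OF that] by (intro expect_mono) auto
        from this[of "insert y H"] this[of H] opened closed
        have "expect ?U ?q (\<lambda>S. expect A' s (\<lambda>T. wt (reach (S \<union> T) (insert y H)) (A \<union> ?U)))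
            \<le> exp b' * (exp (- l * real (card H)) * L)"
          "expect ?U ?q (\<lambda>S. expect A' s (\<lambda>T. wt (reach (S \<union> T) H) (A \<union> ?U)))
            \<le> exp b' * exp (- l * real (card H))"
          by (meson order_trans mult_left_mono exp_ge_zero subset_insertI subset_refl)+
        then show ?thesis unfolding ins using s by (intro add_mono mult_left_mono) auto
      qed
      \<comment> \<open>One step multiplies the bound by \<open>exp b' * (1 - s * (1 - L))\<close>:
        with probability \<open>s\<close> the edge opens and brings the factor \<open>L\<close>.
        Above the threshold this is at most 1 by \<open>gain\<close>, below it because
        \<open>b' = 0\<close>.\<close>
      also have "\<dots> = exp (- l * real (card H)) * (exp b' * (1 - s * (1 - L)))"
        by (simp add: algebra_simps)
      also have "\<dots> \<le> exp (- l * real (card H)) * 1"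
      proof (intro mult_left_mono)
        show "exp b' * (1 - s * (1 - L)) \<le> 1"
        proof (cases "\<theta> \<le> esize ?U p {y}")
          case True
          then show ?thesis using gain[OF H True] by (simp add: b'_def L_def)
        next
          case False
          have "0 \<le> s * (1 - L)" using s L1[of y] by (auto simp: L_def)
          then show ?thesis using False by (simp add: b'_def)
        qed
      qed auto
      finally show ?thesis by simp
    qed
  qed
qed

lemma exp_neg_le_quadratic:
  fixes x :: real
  assumes "0 \<le> x"
  shows "exp (- x) \<le> 1 - x + x\<^sup>2 / 2"
proof -
  have "1 + x + x\<^sup>2 / 2 \<le> exp x" using exp_lower_Taylor_quadratic[OF assms] .
  moreover have "0 < 1 + x + x\<^sup>2 / 2" using assms by (simp add: add_pos_nonneg)
  ultimately have "exp (- x) \<le> 1 / (1 + x + x\<^sup>2 / 2)"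
    by (simp add: exp_minus inverse_eq_divide frac_le)
  also have "\<dots> \<le> 1 - x + x\<^sup>2 / 2"
  proof -
    have "(1 - x + x\<^sup>2 / 2) * (1 + x + x\<^sup>2 / 2) = 1 + (x\<^sup>2)\<^sup>2 / 4"
      by (simp add: algebra_simps power2_eq_square)
    then show ?thesis using \<open>0 < 1 + x + x\<^sup>2 / 2\<close> by (simp add: pos_divide_le_eq)
  qed
  finally show ?thesis .
qed

text \<open>Each good edge earns \<open>b\<close> and each vertex costs \<open>l\<close>; a cluster
  \<open>K\<close> in \<open>\<H>\<close> has at least
  \<open>a\<^sup>2 / (16 d B\<^sup>2) |K|\<close> good edges, so its weight dominates
  \<open>exp (l |K|)\<close>. The family is finite because a finite volume can give the lower bound
  \<open>low\<close> only to the vertices chosen beforehand.\<close>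

proposition sprinkled_cluster_bound:
  fixes F :: "'v set set"
  assumes p: "0 \<le> p" "p \<le> 1" and s: "0 \<le> s" "s \<le> 1" and F: "finite F" "pairs F"
    and deg: "\<And>v. card {e\<in>F. v \<in> e} \<le> d" and d: "1 \<le> d"
    and xi: "\<And>y. esize F p {y} \<le> \<xi>" "1 \<le> \<xi>"
    and a: "0 < a" "2 * B \<le> a * \<xi>" and B: "0 < B"
    and \<H>: "finite \<H>" "\<And>K. K \<in> \<H> \<Longrightarrow> finite K"
    and low: "\<And>K x. K \<in> \<H> \<Longrightarrow> x \<in> K \<Longrightarrow> a * \<xi> \<le> esize F p {x}"
    and L2: "\<And>K W. K \<in> \<H> \<Longrightarrow> finite W \<Longrightarrow> (\<Sum>u\<in>W. (\<Sum>x\<in>K. tau F p x u)\<^sup>2) \<le> B\<^sup>2 * real (card K)"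
    and big: "256 * (real d)\<^sup>2 * B ^ 3 / a ^ 3 \<le> s * \<xi>"
  defines "l \<equiv> a / (128 * (real d)\<^sup>2 * B * \<xi>\<^sup>2)"
  shows "(\<Sum>K\<in>\<H>. expect F (p + s - p * s) (\<lambda>S. of_bool (reach S {v} = K)) * exp (l * real (card K))) \<le> exp (- l)"
proof -
  let ?q = "p + s - p * s"
  \<comment> \<open>\<open>c * \<xi>\<close> is the threshold of \<open>card_good_ge\<close> and
    \<open>M\<close> bounds the second moment; \<open>l\<close> equals \<open>\<theta> / M\<close>,
    so that the quadratic loss is half of the linear gain, and \<open>b\<close> is \<open>s\<close>
    times the remaining half.\<close>
  define c where "c = a / (4 * real d * B)"
  define \<theta> where "\<theta> = c * \<xi>"
  define M where "M = 32 * real d * \<xi> ^ 3"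
  define b where "b = s * l * \<theta> / 2"
  have pos: "0 < c" "0 < \<theta>" "0 < M" "0 < l" using a B d xi by (auto simp: c_def \<theta>_def M_def l_def)
  have lM: "l * M = \<theta>"
    using d B xi by (simp add: l_def M_def \<theta>_def c_def field_simps power2_eq_square power3_eq_cube)
  have b0: "0 \<le> b" using s pos by (simp add: b_def)
  have q: "0 \<le> ?q" "?q \<le> 1" by (rule sprinkle_range[OF p s])+
  have gain: "exp b * (1 - s * (1 - expect (off F H) p (\<lambda>S. exp (- l * rsize S {y})))) \<le> 1"
    if \<theta>: "\<theta> \<le> esize (off F H) p {y}" for H y
  proof -
    let ?U = "off F H"
    have U: "finite ?U" "pairs ?U" using F off_subset[of F H] by (auto intro: finite_subset pairs_subset)
    have degU: "card {e\<in>?U. v \<in> e} \<le> d" for v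
      using card_mono[of "{e\<in>F. v \<in> e}" "{e\<in>?U. v \<in> e}"] F off_subset[of F H] deg[of v] by force
    have xiU: "esize ?U p {z} \<le> \<xi>" for z
      using esize_mono_set[OF p F off_subset, of "{z}" H] xi(1)[of z] by simp
    have M: "expect ?U p (\<lambda>S. (rsize S {y})\<^sup>2) \<le> M"
      unfolding M_def by (rule second_moment_bound[OF p U xiU xi(2) degU d])
    have "expect ?U p (\<lambda>S. exp (- l * rsize S {y}))
      \<le> expect ?U p (\<lambda>S. (1 - l * rsize S {y}) + l\<^sup>2 / 2 * (rsize S {y})\<^sup>2)"
      using p
    proof (rule expect_mono)
      fix S
      show "exp (- l * rsize S {y})
        \<le> (1 - l * rsize S {y}) + l\<^sup>2 / 2 * (rsize S {y})\<^sup>2"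
        using exp_neg_le_quadratic[of "l * rsize S {y}"] pos by (simp add: power_mult_distrib)
    qed
    also have "\<dots> = 1 - l * esize ?U p {y} + l\<^sup>2 / 2 * expect ?U p (\<lambda>S. (rsize S {y})\<^sup>2)"
      by (simp only: expect_add expect_diff expect_cmult expect_const[OF U(1)] esize_def)
    also have "\<dots> \<le> 1 - l * \<theta> + l\<^sup>2 / 2 * M"
      using M \<theta> pos by (intro add_mono diff_mono mult_left_mono) auto
    also have "l\<^sup>2 / 2 * M = l * \<theta> / 2" by (simp add: power2_eq_square mult.assoc lM)
    finally have "l * \<theta> / 2 \<le> 1 - expect ?U p (\<lambda>S. exp (- l * rsize S {y}))"
      unfolding times_divide_eq_left by linarith
    then have "s * (l * \<theta> / 2) \<le> s * (1 - expect ?U p (\<lambda>S. exp (- l * rsize S {y})))"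
      using s(1) by (rule mult_left_mono)
    then have "b \<le> s * (1 - expect ?U p (\<lambda>S. exp (- l * rsize S {y})))"
      by (simp add: b_def mult.assoc)
    then have "1 - s * (1 - expect ?U p (\<lambda>S. exp (- l * rsize S {y}))) \<le> 1 + - b" by simp
    also have "\<dots> \<le> exp (- b)" by (rule exp_ge_add_one_self)
    finally have "exp b * (1 - s * (1 - expect ?U p (\<lambda>S. exp (- l * rsize S {y}))))
      \<le> exp b * exp (- b)" by (intro mult_left_mono) auto
    then show ?thesis by (simp flip: exp_add)
  qed
  define wt where "wt K D = exp (- l * real (card K) + b * real (card (good F p \<theta> K \<inter> D)))" for K D
  \<comment> \<open>The exploration starts from the fully revealed \<open>p\<close>-cluster of
    \<open>v\<close>, with every edge touching it pending.\<close>
  have "expect F ?q (\<lambda>S. wt (reach S {v}) F)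
    = expect F p (\<lambda>S. expect (off F (reach S {v})) ?q (\<lambda>S'. expect (touching_edges F (reach S {v})) s
          (\<lambda>T. wt (reach (S' \<union> T) (reach S {v})) F)))"
    using expect_reveal[of F "{}" "{}" p s "\<lambda>K. wt K F" v] F by (simp add: off_def)
  also have "\<dots> \<le> expect F p (\<lambda>S. exp (- l))"
    using p
  proof (rule expect_mono)
    fix S assume S: "S \<subseteq> F"
    let ?C = "reach S {v}"
    let ?A = "touching_edges F ?C"
    have C: "finite ?C" using S F by (intro finite_reach) (auto intro: finite_subset pairs_subset)
    have D: "?A \<union> off F ?C = F" by (auto simp: off_def touching_edges_def)
    have "v \<in> ?C" using reach_refl[of "{v}" S] by simp
    then have "1 \<le> card ?C" using C by (metis One_nat_def Suc_leI card_gt_0_iff empty_iff)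
    have "expect (off F ?C) ?q (\<lambda>S'. expect ?A s (\<lambda>T. wt (reach (S' \<union> T) ?C) (?A \<union> off F ?C)))
      \<le> exp (- l * real (card ?C))"
      unfolding wt_def
      using C pos touching_subset[of F ?C]
      by (intro sprinkled_cluster_weight[OF p s F _ b0 gain]) (auto simp: touching_edges_def)
    also have "\<dots> \<le> exp (- l)" using \<open>1 \<le> card ?C\<close> pos by simp
    finally show "expect (off F ?C) ?q (\<lambda>S'. expect ?A s (\<lambda>T. wt (reach (S' \<union> T) ?C) F)) \<le> exp (- l)"
      unfolding D .
  qed
  also have "\<dots> = exp (- l)" using F by (simp add: expect_const)
  finally have main: "expect F ?q (\<lambda>S. wt (reach S {v}) F) \<le> exp (- l)" .
  have wt: "exp (l * real (card K)) \<le> wt K F" if K: "K \<in> \<H>" for K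
  proof -
    have gF: "good F p \<theta> K \<inter> F = good F p \<theta> K" by (auto simp: good_def)
    have "a\<^sup>2 / (16 * real d * B\<^sup>2) * real (card K) \<le> real (card (good F p \<theta> K))"
      unfolding \<theta>_def c_def
      by (rule card_good_ge[OF p F \<H>(2)[OF K] deg d xi(1) low[OF K] B L2[OF K] a])
    then have "b * (a\<^sup>2 / (16 * real d * B\<^sup>2) * real (card K)) \<le> b * real (card (good F p \<theta> K))"
      using b0 by (rule mult_left_mono)
    \<comment> \<open>The constant 256 in \<open>big\<close> is exactly what this comparison
      requires.\<close>
    moreover have "2 * l \<le> b * (a\<^sup>2 / (16 * real d * B\<^sup>2))"
    proof -
      have "2 * l = (l * a ^ 3 / (128 * (real d)\<^sup>2 * B ^ 3)) * (256 * (real d)\<^sup>2 * B ^ 3 / a ^ 3)"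
        using a B d by simp
      also have "\<dots> \<le> (l * a ^ 3 / (128 * (real d)\<^sup>2 * B ^ 3)) * (s * \<xi>)"
        using a B d pos by (intro mult_left_mono big) auto
      also have "\<dots> = b * (a\<^sup>2 / (16 * real d * B\<^sup>2))"
        by (simp add: b_def \<theta>_def c_def power2_eq_square power3_eq_cube mult_ac)
      finally show ?thesis .
    qed
    then have "2 * l * real (card K) \<le> b * (a\<^sup>2 / (16 * real d * B\<^sup>2)) * real (card K)"
      by (rule mult_right_mono) simp
    ultimately show ?thesis unfolding wt_def gF by (simp add: algebra_simps)
  qed
  have "(\<Sum>K\<in>\<H>. expect F ?q (\<lambda>S. of_bool (reach S {v} = K)) * exp (l * real (card K)))
     = expect F ?q (\<lambda>S. \<Sum>K\<in>\<H>. exp (l * real (card K)) * of_bool (reach S {v} = K))"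
    by (simp add: expect_sum expect_cmult mult.commute)
  also have "\<dots> \<le> expect F ?q (\<lambda>S. wt (reach S {v}) F)"
    using q
  proof (rule expect_mono)
    fix S
    have "(\<Sum>K\<in>\<H>. exp (l * real (card K)) * of_bool (reach S {v} = K))
      = (\<Sum>K\<in>\<H>. if reach S {v} = K then exp (l * real (card K)) else 0)"
      by (intro sum.cong) auto
    also have "\<dots> = (if reach S {v} \<in> \<H> then exp (l * rsize S {v}) else 0)"
      using \<H>(1) by simp
    also have "\<dots> \<le> wt (reach S {v}) F" using wt by (auto simp: wt_def)
    finally show "(\<Sum>K\<in>\<H>. exp (l * real (card K)) * of_bool (reach S {v} = K)) \<le> wt (reach S {v}) F" .
  qed
  finally show ?thesis using main by simp
qed

section \<open>Percolation events and finite expectations\<close>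

lemma reach_finite_subset:
  assumes "w \<in> reach S H"
  obtains F where "finite F" "F \<subseteq> S" "w \<in> reach F H"
proof -
  obtain v where v: "v \<in> H" "(v, w) \<in> (adjacency S)\<^sup>*" using assms by (auto simp: reach_def)
  from v(2) have "\<exists>F. finite F \<and> F \<subseteq> S \<and> w \<in> reach F H"
  proof (induction rule: rtrancl_induct)
    case base
    show ?case using v(1) reach_refl[of H "{}"] by (intro exI[of _ "{}"]) auto
  next
    case (step y z)
    then obtain F where F: "finite F" "F \<subseteq> S" "y \<in> reach F H" by auto
    have "y \<in> reach (insert {y, z} F) H" using F(3) reach_mono[of F "insert {y, z} F" H H] by auto
    then have "z \<in> reach (insert {y, z} F) H" by (rule reach_closed) simp
    moreover have "{y, z} \<in> S" using step by (simp add: adjacency_def)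
    ultimately show ?case using F by (intro exI[of _ "insert {y, z} F"]) auto
  qed
  then show ?thesis using that by auto
qed

lemma cluster_eq_reach: "cluster E \<omega> v = reach {e \<in> E. \<omega> e} {v}"
  by (auto simp: cluster_def reach_def)

locale lf_graph =
  fixes V :: "'v set" and E :: "'v set set"
  assumes simple: "simple_graph V E"
    and connected: "connected_graph V E"
    and lf: "locally_finite_graph V E"
begin

lemma pairs_E: "pairs E"
  using simple unfolding simple_graph_def pairs_def by blast

lemma pairs_sub: "F \<subseteq> E \<Longrightarrow> pairs F"
  using pairs_E by (rule pairs_subset)

lemma edge_subset: "e \<in> E \<Longrightarrow> e \<subseteq> V"
  using simple by (auto simp: simple_graph_def)

lemma reach_subset_V: "S \<subseteq> E \<Longrightarrow> H \<subseteq> V \<Longrightarrow> reach S H \<subseteq> V"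
  using edge_subset by (intro reach_least) auto

lemma finite_touching_E:
  assumes "finite H" "H \<subseteq> V"
  shows "finite (touching_edges E H)"
proof -
  have "touching_edges E H = (\<Union>v\<in>H. {e\<in>E. v \<in> e})" by (auto simp: touching_edges_def)
  then show ?thesis using assms lf by (auto simp: locally_finite_graph_def)
qed

lemma countable_V: "countable V"
proof -
  obtain v where v: "v \<in> V" using connected by (auto simp: connected_graph_def)
  have sub: "(adjacency E ^^ n) `` {v} \<subseteq> V" for n
  proof (induction n)
    case (Suc n)
    have "(adjacency E ^^ Suc n) `` {v} = adjacency E `` ((adjacency E ^^ n) `` {v})" by auto
    also have "\<dots> \<subseteq> V" using edge_subset by (auto simp: adjacency_def)
    finally show ?case .
  qed (use v in auto)
  have fin: "finite ((adjacency E ^^ n) `` {v})" for n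
  proof (induction n)
    case (Suc n)
    let ?B = "(adjacency E ^^ n) `` {v}"
    have "(adjacency E ^^ Suc n) `` {v} = adjacency E `` ?B" by auto
    also have "\<dots> \<subseteq> \<Union>(touching_edges E ?B)" by (auto simp: adjacency_def touching_edges_def)
    finally have "(adjacency E ^^ Suc n) `` {v} \<subseteq> \<Union>(touching_edges E ?B)" .
    moreover have "finite (touching_edges E ?B)" using Suc sub by (rule finite_touching_E)
    then have "finite (\<Union>(touching_edges E ?B))"
      using pairs_sub[OF touching_subset[of E ?B]] by (auto simp: pairs_def)
    ultimately show ?case using finite_subset by blast
  qed simp
  have "V \<subseteq> (\<Union>n. (adjacency E ^^ n) `` {v})"
    using v connected by (auto simp: connected_graph_def rtrancl_is_UN_relpow)
  moreover have "countable (\<Union>n. (adjacency E ^^ n) `` {v})"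
    using fin by (intro countable_UN) (auto intro: countable_finite)
  ultimately show ?thesis using countable_subset by blast
qed

lemma countable_E: "countable E"
proof -
  have "E \<subseteq> (\<lambda>(u, v). {u, v}) ` (V \<times> V)"
    using simple by (auto simp: simple_graph_def)
  then show ?thesis using countable_V countable_subset by (meson countable_SIGMA countable_image)
qed

lemma finite_exhaustion:
  obtains F :: "nat \<Rightarrow> 'v set set"
  where "\<And>k. finite (F k)" "\<And>k. F k \<subseteq> E" "incseq F" "\<And>G. finite G \<Longrightarrow> G \<subseteq> E \<Longrightarrow> \<exists>k. G \<subseteq> F k"
proof
  let ?F = "\<lambda>k. {e \<in> E. to_nat_on E e < k}"
  show "finite (?F k)" for k
  proof -
    have "inj_on (to_nat_on E) (?F k)"
      using inj_on_to_nat_on[OF countable_E] by (rule inj_on_subset) auto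
    moreover have "to_nat_on E ` ?F k \<subseteq> {..<k}" by auto
    ultimately show ?thesis using inj_on_finite by blast
  qed
  show "?F k \<subseteq> E" for k by auto
  show "incseq ?F" by (auto simp: incseq_def)
  show "\<exists>k. G \<subseteq> ?F k" if "finite G" "G \<subseteq> E" for G
  proof
    show "G \<subseteq> ?F (Suc (Max (to_nat_on E ` G)))" using that by (auto simp: le_imp_less_Suc)
  qed
qed

abbreviation "perc \<equiv> percolation E"

abbreviation "ae_finite p \<equiv> AE \<omega> in perc p. \<forall>v\<in>V. finite (cluster E \<omega> v)"

lemma prob_space_perc: "prob_space (perc p)"
  unfolding percolation_def by (intro prob_space_PiM prob_space_measure_pmf)

text \<open>An event decided by finitely many edges is a finite disjoint union of cylinders. This is
  the bridge from the product measure to \<open>expect\<close>.\<close>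

lemma measure_config:
  assumes p: "0 \<le> p" "p \<le> 1" and F: "finite F" "F \<subseteq> E"
  shows "{\<omega> \<in> space (perc p). Q {e \<in> F. \<omega> e}} \<in> sets (perc p)"
    and "measure (perc p) {\<omega> \<in> space (perc p). Q {e \<in> F. \<omega> e}} = expect F p (\<lambda>S. of_bool (Q S))"
proof -
  interpret PP: product_prob_space "\<lambda>_. measure_pmf (bernoulli_pmf p)" E
    by unfold_locales
  let ?M = "perc p"
  interpret P: prob_space ?M by (rule prob_space_perc)
  define cyl where "cyl S = {\<omega> \<in> space ?M. {e \<in> F. \<omega> e} = S}" for S
  have emb: "cyl S = prod_emb E (\<lambda>_. measure_pmf (bernoulli_pmf p)) F (\<Pi>\<^sub>E e\<in>F. {e \<in> S})" if "S \<subseteq> F" for S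
    using that F(2) unfolding cyl_def percolation_def
    by (auto simp: prod_emb_def space_PiM PiE_iff extensional_def)
  have cyl_sets: "cyl S \<in> sets ?M" if "S \<subseteq> F" for S
    unfolding emb[OF that] unfolding percolation_def using F by (intro sets_PiM_I) auto
  have cyl_measure: "measure ?M (cyl S) = p ^ card S * (1 - p) ^ card (F - S)" if S: "S \<subseteq> F" for S
  proof -
    have "emeasure ?M (cyl S) = (\<Prod>e\<in>F. emeasure (measure_pmf (bernoulli_pmf p)) {e \<in> S})"
      unfolding emb[OF S] unfolding percolation_def using F by (intro PP.emeasure_PiM_emb) auto
    also have "\<dots> = (\<Prod>e\<in>F. ennreal (if e \<in> S then p else 1 - p))"
      using p by (intro prod.cong) (auto simp: emeasure_pmf_single)
    also have "\<dots> = ennreal (\<Prod>e\<in>F. if e \<in> S then p else 1 - p)"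
      using p by (intro prod_ennreal) auto
    also have "(\<Prod>e\<in>F. if e \<in> S then p else 1 - p) = p ^ card S * (1 - p) ^ card (F - S)"
      using F(1) S by (simp add: prod.If_cases Int_absorb1 Diff_eq)
    finally show ?thesis using p by (simp add: measure_def)
  qed
  have eq: "{\<omega> \<in> space ?M. Q {e \<in> F. \<omega> e}} = (\<Union>S\<in>{S\<in>Pow F. Q S}. cyl S)"
    by (auto simp: cyl_def)
  show "{\<omega> \<in> space ?M. Q {e \<in> F. \<omega> e}} \<in> sets ?M"
    unfolding eq using F cyl_sets by (intro sets.finite_UN) auto
  have "measure ?M {\<omega> \<in> space ?M. Q {e \<in> F. \<omega> e}} = (\<Sum>S\<in>{S\<in>Pow F. Q S}. measure ?M (cyl S))"
    unfolding eq
  proof (rule P.finite_measure_finite_Union)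
    show "disjoint_family_on cyl {S \<in> Pow F. Q S}" by (auto simp: disjoint_family_on_def cyl_def)
  qed (use F cyl_sets in auto)
  also have "\<dots> = (\<Sum>S\<in>{S\<in>Pow F. Q S}. p ^ card S * (1 - p) ^ card (F - S))"
    by (intro sum.cong) (auto simp: cyl_measure)
  also have "\<dots> = expect F p (\<lambda>S. of_bool (Q S))"
    unfolding expect_def using F(1)
    by (simp add: sum.If_cases of_bool_def if_distrib Int_def cong: if_cong)
  finally show "measure ?M {\<omega> \<in> space ?M. Q {e \<in> F. \<omega> e}} = expect F p (\<lambda>S. of_bool (Q S))" .
qed

lemma reach_config_subset:
  assumes "F \<subseteq> E"
  shows "reach {e \<in> F. \<omega> e} {v} \<subseteq> cluster E \<omega> v"
  unfolding cluster_eq_reach using assms by (intro reach_mono) auto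

lemma tau_le_two_point:
  assumes p: "0 \<le> p" "p \<le> 1" and F: "finite F" "F \<subseteq> E"
  shows "tau F p u v \<le> two_point E p u v"
proof -
  interpret P: prob_space "perc p" by (rule prob_space_perc)
  let ?A = "\<lambda>G. {\<omega> \<in> space (perc p). v \<in> reach {e \<in> G. \<omega> e} {u}}"
  have "{\<omega> \<in> space (perc p). v \<in> cluster E \<omega> u} = (\<Union>G\<in>{G. finite G \<and> G \<subseteq> E}. ?A G)"
  proof (intro subset_antisym subsetI)
    fix \<omega> assume \<omega>: "\<omega> \<in> {\<omega> \<in> space (perc p). v \<in> cluster E \<omega> u}"
    then obtain G where G: "finite G" "G \<subseteq> {e \<in> E. \<omega> e}" "v \<in> reach G {u}"
      unfolding cluster_eq_reach by (auto elim: reach_finite_subset)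
    then have "{e \<in> G. \<omega> e} = G" by auto
    then show "\<omega> \<in> (\<Union>G\<in>{G. finite G \<and> G \<subseteq> E}. ?A G)" using G \<omega> by auto
  next
    fix \<omega> assume "\<omega> \<in> (\<Union>G\<in>{G. finite G \<and> G \<subseteq> E}. ?A G)"
    then show "\<omega> \<in> {\<omega> \<in> space (perc p). v \<in> cluster E \<omega> u}"
      using reach_config_subset by blast
  qed
  also have "\<dots> \<in> sets (perc p)"
  proof (rule sets.countable_UN')
    show "countable {G. finite G \<and> G \<subseteq> E}" by (rule countable_Collect_finite_subset[OF countable_E])
    show "?A ` {G. finite G \<and> G \<subseteq> E} \<subseteq> sets (perc p)"
      using measure_config(1)[OF p, of _ "\<lambda>S. v \<in> reach S {u}"] by auto
  qed
  \<comment> \<open>Measurability matters: \<open>measure\<close> is 0 on non-measurable sets and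
    could then not serve as an upper bound.\<close>
  finally have meas: "{\<omega> \<in> space (perc p). v \<in> cluster E \<omega> u} \<in> sets (perc p)" .
  have "tau F p u v = measure (perc p) (?A F)"
    unfolding tau_def by (rule measure_config(2)[OF p F, symmetric])
  also have "\<dots> \<le> measure (perc p) {\<omega> \<in> space (perc p). v \<in> cluster E \<omega> u}"
    using meas reach_config_subset[OF F(2)] by (intro P.finite_measure_mono) auto
  finally show ?thesis by (simp add: two_point_def)
qed

text \<open>The probability that the cluster of \<open>v\<close> equals \<open>H\<close>, taken over
  the finitely many edges that decide this event, so that it is a finite sum even though the graph
  is infinite.\<close>

definition clprob :: "real \<Rightarrow> 'v \<Rightarrow> 'v set \<Rightarrow> real" where
  "clprob p v H = expect (touching_edges E H) p (\<lambda>S. of_bool (reach S {v} = H))"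

lemma clprob_nonneg: "0 \<le> p \<Longrightarrow> p \<le> 1 \<Longrightarrow> 0 \<le> clprob p v H"
  unfolding clprob_def by (intro expect_nonneg) auto

lemma clprob_eq:
  assumes "finite F" "F \<subseteq> E" "touching_edges E H \<subseteq> F"
  shows "clprob p v H = expect F p (\<lambda>S. of_bool (reach S {v} = H))"
  unfolding clprob_def
proof (rule expect_marginal[symmetric, OF assms(1,3)])
  fix S T assume "S \<subseteq> touching_edges E H" "T \<subseteq> F - touching_edges E H"
  then show "of_bool (reach (S \<union> T) {v} = H) = of_bool (reach S {v} = H)"
    using assms(2) reach_eq_iff_touching[of T H S "{v}"] by (auto simp: touching_edges_def)
qed

lemma cluster_eq_iff:
  "cluster E \<omega> v = H \<longleftrightarrow> reach {e \<in> touching_edges E H. \<omega> e} {v} = H"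
proof -
  have "{e \<in> E. \<omega> e} = {e \<in> touching_edges E H. \<omega> e} \<union> {e \<in> E - touching_edges E H. \<omega> e}"
    by (auto simp: touching_edges_def)
  then show ?thesis
    unfolding cluster_eq_reach
    using reach_eq_iff_touching[of "{e \<in> E - touching_edges E H. \<omega> e}" H "{e \<in> touching_edges E H. \<omega> e}" "{v}"]
    by (auto simp: touching_edges_def)
qed

lemma measure_cluster_eq:
  assumes p: "0 \<le> p" "p \<le> 1" and H: "finite H" "H \<subseteq> V"
  shows "{\<omega> \<in> space (perc p). cluster E \<omega> v = H} \<in> sets (perc p)"
    and "measure (perc p) {\<omega> \<in> space (perc p). cluster E \<omega> v = H} = clprob p v H"
  unfolding cluster_eq_iff clprob_def
  using measure_config[OF p finite_touching_E[OF H] touching_subset, of "\<lambda>S. reach S {v} = H"] by auto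

lemma measure_cluster_family:
  assumes p: "0 \<le> p" "p \<le> 1" and "finite \<H>" "\<And>H. H \<in> \<H> \<Longrightarrow> finite H \<and> H \<subseteq> V"
  shows "measure (perc p) {\<omega> \<in> space (perc p). cluster E \<omega> v \<in> \<H>} = (\<Sum>H\<in>\<H>. clprob p v H)"
    "{\<omega> \<in> space (perc p). cluster E \<omega> v \<in> \<H>} \<in> sets (perc p)"
proof -
  interpret P: prob_space "perc p" by (rule prob_space_perc)
  let ?A = "\<lambda>H. {\<omega> \<in> space (perc p). cluster E \<omega> v = H}"
  have eq: "{\<omega> \<in> space (perc p). cluster E \<omega> v \<in> \<H>} = (\<Union>H\<in>\<H>. ?A H)" by auto
  have sets: "?A H \<in> sets (perc p)" if "H \<in> \<H>" for H
    using that assms by (intro measure_cluster_eq) auto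
  show "{\<omega> \<in> space (perc p). cluster E \<omega> v \<in> \<H>} \<in> sets (perc p)"
    unfolding eq using sets assms by auto
  have "measure (perc p) (\<Union>H\<in>\<H>. ?A H) = (\<Sum>H\<in>\<H>. measure (perc p) (?A H))"
    using sets assms by (intro P.finite_measure_finite_Union) (auto simp: disjoint_family_on_def)
  also have "\<dots> = (\<Sum>H\<in>\<H>. clprob p v H)"
    using assms by (intro sum.cong) (auto intro!: measure_cluster_eq)
  finally show "measure (perc p) {\<omega> \<in> space (perc p). cluster E \<omega> v \<in> \<H>} = (\<Sum>H\<in>\<H>. clprob p v H)"
    unfolding eq .
qed

text \<open>Only countably many finite sets can be clusters, so the event is an increasing union
  over finite families, and a bound uniform in the family passes to the limit. The same union gives
  measurability.\<close>

lemma measure_finite_cluster_le: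
  assumes p: "0 \<le> p" "p \<le> 1" and v: "v \<in> V"
    and bound: "\<And>\<H>. finite \<H> \<Longrightarrow> (\<And>H. H \<in> \<H> \<Longrightarrow> finite H \<and> H \<subseteq> V \<and> Q H) \<Longrightarrow> (\<Sum>H\<in>\<H>. clprob p v H) \<le> c"
  shows "{\<omega> \<in> space (perc p). finite (cluster E \<omega> v) \<and> Q (cluster E \<omega> v)} \<in> sets (perc p)" (is "?A \<in> _")
    and "measure (perc p) {\<omega> \<in> space (perc p). finite (cluster E \<omega> v) \<and> Q (cluster E \<omega> v)} \<le> c"
proof -
  interpret P: prob_space "perc p" by (rule prob_space_perc)
  define D where "D = {H. finite H \<and> H \<subseteq> V \<and> Q H}"
  have "countable D"
    using countable_Collect_finite_subset[OF countable_V] by (rule countable_subset[rotated]) (auto simp: D_def)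
  have "cluster E \<omega> v \<subseteq> V" for \<omega>
    unfolding cluster_eq_reach using v by (intro reach_subset_V) auto
  then have A: "?A = {\<omega> \<in> space (perc p). cluster E \<omega> v \<in> D}" by (auto simp: D_def)
  define \<H> where "\<H> n = {H \<in> D. to_nat_on D H < n}" for n
  have fin: "finite (\<H> n)" for n
  proof -
    have "inj_on (to_nat_on D) (\<H> n)"
      using inj_on_to_nat_on[OF \<open>countable D\<close>] by (rule inj_on_subset) (auto simp: \<H>_def)
    moreover have "to_nat_on D ` \<H> n \<subseteq> {..<n}" by (auto simp: \<H>_def)
    ultimately show ?thesis using inj_on_finite by blast
  qed
  let ?B = "\<lambda>n. {\<omega> \<in> space (perc p). cluster E \<omega> v \<in> \<H> n}"
  have \<H>: "finite H \<and> H \<subseteq> V" if "H \<in> \<H> n" for H n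
    using that by (auto simp: \<H>_def D_def)
  have B: "measure (perc p) (?B n) = (\<Sum>H\<in>\<H> n. clprob p v H)" "?B n \<in> sets (perc p)" for n
    using measure_cluster_family[OF p fin \<H>] by auto
  have AB: "?A = (\<Union>n. ?B n)" unfolding A \<H>_def by auto
  then show "?A \<in> sets (perc p)" using B(2) by auto
  have "(\<lambda>n. measure (perc p) (?B n)) \<longlonglongrightarrow> measure (perc p) (\<Union>n. ?B n)"
    using B(2) by (intro P.finite_Lim_measure_incseq) (auto simp: incseq_def \<H>_def)
  then show "measure (perc p) ?A \<le> c"
    unfolding AB
  proof (rule LIMSEQ_le_const2)
    have "measure (perc p) (?B n) \<le> c" for n
      unfolding B(1) using fin by (intro bound) (auto simp: \<H>_def D_def)
    then show "\<exists>N. \<forall>n\<ge>N. measure (perc p) (?B n) \<le> c" by auto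
  qed
qed

text \<open>Every vertex of the cluster, except possibly \<open>v\<close>, is an end of an edge
  touching it; the converse is local finiteness.\<close>

lemma finite_touching_iff:
  assumes v: "v \<in> V"
  shows "finite (touching_edges E (cluster E \<omega> v)) \<longleftrightarrow> finite (cluster E \<omega> v)"
proof
  let ?C = "cluster E \<omega> v"
  assume fin: "finite (touching_edges E ?C)"
  have "reach {e \<in> E. \<omega> e} {v} \<subseteq> ?C \<inter> ({v} \<union> \<Union>(touching_edges E ?C))"
  proof (rule reach_least)
    show "{v} \<subseteq> ?C \<inter> ({v} \<union> \<Union>(touching_edges E ?C))"
      unfolding cluster_eq_reach using reach_refl[of "{v}"] by auto
    fix x y assume x: "x \<in> ?C \<inter> ({v} \<union> \<Union>(touching_edges E ?C))" and e: "{x, y} \<in> {e \<in> E. \<omega> e}"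
    then have "y \<in> ?C" unfolding cluster_eq_reach using reach_closed by fast
    then show "y \<in> ?C \<inter> ({v} \<union> \<Union>(touching_edges E ?C))"
      using e by (auto simp: touching_edges_def)
  qed
  then have "?C \<subseteq> {v} \<union> \<Union>(touching_edges E ?C)" unfolding cluster_eq_reach by auto
  moreover have "finite (\<Union>(touching_edges E ?C))"
    using fin pairs_sub[OF touching_subset[of E ?C]] by (auto simp: pairs_def)
  ultimately show "finite ?C" using finite_subset by blast
next
  assume "finite (cluster E \<omega> v)"
  moreover have "cluster E \<omega> v \<subseteq> V"
    unfolding cluster_eq_reach using v by (intro reach_subset_V) auto
  ultimately show "finite (touching_edges E (cluster E \<omega> v))" by (rule finite_touching_E)
qed

lemma tail_eq:
  assumes "v \<in> V"
  shows "finite_cluster_tail E p v n = measure (perc p)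
    {\<omega> \<in> space (perc p). finite (cluster E \<omega> v) \<and> n \<le> card (touching_edges E (cluster E \<omega> v))}"
  unfolding finite_cluster_tail_def finite_touching_iff[OF assms] ..

lemma tail_le:
  assumes "0 \<le> p" "p \<le> 1" "v \<in> V"
    and "\<And>\<H>. finite \<H> \<Longrightarrow> (\<And>H. H \<in> \<H> \<Longrightarrow> finite H \<and> H \<subseteq> V \<and> n \<le> card (touching_edges E H)) \<Longrightarrow>
      (\<Sum>H\<in>\<H>. clprob p v H) \<le> c"
  shows "finite_cluster_tail E p v n \<le> c"
  unfolding tail_eq[OF assms(3)]
  using assms by (intro measure_finite_cluster_le(2)[where Q = "\<lambda>H. n \<le> card (touching_edges E H)"]) auto

lemma sum_clprob_le_1:
  assumes "0 \<le> p" "p \<le> 1" "finite \<H>" "\<And>H. H \<in> \<H> \<Longrightarrow> finite H \<and> H \<subseteq> V"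
  shows "(\<Sum>H\<in>\<H>. clprob p v H) \<le> 1"
proof -
  interpret P: prob_space "perc p" by (rule prob_space_perc)
  show ?thesis
    using measure_cluster_family(1)[of p \<H> v] assms
      P.prob_le_1[of "{\<omega> \<in> space (perc p). cluster E \<omega> v \<in> \<H>}"] by simp
qed

lemma sum_clprob_le_measure:
  assumes p: "0 \<le> p" "p \<le> 1" and v: "v \<in> V" and \<H>: "finite \<H>"
    "\<And>H. H \<in> \<H> \<Longrightarrow> finite H \<and> H \<subseteq> V \<and> Q H"
  shows "(\<Sum>H\<in>\<H>. clprob p v H)
    \<le> measure (perc p) {\<omega> \<in> space (perc p). finite (cluster E \<omega> v) \<and> Q (cluster E \<omega> v)}"
proof -
  interpret P: prob_space "perc p" by (rule prob_space_perc)
  have "{\<omega> \<in> space (perc p). finite (cluster E \<omega> v) \<and> Q (cluster E \<omega> v)} \<in> sets (perc p)"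
    by (rule measure_finite_cluster_le(1)[OF p v, where c = 1]) (use sum_clprob_le_1[OF p] in blast)
  moreover have "{\<omega> \<in> space (perc p). cluster E \<omega> v \<in> \<H>}
      \<subseteq> {\<omega> \<in> space (perc p). finite (cluster E \<omega> v) \<and> Q (cluster E \<omega> v)}"
    using \<H>(2) by blast
  ultimately have "measure (perc p) {\<omega> \<in> space (perc p). cluster E \<omega> v \<in> \<H>}
      \<le> measure (perc p) {\<omega> \<in> space (perc p). finite (cluster E \<omega> v) \<and> Q (cluster E \<omega> v)}"
    by (intro P.finite_measure_mono)
  then show ?thesis
    using measure_cluster_family(1)[OF p \<H>(1)] \<H>(2) by simp
qed

lemma tail_ge:
  assumes "0 \<le> p" "p \<le> 1" "v \<in> V" "finite \<H>"
    "\<And>H. H \<in> \<H> \<Longrightarrow> finite H \<and> H \<subseteq> V \<and> n \<le> card (touching_edges E H)"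
  shows "(\<Sum>H\<in>\<H>. clprob p v H) \<le> finite_cluster_tail E p v n"
  unfolding tail_eq[OF assms(3)]
  using assms by (intro sum_clprob_le_measure[where Q = "\<lambda>H. n \<le> card (touching_edges E H)"]) auto

text \<open>Markov's inequality: an infinite cluster shows \<open>n\<close> vertices in some finite
  volume, so \<open>n\<close> times its probability is at most \<open>X\<close>, for every
  \<open>n\<close>.\<close>

lemma AE_finite_cluster:
  assumes p: "0 \<le> p" "p \<le> 1"
    and X: "\<And>v F. v \<in> V \<Longrightarrow> finite F \<Longrightarrow> F \<subseteq> E \<Longrightarrow> esize F p {v} \<le> X"
  shows "ae_finite p"
proof (subst AE_ball_countable[OF countable_V], rule ballI)
  fix v assume v: "v \<in> V"
  interpret P: prob_space "perc p" by (rule prob_space_perc)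
  obtain F where F: "\<And>k. finite (F k)" "\<And>k. F k \<subseteq> E" "incseq F"
    "\<And>G. finite G \<Longrightarrow> G \<subseteq> E \<Longrightarrow> \<exists>k. G \<subseteq> F k"
    by (rule finite_exhaustion) blast
  let ?N = "{\<omega> \<in> space (perc p). infinite (cluster E \<omega> v)}"
  have N: "?N \<in> sets (perc p)"
  proof -
    have "{\<omega> \<in> space (perc p). finite (cluster E \<omega> v) \<and> True} \<in> sets (perc p)"
      by (rule measure_finite_cluster_le(1)[OF p v, where c = 1]) (use sum_clprob_le_1[OF p] in blast)
    then have "space (perc p) - {\<omega> \<in> space (perc p). finite (cluster E \<omega> v) \<and> True} \<in> sets (perc p)"
      by auto
    also have "space (perc p) - {\<omega> \<in> space (perc p). finite (cluster E \<omega> v) \<and> True} = ?N" by auto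
    finally show ?thesis .
  qed
  have "real n * measure (perc p) ?N \<le> X" for n
  proof -
    let ?B = "\<lambda>k. {\<omega> \<in> space (perc p). n \<le> card (reach {e \<in> F k. \<omega> e} {v})}"
    have fin: "finite (reach {e \<in> F k. \<omega> e} {v})" for k \<omega>
      using F by (intro finite_reach pairs_sub) auto
    have inc: "incseq ?B"
    proof (intro incseq_SucI subsetI CollectI conjI)
      fix k \<omega> assume \<omega>: "\<omega> \<in> ?B k"
      have "card (reach {e \<in> F k. \<omega> e} {v}) \<le> card (reach {e \<in> F (Suc k). \<omega> e} {v})"
        using fin F(3) by (intro card_mono reach_mono) (auto simp: incseq_Suc_iff)
      then show "n \<le> card (reach {e \<in> F (Suc k). \<omega> e} {v})" "\<omega> \<in> space (perc p)" using \<omega> by auto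
    qed
    have sub: "?N \<subseteq> (\<Union>k. ?B k)"
    proof
      fix \<omega> assume \<omega>: "\<omega> \<in> ?N"
      then obtain W where W: "finite W" "card W = n" "W \<subseteq> cluster E \<omega> v"
        using infinite_arbitrarily_large by blast
      have "\<exists>G. finite G \<and> G \<subseteq> {e\<in>E. \<omega> e} \<and> w \<in> reach G {v}" if "w \<in> W" for w
        using W(3) that unfolding cluster_eq_reach by (meson reach_finite_subset subsetD)
      then obtain G where G: "\<And>w. w \<in> W \<Longrightarrow> finite (G w) \<and> G w \<subseteq> {e\<in>E. \<omega> e} \<and> w \<in> reach (G w) {v}"
        by metis
      have "finite (\<Union>w\<in>W. G w)" "(\<Union>w\<in>W. G w) \<subseteq> E" using W G by auto
      then obtain k where k: "(\<Union>w\<in>W. G w) \<subseteq> F k" using F(4) by blast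
      have "W \<subseteq> reach {e \<in> F k. \<omega> e} {v}"
      proof
        fix w assume w: "w \<in> W"
        have "reach (G w) {v} \<subseteq> reach {e \<in> F k. \<omega> e} {v}"
          using w k G[OF w] by (intro reach_mono) auto
        then show "w \<in> reach {e \<in> F k. \<omega> e} {v}" using G[OF w] by auto
      qed
      then have "n \<le> card (reach {e \<in> F k. \<omega> e} {v})" using W(2) card_mono[OF fin] by metis
      then show "\<omega> \<in> (\<Union>k. ?B k)" using \<omega> by auto
    qed
    have "real n * measure (perc p) (?B k) \<le> X" for k
    proof -
      have "real n * measure (perc p) (?B k) = expect (F k) p (\<lambda>S. real n * of_bool (n \<le> card (reach S {v})))"
        unfolding expect_cmult using measure_config(2)[OF p F(1,2), of "\<lambda>S. n \<le> card (reach S {v})"] by simp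
      also have "\<dots> \<le> esize (F k) p {v}"
        unfolding esize_def using p by (intro expect_mono) (auto simp: of_bool_def)
      also have "\<dots> \<le> X" using X v F by auto
      finally show ?thesis .
    qed
    moreover have "(\<lambda>k. real n * measure (perc p) (?B k)) \<longlonglongrightarrow> real n * measure (perc p) (\<Union>k. ?B k)"
      using inc measure_config(1)[OF p F(1,2), of "\<lambda>S. n \<le> card (reach S {v})"]
      by (intro tendsto_mult tendsto_const P.finite_Lim_measure_incseq) auto
    ultimately have "real n * measure (perc p) (\<Union>k. ?B k) \<le> X"
      by (intro LIMSEQ_le_const2) auto
    moreover have "measure (perc p) ?N \<le> measure (perc p) (\<Union>k. ?B k)"
      using sub measure_config(1)[OF p F(1,2), of "\<lambda>S. n \<le> card (reach S {v})"]
      by (intro P.finite_measure_mono) auto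
    ultimately show ?thesis by (meson mult_left_mono of_nat_0_le_iff order_trans)
  qed
  then have "measure (perc p) ?N = 0"
  proof -
    assume le: "\<And>n. real n * measure (perc p) ?N \<le> X"
    have "\<not> 0 < measure (perc p) ?N"
    proof
      assume "0 < measure (perc p) ?N"
      then obtain n where "X < real n * measure (perc p) ?N" using reals_Archimedean3 by blast
      then show False using le[of n] by simp
    qed
    then show ?thesis using measure_nonneg[of "perc p" ?N] by linarith
  qed
  then have "emeasure (perc p) ?N = 0" by (simp add: P.emeasure_eq_measure)
  then show "AE \<omega> in perc p. finite (cluster E \<omega> v)"
    using N by (intro AE_I[of _ _ ?N]) auto
qed

text \<open>Finite clusters carry the full mass here, so no bound on it lies below 1. This is how
  the sprinkled estimate becomes a contradiction.\<close>

lemma measure_finite_cluster_AE: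
  assumes p: "0 \<le> p" "p \<le> 1" and v: "v \<in> V"
    and AE: "ae_finite p"
    and bound: "\<And>\<H>. finite \<H> \<Longrightarrow> (\<And>H. H \<in> \<H> \<Longrightarrow> finite H \<and> H \<subseteq> V) \<Longrightarrow> (\<Sum>H\<in>\<H>. clprob p v H) \<le> c"
  shows "1 \<le> c"
proof -
  interpret P: prob_space "perc p" by (rule prob_space_perc)
  let ?A = "{\<omega> \<in> space (perc p). finite (cluster E \<omega> v) \<and> True}"
  have A: "?A \<in> sets (perc p)" "measure (perc p) ?A \<le> c"
    using bound by (intro measure_finite_cluster_le[OF p v, where Q = "\<lambda>_. True" and c = c]; blast)+
  have "AE \<omega> in perc p. finite (cluster E \<omega> v) \<and> True"
    using AE by eventually_elim (use v in auto)
  then have "measure (perc p) ?A = 1"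
    using P.prob_Collect_eq_1[OF A(1)] by simp
  then show ?thesis using A(2) by simp
qed

text \<open>The cluster within \<open>F\<close> is contained in the true one, and almost sure
  finiteness expresses the tail of the latter through finite clusters.\<close>

lemma expect_card_ge_le:
  assumes p: "0 \<le> p" "p \<le> 1" and v: "v \<in> V" and F: "finite F" "F \<subseteq> E"
    and AE: "ae_finite p"
    and bound: "\<And>\<H>. finite \<H> \<Longrightarrow> (\<And>H. H \<in> \<H> \<Longrightarrow> finite H \<and> H \<subseteq> V \<and> k \<le> card H) \<Longrightarrow> (\<Sum>H\<in>\<H>. clprob p v H) \<le> c"
  shows "expect F p (\<lambda>S. of_bool (k \<le> card (reach S {v}))) \<le> c"
proof -
  interpret P: prob_space "perc p" by (rule prob_space_perc)
  let ?A = "{\<omega> \<in> space (perc p). k \<le> card (reach {e \<in> F. \<omega> e} {v})}"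
  let ?B = "{\<omega> \<in> space (perc p). finite (cluster E \<omega> v) \<and> k \<le> card (cluster E \<omega> v)}"
  have "expect F p (\<lambda>S. of_bool (k \<le> card (reach S {v}))) = measure (perc p) ?A"
    using measure_config(2)[OF p F, of "\<lambda>S. k \<le> card (reach S {v})"] by simp
  also have "\<dots> \<le> measure (perc p) ?B"
  proof (rule P.finite_measure_mono_AE)
    show "AE \<omega> in perc p. \<omega> \<in> ?A \<longrightarrow> \<omega> \<in> ?B"
      using AE
    proof eventually_elim
      case (elim \<omega>)
      then have fin: "finite (cluster E \<omega> v)" using v by auto
      then have "card (reach {e \<in> F. \<omega> e} {v}) \<le> card (cluster E \<omega> v)"
        using reach_config_subset[OF F(2)] by (intro card_mono)
      then show ?case using fin by auto
    qed
    show "?B \<in> sets (perc p)"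
      using bound by (intro measure_finite_cluster_le(1)[OF p v, where c = c and Q = "\<lambda>H. k \<le> card H"]) auto
  qed
  also have "\<dots> \<le> c"
    using bound by (intro measure_finite_cluster_le(2)[OF p v, where Q = "\<lambda>H. k \<le> card H"]) auto
  finally show ?thesis .
qed

end

section \<open>Quasi-transitive graphs\<close>

lemma expect_image:
  assumes "finite F" "inj_on g F"
  shows "expect (g ` F) p f = expect F p (\<lambda>S. f (g ` S))"
  using assms
proof (induction F arbitrary: f rule: finite_induct)
  case (insert e F)
  then have "g e \<notin> g ` F" by auto
  then show ?case using insert by (simp add: expect_insert)
qed simp

text \<open>Conditioning on the single edge \<open>{x, y}\<close> takes the place of the Harris
  inequality: with the edge open both ends share one cluster, whose mean dominates that of the
  cluster of \<open>y\<close>.\<close>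

lemma esize_insert_edge_ge:
  assumes p: "0 \<le> p" "p \<le> 1" and F: "finite F" "pairs (insert {x, y} F)"
  shows "p * esize F p {y} \<le> esize (insert {x, y} F) p {x}"
proof -
  define F' where "F' = F - {{x, y}}"
  have F': "finite F'" "pairs F'" "{x, y} \<notin> F'" "insert {x, y} F = insert {x, y} F'"
    using F by (auto simp: F'_def intro: pairs_subset)
  have nonneg: "0 \<le> esize F' p {x}" unfolding esize_def using p by (intro expect_nonneg) auto
  have le: "esize F' p {y} \<le> esize F' p {y, x}"
    using esize_insert_vertex(1)[OF p F'(1,2), of "{y}" x] by (simp add: insert_commute)
  have "esize F p {y} \<le> esize (insert {x, y} F') p {y}"
    using p F F' by (intro esize_mono_set) auto
  also have "\<dots> = p * esize F' p {y, x} + (1 - p) * esize F' p {y}"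
    using esize_insert_edge[of F' y x "{y}" p] F' by (simp add: insert_commute)
  also have "\<dots> \<le> p * esize F' p {y, x} + (1 - p) * esize F' p {y, x}"
    using le p by (intro add_left_mono mult_left_mono) auto
  also have "\<dots> = esize F' p {y, x}" by (simp add: algebra_simps)
  finally have "p * esize F p {y} \<le> p * esize F' p {y, x}" using p by (intro mult_left_mono) auto
  also have "\<dots> \<le> p * esize F' p (insert y {x}) + (1 - p) * esize F' p {x}"
    using nonneg p by simp
  also have "\<dots> = esize (insert {x, y} F') p {x}"
    using esize_insert_edge[of F' x y "{x}" p] F' by simp
  finally show ?thesis using F' by simp
qed

context lf_graph
begin

lemma esize_path_ge:
  assumes p: "0 \<le> p" "p \<le> 1" and "(x, w) \<in> adjacency E ^^ k" "finite F" "F \<subseteq> E"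
  shows "\<exists>F'. finite F' \<and> F' \<subseteq> E \<and> p ^ k * esize F p {w} \<le> esize F' p {x}"
  using assms(3)
proof (induction k arbitrary: x)
  case 0
  then show ?case using assms(4,5) by auto
next
  case (Suc k)
  obtain y where y: "{x, y} \<in> E" "(y, w) \<in> adjacency E ^^ k"
    using relpow_Suc_D2[OF Suc.prems] by (auto simp: adjacency_def)
  then obtain F' where F': "finite F'" "F' \<subseteq> E" "p ^ k * esize F p {w} \<le> esize F' p {y}"
    using Suc.IH by blast
  have "p ^ Suc k * esize F p {w} \<le> p * esize F' p {y}"
    using F'(3) p by (simp add: mult.assoc mult_left_mono)
  also have "\<dots> \<le> esize (insert {x, y} F') p {x}"
    using F' y by (intro esize_insert_edge_ge p pairs_sub) auto
  finally show ?case using F' y by (intro exI[of _ "insert {x, y} F'"]) auto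
qed

lemma automorphism_edge:
  assumes "graph_automorphism V E \<phi>" "e \<in> E"
  shows "\<phi> ` e \<in> E"
proof -
  obtain u w where e: "e = {u, w}" "u \<in> V" "w \<in> V"
    using assms(2) simple by (auto simp: simple_graph_def)
  then show ?thesis using assms by (auto simp: graph_automorphism_def)
qed

lemma automorphism_inj:
  assumes "graph_automorphism V E \<phi>"
  shows "inj_on \<phi> V" "\<phi> ` V = V" "inj_on (image \<phi>) E"
proof -
  show inj: "inj_on \<phi> V" "\<phi> ` V = V"
    using assms by (auto simp: graph_automorphism_def bij_betw_def)
  show "inj_on (image \<phi>) E"
    by (rule inj_on_subset[OF inj_on_image_Pow[OF inj(1)]]) (use edge_subset in auto)
qed

text \<open>The image of a cluster lies in the cluster of the image. This one inequality suffices,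
  and it avoids inverting \<open>\<phi>\<close>.\<close>

lemma esize_automorphism_ge:
  assumes p: "0 \<le> p" "p \<le> 1" and \<phi>: "graph_automorphism V E \<phi>" and F: "finite F" "F \<subseteq> E" and v: "v \<in> V"
  shows "esize F p {v} \<le> esize (image \<phi> ` F) p {\<phi> v}"
proof -
  note inj = automorphism_inj[OF \<phi>]
  have "esize (image \<phi> ` F) p {\<phi> v} = expect F p (\<lambda>S. real (card (reach (image \<phi> ` S) {\<phi> v})))"
    unfolding esize_def using F inj(3) by (intro expect_image) (auto intro: inj_on_subset)
  moreover have "esize F p {v} \<le> \<dots>"
    unfolding esize_def using p
  proof (rule expect_mono)
    fix S assume S: "S \<subseteq> F"
    let ?R = "reach (image \<phi> ` S) {\<phi> v}"
    have "image \<phi> ` S \<subseteq> E" using S F automorphism_edge[OF \<phi>] by blast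
    then have fin: "finite ?R" using S F by (intro finite_reach pairs_sub) (auto intro: finite_subset)
    have RV: "reach S {v} \<subseteq> V" using S F v by (intro reach_subset_V) auto
    have "reach S {v} \<subseteq> {x. \<phi> x \<in> ?R}"
    proof (rule reach_least)
      show "{v} \<subseteq> {x. \<phi> x \<in> ?R}" using reach_refl[of "{\<phi> v}"] by auto
      fix x y assume x: "x \<in> {x. \<phi> x \<in> ?R}" and e: "{x, y} \<in> S"
      have "\<phi> x \<in> ?R" "{\<phi> x, \<phi> y} \<in> image \<phi> ` S"
        using x imageI[OF e, of "image \<phi>"] by simp_all
      then have "\<phi> y \<in> ?R" by (rule reach_closed)
      then show "y \<in> {x. \<phi> x \<in> ?R}" by simp
    qed
    then have "\<phi> ` reach S {v} \<subseteq> ?R" by auto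
    moreover have "card (\<phi> ` reach S {v}) = card (reach S {v})"
      using inj(1) RV by (intro card_image) (rule inj_on_subset)
    ultimately show "rsize S {v} \<le> real (card ?R)"
      using card_mono[OF fin, of "\<phi> ` reach S {v}"] by simp
  qed
  ultimately show ?thesis by simp
qed

text \<open>Kept apart from \<open>susc\<close> because the \<open>Sup\<close> of an unbounded set
  of reals carries no information. Uniformity over the vertices is built in.\<close>

definition fin_susc :: "real \<Rightarrow> bool" where
  "fin_susc p \<longleftrightarrow> (\<exists>X. \<forall>v\<in>V. \<forall>F. finite F \<longrightarrow> F \<subseteq> E \<longrightarrow> esize F p {v} \<le> X)"

definition susc :: "real \<Rightarrow> real" where
  "susc p = Sup {esize F p {v} | F v. v \<in> V \<and> finite F \<and> F \<subseteq> E}"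

lemma esize_le_susc:
  assumes "fin_susc p" "v \<in> V" "finite F" "F \<subseteq> E"
  shows "esize F p {v} \<le> susc p"
  unfolding susc_def
proof (rule cSup_upper)
  show "bdd_above {esize F p {v} | F v. v \<in> V \<and> finite F \<and> F \<subseteq> E}"
    using assms(1) unfolding fin_susc_def bdd_above_def by blast
qed (use assms in auto)

lemma susc_ge_1: "fin_susc p \<Longrightarrow> 1 \<le> susc p"
proof -
  assume fin: "fin_susc p"
  obtain v where v: "v \<in> V" using connected by (auto simp: connected_graph_def)
  have "reach {} {v} = {v}" by (rule reach_no_touch) auto
  then have "esize {} p {v} = 1" by (simp add: esize_def)
  then show ?thesis using esize_le_susc[OF fin v, of "{}"] by simp
qed

text \<open>The finite-volume lemmas quantify over the whole type; an element outside
  \<open>V\<close> is isolated and has expected size 1.\<close>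

lemma esize_le_susc_any:
  assumes "fin_susc p" "finite F" "F \<subseteq> E"
  shows "esize F p {y} \<le> susc p"
proof (cases "y \<in> V")
  case False
  have "reach S {y} = {y}" if "S \<subseteq> F" for S
    using that assms(3) edge_subset False by (intro reach_no_touch) blast
  then have "esize F p {y} = expect F p (\<lambda>_. 1)"
    unfolding esize_def by (intro expect_cong) simp
  then show ?thesis using assms susc_ge_1 by (simp add: expect_const)
qed (use assms esize_le_susc in auto)

lemma susc_approx:
  assumes "fin_susc p" "c < susc p"
  obtains F v where "v \<in> V" "finite F" "F \<subseteq> E" "c < esize F p {v}"
proof -
  obtain v where v: "v \<in> V" using connected by (auto simp: connected_graph_def)
  have "{esize F p {v} | F v. v \<in> V \<and> finite F \<and> F \<subseteq> E} \<noteq> {}" using v by blast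
  then obtain y where "y \<in> {esize F p {v} | F v. v \<in> V \<and> finite F \<and> F \<subseteq> E}" "c < y"
    using assms(2) unfolding susc_def by (meson less_cSupD)
  then show ?thesis using that by auto
qed

lemma esize_zero: "finite F \<Longrightarrow> esize F 0 {v} = 1"
  using reach_no_touch[of "{}" "{v}"] by (simp add: esize_def expect_prob_0)

lemma fin_susc_zero: "fin_susc 0"
  unfolding fin_susc_def by (intro exI[of _ 1]) (simp add: esize_zero)

lemma susc_zero_le: "susc 0 \<le> 1"
proof -
  obtain v where "v \<in> V" using connected by (auto simp: connected_graph_def)
  then have "{esize F 0 {v} | F v. v \<in> V \<and> finite F \<and> F \<subseteq> E} \<noteq> {}" by blast
  then show ?thesis unfolding susc_def by (intro cSup_least) (auto simp: esize_zero)
qed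

lemma fin_susc_mono:
  assumes "0 \<le> p" "p \<le> q" "q \<le> 1" "fin_susc q"
  shows "fin_susc p"
proof -
  have "esize F p {v} \<le> susc q" if "v \<in> V" "finite F" "F \<subseteq> E" for v F
    using esize_mono_p[OF assms(1-3), of F "{v}"] that pairs_sub esize_le_susc[OF assms(4) that]
    by (meson finite.simps order_trans)
  then show ?thesis unfolding fin_susc_def by blast
qed

lemma fin_susc_imp_AE:
  assumes "0 \<le> p" "p \<le> 1" "fin_susc p"
  shows "ae_finite p"
  using assms esize_le_susc by (intro AE_finite_cluster) auto

end

locale qt_graph = lf_graph +
  assumes quasi: "quasi_transitive_graph V E"
begin

text \<open>Automorphisms from and to the representative are both recorded, so that none has to be
  inverted later.\<close>

lemma orbit_representatives:
  obtains R where "finite R" "R \<subseteq> V"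
    "\<And>x. x \<in> V \<Longrightarrow> \<exists>r\<in>R. \<exists>\<phi>. graph_automorphism V E \<phi> \<and> x = \<phi> r"
    "\<And>x. x \<in> V \<Longrightarrow> \<exists>r\<in>R. \<exists>\<phi>. graph_automorphism V E \<phi> \<and> r = \<phi> x"
proof -
  have "finite (vertex_orbit V E ` V)" using quasi by (simp add: quasi_transitive_graph_def)
  then obtain R where R: "R \<subseteq> V" "finite R" "vertex_orbit V E ` V = vertex_orbit V E ` R"
    using finite_subset_image[of "vertex_orbit V E ` V" "vertex_orbit V E" V] by auto
  have "graph_automorphism V E id" by (auto simp: graph_automorphism_def)
  then have self: "x \<in> vertex_orbit V E x" for x
    unfolding vertex_orbit_def by (metis (mono_tags, lifting) id_apply mem_Collect_eq)
  have "\<exists>r\<in>R. vertex_orbit V E x = vertex_orbit V E r" if "x \<in> V" for x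
    using that R(3) by (metis imageE imageI)
  then have "\<exists>r\<in>R. x \<in> vertex_orbit V E r \<and> r \<in> vertex_orbit V E x" if "x \<in> V" for x
    using self that by metis
  then show ?thesis using R by (intro that[of R]) (fastforce simp: vertex_orbit_def)+
qed

lemma bounded_degree: "\<exists>d\<ge>1. \<forall>F\<subseteq>E. \<forall>v. card {e \<in> F. v \<in> e} \<le> d"
proof -
  obtain R where R: "finite R" "R \<subseteq> V"
    "\<And>x. x \<in> V \<Longrightarrow> \<exists>r\<in>R. \<exists>\<phi>. graph_automorphism V E \<phi> \<and> r = \<phi> x"
    by (rule orbit_representatives) blast
  let ?deg = "\<lambda>v. card {e \<in> E. v \<in> e}"
  define d where "d = Suc (Max (?deg ` R))"
  have fin: "finite {e \<in> E. v \<in> e}" for v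
    using lf edge_subset by (cases "v \<in> V") (auto simp: locally_finite_graph_def intro: finite_subset[of _ "{}"])
  have "?deg v \<le> d" for v
  proof (cases "v \<in> V")
    case True
    then obtain r \<phi> where r: "r \<in> R" "graph_automorphism V E \<phi>" "r = \<phi> v" using R(3) by blast
    have "?deg v \<le> ?deg r"
    proof (rule card_inj_on_le)
      show "inj_on (image \<phi>) {e \<in> E. v \<in> e}"
        using automorphism_inj(3)[OF r(2)] by (rule inj_on_subset) auto
      show "image \<phi> ` {e \<in> E. v \<in> e} \<subseteq> {e \<in> E. r \<in> e}" using automorphism_edge[OF r(2)] r(3) by auto
    qed (rule fin)
    also have "?deg r \<le> Max (?deg ` R)" using R(1) r(1) by (intro Max_ge) auto
    finally show ?thesis by (simp add: d_def)
  next
    case False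
    then have "{e \<in> E. v \<in> e} = {}" using edge_subset by auto
    then show ?thesis unfolding d_def by (metis card.empty le0)
  qed
  moreover have "card {e \<in> F. v \<in> e} \<le> ?deg v" if "F \<subseteq> E" for F v
    using that by (intro card_mono fin) auto
  ultimately have "\<forall>F\<subseteq>E. \<forall>v. card {e \<in> F. v \<in> e} \<le> d" by (meson order_trans)
  then show ?thesis by (intro exI[of _ d]) (simp add: d_def)
qed

text \<open>Carry \<open>v\<close> to its representative, connect this by a path to the
  representative of \<open>x\<close>, and carry the result to \<open>x\<close>. Finitely many pairs
  of representatives give one bound \<open>D\<close> on the path lengths, independent of
  \<open>p\<close>.\<close>

lemma esize_comparable:
  "\<exists>D. \<forall>p v x F. 0 \<le> p \<longrightarrow> p \<le> 1 \<longrightarrow> v \<in> V \<longrightarrow> x \<in> V \<longrightarrow> finite F \<longrightarrow> F \<subseteq> E \<longrightarrow>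
    (\<exists>F'. finite F' \<and> F' \<subseteq> E \<and> p ^ D * esize F p {v} \<le> esize F' p {x})"
proof -
  obtain R where R: "finite R" "R \<subseteq> V"
    "\<And>x. x \<in> V \<Longrightarrow> \<exists>r\<in>R. \<exists>\<phi>. graph_automorphism V E \<phi> \<and> x = \<phi> r"
    "\<And>x. x \<in> V \<Longrightarrow> \<exists>r\<in>R. \<exists>\<phi>. graph_automorphism V E \<phi> \<and> r = \<phi> x"
    by (rule orbit_representatives) blast
  have "\<exists>k. (r, r') \<in> adjacency E ^^ k" if "r \<in> R" "r' \<in> R" for r r'
    using that R(2) connected by (auto simp: connected_graph_def rtrancl_is_UN_relpow subset_iff)
  then obtain len where len: "\<And>r r'. r \<in> R \<Longrightarrow> r' \<in> R \<Longrightarrow> (r, r') \<in> adjacency E ^^ (len r r')"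
    by metis
  define D where "D = Max ((\<lambda>(r, r'). len r r') ` (R \<times> R))"
  have D: "len r r' \<le> D" if "r \<in> R" "r' \<in> R" for r r'
    unfolding D_def using that R(1) by (intro Max_ge) auto
  show ?thesis
  proof (rule exI[of _ D], intro allI impI)
    fix p :: real and v x F assume p: "0 \<le> p" "p \<le> 1" and v: "v \<in> V" and x: "x \<in> V" and F: "finite F" "F \<subseteq> E"
    obtain r \<phi> where r: "r \<in> R" "graph_automorphism V E \<phi>" "x = \<phi> r" using R(3)[OF x] by blast
    obtain r' \<psi> where r': "r' \<in> R" "graph_automorphism V E \<psi>" "r' = \<psi> v" using R(4)[OF v] by blast
    let ?F1 = "image \<psi> ` F"
    have F1: "finite ?F1" "?F1 \<subseteq> E" "esize F p {v} \<le> esize ?F1 p {r'}"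
      using F automorphism_edge[OF r'(2)] esize_automorphism_ge[OF p r'(2) F v] r'(3) by auto
    obtain F2 where F2: "finite F2" "F2 \<subseteq> E" "p ^ len r r' * esize ?F1 p {r'} \<le> esize F2 p {r}"
      using esize_path_ge[OF p len[OF r(1) r'(1)] F1(1,2)] by blast
    let ?F3 = "image \<phi> ` F2"
    have F3: "finite ?F3" "?F3 \<subseteq> E" "esize F2 p {r} \<le> esize ?F3 p {x}"
      using F2 automorphism_edge[OF r(2)] esize_automorphism_ge[OF p r(2) F2(1,2)] r R(2) by auto
    have "0 \<le> esize F p {v}" unfolding esize_def using p by (intro expect_nonneg) auto
    then have "p ^ D * esize F p {v} \<le> p ^ len r r' * esize ?F1 p {r'}"
      using D[OF r(1) r'(1)] F1(3) p by (intro mult_mono power_decreasing) auto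
    then have "p ^ D * esize F p {v} \<le> esize ?F3 p {x}" using F2(3) F3(3) by linarith
    then show "\<exists>F'. finite F' \<and> F' \<subseteq> E \<and> p ^ D * esize F p {v} \<le> esize F' p {x}"
      using F3 by blast
  qed
qed

end

section \<open>Boundedness of the two-point matrix\<close>

lemma infsum_finite_support:
  fixes f :: "'a \<Rightarrow> real"
  assumes "finite K" "K \<subseteq> V" "\<And>v. v \<in> V - K \<Longrightarrow> f v = 0"
  shows "f summable_on V" "(\<Sum>\<^sub>\<infinity>v\<in>V. f v) = (\<Sum>v\<in>K. f v)"
proof -
  show "f summable_on V"
    using summable_on_finite[OF assms(1), of f] assms
    by (subst summable_on_cong_neutral[of K V f f]) auto
  show "(\<Sum>\<^sub>\<infinity>v\<in>V. f v) = (\<Sum>v\<in>K. f v)"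
    using assms by (subst infsum_cong_neutral[of K V f f]) auto
qed

text \<open>The operator bound is tested on indicators of finite sets only, which is all that the
  count of good edges uses.\<close>

lemma l2_bound_indicator:
  assumes "l2_operator_norm V M < \<infinity>"
  shows "\<exists>B>0. \<forall>K W. finite K \<longrightarrow> K \<subseteq> V \<longrightarrow> finite W \<longrightarrow> W \<subseteq> V \<longrightarrow>
    (\<Sum>u\<in>W. (\<Sum>x\<in>K. M u x)\<^sup>2) \<le> B\<^sup>2 * real (card K)"
proof -
  let ?P = "\<lambda>B. 0 \<le> B \<and> (\<forall>f. square_summable V f \<longrightarrow>
          (\<forall>u\<in>V. (\<lambda>v. M u v * f v) summable_on V) \<and> square_summable V (matrix_apply V M f) \<and>
          l2_norm V (matrix_apply V M f) \<le> B * l2_norm V f)"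
  have "{ereal B | B. ?P B} \<noteq> {}"
  proof
    assume "{ereal B | B. ?P B} = {}"
    then have "l2_operator_norm V M = Inf {}" unfolding l2_operator_norm_def by (rule arg_cong)
    then show False using assms by (simp add: top_ereal_def)
  qed
  then obtain B where B: "?P B" by auto
  have "(\<Sum>u\<in>W. (\<Sum>x\<in>K. M u x)\<^sup>2) \<le> (B + 1)\<^sup>2 * real (card K)"
    if K: "finite K" "K \<subseteq> V" and W: "finite W" "W \<subseteq> V" for K W
  proof -
    define f where "f v = (if v \<in> K then 1 else 0 :: real)" for v
    have f2: "(\<lambda>v. (f v)\<^sup>2) summable_on V" "(\<Sum>\<^sub>\<infinity>v\<in>V. (f v)\<^sup>2) = real (card K)"
      using infsum_finite_support[OF K, of "\<lambda>v. (f v)\<^sup>2"] by (auto simp: f_def)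
    have Mf: "matrix_apply V M f u = (\<Sum>x\<in>K. M u x)" for u
      unfolding matrix_apply_def using infsum_finite_support(2)[OF K, of "\<lambda>v. M u v * f v"]
      by (simp add: f_def)
    have sq: "(\<lambda>u. (matrix_apply V M f u)\<^sup>2) summable_on V"
      and le: "l2_norm V (matrix_apply V M f) \<le> B * l2_norm V f" and B0: "0 \<le> B"
      using B f2(1) unfolding square_summable_def by blast+
    have "(\<Sum>u\<in>W. (\<Sum>x\<in>K. M u x)\<^sup>2) \<le> (\<Sum>\<^sub>\<infinity>u\<in>V. (matrix_apply V M f u)\<^sup>2)"
      unfolding Mf[symmetric] using sq W by (intro finite_sum_le_infsum) auto
    also have "\<dots> = (l2_norm V (matrix_apply V M f))\<^sup>2"
      unfolding l2_norm_def by (simp add: infsum_nonneg)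
    also have "\<dots> \<le> (B * l2_norm V f)\<^sup>2"
      using le by (intro power_mono) (auto simp: l2_norm_def infsum_nonneg)
    also have "\<dots> = B\<^sup>2 * real (card K)"
      by (simp add: l2_norm_def f2 power_mult_distrib)
    also have "\<dots> \<le> (B + 1)\<^sup>2 * real (card K)"
      using B0 by (intro mult_right_mono power_mono) auto
    finally show ?thesis .
  qed
  \<comment> \<open>The shift to \<open>B + 1\<close> makes the constant strictly positive.\<close>
  then show ?thesis using B by (intro exI[of _ "B + 1"]) auto
qed

context qt_graph
begin

definition l2_bdd :: "real \<Rightarrow> real \<Rightarrow> bool" where
  "l2_bdd B p \<longleftrightarrow> (\<forall>F K W. finite F \<longrightarrow> F \<subseteq> E \<longrightarrow> finite K \<longrightarrow> K \<subseteq> V \<longrightarrow> finite W \<longrightarrow>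
    (\<Sum>u\<in>W. (\<Sum>x\<in>K. tau F p x u)\<^sup>2) \<le> B\<^sup>2 * real (card K))"

text \<open>In every finite volume \<open>tau\<close> at \<open>p\<close> lies below the two-point
  matrix at \<open>q\<close>, so one norm bound serves all \<open>p \<le> q\<close>.\<close>

lemma l2_bdd_exists:
  assumes q: "0 \<le> q" "q \<le> 1" "l2_operator_norm V (two_point E q) < \<infinity>"
  shows "\<exists>B>0. \<forall>p. 0 \<le> p \<longrightarrow> p \<le> q \<longrightarrow> l2_bdd B p"
proof -
  obtain B where B: "B > 0" "\<And>K W. finite K \<Longrightarrow> K \<subseteq> V \<Longrightarrow> finite W \<Longrightarrow> W \<subseteq> V \<Longrightarrow>
    (\<Sum>u\<in>W. (\<Sum>x\<in>K. two_point E q u x)\<^sup>2) \<le> B\<^sup>2 * real (card K)"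
    using l2_bound_indicator[OF q(3)] by auto
  have "(\<Sum>u\<in>W. (\<Sum>x\<in>K. tau F p x u)\<^sup>2) \<le> B\<^sup>2 * real (card K)"
    if p: "0 \<le> p" "p \<le> q" and F: "finite F" "F \<subseteq> E" and K: "finite K" "K \<subseteq> V" and W: "finite W" for p F K W
  proof -
    have p1: "p \<le> 1" using p q by auto
    have zero: "tau F p x u = 0" if "x \<in> K" "u \<notin> V" for x u
    proof -
      have "u \<notin> reach S {x}" if "S \<subseteq> F" for S
        using reach_subset_V[of S "{x}"] that F K \<open>x \<in> K\<close> \<open>u \<notin> V\<close> by auto
      then have "tau F p x u = expect F p (\<lambda>_. 0)" unfolding tau_def by (intro expect_cong) simp
      then show ?thesis using F by (simp add: expect_const)
    qed
    have le: "tau F p x u \<le> two_point E q u x" for x u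
      using tau_mono_p[OF p(1,2) q(2) F(1), of u x] tau_le_two_point[OF q(1,2) F, of u x]
      unfolding tau_sym[of F p x u] by linarith
    have "(\<Sum>u\<in>W. (\<Sum>x\<in>K. tau F p x u)\<^sup>2) = (\<Sum>u\<in>W \<inter> V. (\<Sum>x\<in>K. tau F p x u)\<^sup>2)"
      using W zero by (intro sum.mono_neutral_right) (auto intro!: sum.neutral)
    also have "\<dots> \<le> (\<Sum>u\<in>W \<inter> V. (\<Sum>x\<in>K. two_point E q u x)\<^sup>2)"
      using le tau_nonneg[OF p(1) p1] by (intro sum_mono power_mono sum_nonneg) auto
    also have "\<dots> \<le> B\<^sup>2 * real (card K)" using B(2)[OF K] W by auto
    finally show ?thesis .
  qed
  then show ?thesis using B(1) unfolding l2_bdd_def by blast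
qed

end

section \<open>Consequences in infinite volume\<close>

text \<open>Fixes the constants of the graph. The gap between the critical probability and
  \<open>p_two_to_two\<close> enters through \<open>l2\<close>, uniform up to and including the
  critical point, and through \<open>crit_less_1\<close>.\<close>

locale l2_graph = qt_graph V E for V :: "'v set" and E :: "'v set set" +
  fixes d D :: nat and B :: real
  assumes d: "1 \<le> d" and deg: "\<And>F v. F \<subseteq> E \<Longrightarrow> card {e \<in> F. v \<in> e} \<le> d"
    and comparable: "\<And>p v x F. 0 \<le> p \<Longrightarrow> p \<le> 1 \<Longrightarrow> v \<in> V \<Longrightarrow> x \<in> V \<Longrightarrow> finite F \<Longrightarrow> F \<subseteq> E \<Longrightarrow>
      \<exists>F'. finite F' \<and> F' \<subseteq> E \<and> p ^ D * esize F p {v} \<le> esize F' p {x}"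
    and B: "0 < B" and l2: "\<And>p. 0 \<le> p \<Longrightarrow> p \<le> critical_probability V E \<Longrightarrow> l2_bdd B p"
    and crit_less_1: "critical_probability V E < 1"
begin

abbreviation "pc \<equiv> critical_probability V E"

lemma card_touching_E_le:
  assumes "finite H" "H \<subseteq> V"
  shows "card (touching_edges E H) \<le> d * card H"
proof -
  let ?F = "touching_edges E H"
  have "touching_edges ?F H = ?F" by (auto simp: touching_edges_def)
  then show ?thesis
    using card_touching_le[OF finite_touching_E[OF assms] assms(1) deg[OF touching_subset]] by metis
qed

lemma fin_susc_perturb:
  assumes p: "0 \<le> p" "p \<le> q" "q \<le> 1" and fin: "fin_susc p" and small: "(q - p) * susc p * real d < 1"
  shows "fin_susc q"
proof -
  have "esize F q {v} \<le> susc p / (1 - (q - p) * susc p * real d)" if "finite F" "F \<subseteq> E" for F v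
    using p that deg small by (intro esize_perturb pairs_sub esize_le_susc_any fin) auto
  then show ?thesis unfolding fin_susc_def by blast
qed

text \<open>Approximating the supremum costs the factor 1/2, and moving from a nearly optimal vertex
  to \<open>x\<close> costs \<open>p ^ D\<close>; monotonicity in the volume then merges the
  finitely many choices.\<close>

lemma uniform_volume:
  assumes p: "0 < p" "p \<le> 1" and fin: "fin_susc p" and W: "finite W" "W \<subseteq> V" and G: "finite G" "G \<subseteq> E"
  shows "\<exists>F. finite F \<and> F \<subseteq> E \<and> G \<subseteq> F \<and> (\<forall>x\<in>W. p ^ D / 2 * susc p \<le> esize F p {x})"
proof -
  have "susc p / 2 < susc p" using susc_ge_1[OF fin] by simp
  then obtain F0 v where F0: "v \<in> V" "finite F0" "F0 \<subseteq> E" "susc p / 2 < esize F0 p {v}"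
    by (rule susc_approx[OF fin])
  have "\<exists>F'. finite F' \<and> F' \<subseteq> E \<and> p ^ D / 2 * susc p \<le> esize F' p {x}" if "x \<in> W" for x
  proof -
    have "x \<in> V" using that W by auto
    then obtain F' where F': "finite F'" "F' \<subseteq> E" "p ^ D * esize F0 p {v} \<le> esize F' p {x}"
      using comparable[OF less_imp_le[OF p(1)] p(2) F0(1) _ F0(2,3)] by blast
    have "p ^ D * (susc p / 2) \<le> p ^ D * esize F0 p {v}"
      using F0(4) p by (intro mult_left_mono) auto
    then show ?thesis using F' by auto
  qed
  then obtain f where f: "\<And>x. x \<in> W \<Longrightarrow> finite (f x) \<and> f x \<subseteq> E \<and> p ^ D / 2 * susc p \<le> esize (f x) p {x}"
    by metis
  let ?F = "G \<union> (\<Union>x\<in>W. f x)"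
  have F: "finite ?F" "?F \<subseteq> E" using f W G by auto
  have "p ^ D / 2 * susc p \<le> esize ?F p {x}" if "x \<in> W" for x
  proof -
    have "esize (f x) p {x} \<le> esize ?F p {x}"
      using F that p by (intro esize_mono_set pairs_sub) auto
    then show ?thesis using f[OF that] by linarith
  qed
  then show ?thesis using F by blast
qed

text \<open>The finite volume is chosen after the family \<open>\<H>\<close>: large enough to decide
  these clusters and to give each of their vertices a fixed share of the susceptibility.\<close>

lemma sprinkled_clprob_bound:
  assumes p: "0 < p" "p \<le> 1" "p \<le> pc" and s: "0 \<le> s" "s \<le> 1" and fin: "fin_susc p"
    and a: "0 < a" "a \<le> p ^ D / 2" and large: "2 * B \<le> a * susc p" and big: "256 * (real d)\<^sup>2 * B ^ 3 / a ^ 3 \<le> s * susc p"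
  defines "l \<equiv> a / (128 * (real d)\<^sup>2 * B * (susc p)\<^sup>2)"
  assumes \<H>: "finite \<H>" "\<And>H. H \<in> \<H> \<Longrightarrow> finite H \<and> H \<subseteq> V"
  shows "(\<Sum>H\<in>\<H>. clprob (p + s - p * s) v H * exp (l * real (card H))) \<le> exp (- l)"
proof -
  have "finite (\<Union>\<H>)" "\<Union>\<H> \<subseteq> V" "finite (\<Union>H\<in>\<H>. touching_edges E H)" "(\<Union>H\<in>\<H>. touching_edges E H) \<subseteq> E"
    using \<H> finite_touching_E by (auto simp: touching_edges_def)
  then obtain F where F: "finite F" "F \<subseteq> E" "(\<Union>H\<in>\<H>. touching_edges E H) \<subseteq> F"
    "\<And>x. x \<in> \<Union>\<H> \<Longrightarrow> p ^ D / 2 * susc p \<le> esize F p {x}"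
    using uniform_volume[OF p(1,2) fin, of "\<Union>\<H>" "\<Union>H\<in>\<H>. touching_edges E H"] by metis
  have "a * susc p \<le> p ^ D / 2 * susc p"
    using a(2) susc_ge_1[OF fin] by (intro mult_right_mono) auto
  then have low: "a * susc p \<le> esize F p {x}" if "x \<in> \<Union>\<H>" for x
    using F(4)[OF that] by linarith
  have "clprob (p + s - p * s) v H = expect F (p + s - p * s) (\<lambda>S. of_bool (reach S {v} = H))"
    if "H \<in> \<H>" for H
    using F(3) that by (intro clprob_eq F(1,2)) blast
  then have "(\<Sum>H\<in>\<H>. clprob (p + s - p * s) v H * exp (l * real (card H)))
     = (\<Sum>H\<in>\<H>. expect F (p + s - p * s) (\<lambda>S. of_bool (reach S {v} = H)) * exp (l * real (card H)))"
    by simp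
  also have "\<dots> \<le> exp (- l)"
    unfolding l_def
  proof (rule sprinkled_cluster_bound[OF _ p(2) s F(1) pairs_sub[OF F(2)] deg[OF F(2)] d])
    show "esize F p {y} \<le> susc p" for y using fin F by (intro esize_le_susc_any)
    show "1 \<le> susc p" using fin by (rule susc_ge_1)
    show "0 < a" by (rule a)
    show "(\<Sum>u\<in>W. (\<Sum>x\<in>K. tau F p x u)\<^sup>2) \<le> B\<^sup>2 * real (card K)" if "K \<in> \<H>" "finite W" for K W
      using l2[OF less_imp_le[OF p(1)] p(3), unfolded l2_bdd_def, rule_format, OF F(1,2), of K W]
        that \<H>(2)[OF that(1)] by simp
    show "a * susc p \<le> esize F p {x}" if "K \<in> \<H>" "x \<in> K" for K x using low that by blast
  qed (use p B large big \<H> in auto)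
  finally show ?thesis .
qed

lemma clprob_exp_bound:
  assumes p: "0 \<le> p" "p \<le> 1" and fin: "fin_susc p"
  defines "m \<equiv> 1 / (4 * real d * (susc p)\<^sup>2)"
  assumes \<H>: "finite \<H>" "\<And>H. H \<in> \<H> \<Longrightarrow> finite H \<and> H \<subseteq> V"
  shows "(\<Sum>H\<in>\<H>. clprob p v H * exp (m * real (card H))) \<le> exp (2 * m * susc p)"
proof -
  let ?F = "\<Union>H\<in>\<H>. touching_edges E H"
  have F: "finite ?F" "?F \<subseteq> E" using \<H> finite_touching_E by (auto simp: touching_edges_def)
  have "clprob p v H = expect ?F p (\<lambda>S. of_bool (reach S {v} = H))" if "H \<in> \<H>" for H
    using that by (intro clprob_eq F) blast
  then have "(\<Sum>H\<in>\<H>. clprob p v H * exp (m * real (card H)))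
     = (\<Sum>H\<in>\<H>. expect ?F p (\<lambda>S. exp (m * real (card H)) * of_bool (reach S {v} = H)))"
    by (simp add: expect_cmult mult.commute)
  also have "\<dots> = expect ?F p (\<lambda>S. \<Sum>H\<in>\<H>. exp (m * real (card H)) * of_bool (reach S {v} = H))"
    by (simp add: expect_sum)
  also have "\<dots> \<le> expect ?F p (\<lambda>S. exp (m * rsize S {v}))"
    using p
  proof (rule expect_mono)
    fix S
    have "(\<Sum>H\<in>\<H>. exp (m * real (card H)) * of_bool (reach S {v} = H))
      = (\<Sum>H\<in>\<H>. if reach S {v} = H then exp (m * real (card H)) else 0)"
      by (intro sum.cong) auto
    also have "\<dots> = (if reach S {v} \<in> \<H> then exp (m * rsize S {v}) else 0)"
      using \<H>(1) by simp
    finally show "(\<Sum>H\<in>\<H>. exp (m * real (card H)) * of_bool (reach S {v} = H))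
      \<le> exp (m * rsize S {v})" by simp
  qed
  also have "\<dots> \<le> exp (2 * m * susc p)"
    unfolding m_def
    by (rule exp_moment_bound[OF p F(1) pairs_sub[OF F(2)] esize_le_susc_any[OF fin F]
      susc_ge_1[OF fin] deg[OF F(2)] d])
  finally show ?thesis .
qed

end

section \<open>The lower bounds\<close>

text \<open>The factor \<open>C\<close> disappears because \<open>ln C / n\<close> tends to 0; a
  vanishing tail contributes \<open>-\<infinity>\<close>.\<close>

lemma zeta_ge:
  assumes C: "0 < C" and tail: "\<And>n. finite_cluster_tail E p v n \<le> C * exp (- r * real n)"
  shows "ereal r \<le> zeta E v p"
proof -
  let ?f = "\<lambda>n. ereal (1 / real n) * extended_log (finite_cluster_tail E p v n)"
  have "eventually (\<lambda>n. ?f n \<le> ereal (ln C / real n - r)) sequentially"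
    using eventually_gt_at_top[of 0]
  proof eventually_elim
    case (elim n)
    let ?t = "finite_cluster_tail E p v n"
    show ?case
    proof (cases "?t = 0")
      case True
      then show ?thesis using elim by (simp add: extended_log_def)
    next
      case False
      have "0 \<le> ?t" by (simp add: finite_cluster_tail_def)
      then have t: "0 < ?t" using False by simp
      then have "ln ?t \<le> ln (C * exp (- r * real n))" using tail[of n] by simp
      also have "\<dots> = ln C - r * real n" using C by (simp add: ln_mult)
      finally have "ln ?t / real n \<le> (ln C - r * real n) / real n"
        using elim by (intro divide_right_mono) auto
      then show ?thesis using t elim by (simp add: extended_log_def diff_divide_distrib)
    qed
  qed
  then have "limsup ?f \<le> limsup (\<lambda>n. ereal (ln C / real n - r))" by (rule Limsup_mono)
  also have "(\<lambda>n. ln C / real n - r) \<longlonglongrightarrow> 0 - r"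
    by (intro tendsto_diff tendsto_const lim_const_over_n)
  then have "(\<lambda>n. ereal (ln C / real n - r)) \<longlonglongrightarrow> ereal (0 - r)" by (rule tendsto_ereal)
  then have "limsup (\<lambda>n. ereal (ln C / real n - r)) = ereal (0 - r)"
    by (intro lim_imp_Limsup) auto
  finally have "- ereal (0 - r) \<le> - limsup ?f" unfolding ereal_minus_le_minus .
  then show ?thesis by (simp add: zeta_def)
qed

lemma zeta_le:
  assumes "\<And>\<eta> m. 0 < \<eta> \<Longrightarrow> \<exists>n\<ge>m. exp (- (r + \<eta>) * real n) \<le> finite_cluster_tail E p v n"
  shows "zeta E v p \<le> ereal r"
proof (rule ereal_le_epsilon2)
  fix \<eta> :: real assume \<eta>: "0 < \<eta>"
  let ?f = "\<lambda>n. ereal (1 / real n) * extended_log (finite_cluster_tail E p v n)"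
  have "ereal (- (r + \<eta>)) \<le> limsup ?f"
  proof (rule ccontr)
    assume "\<not> ereal (- (r + \<eta>)) \<le> limsup ?f"
    then have "eventually (\<lambda>n. ?f n < ereal (- (r + \<eta>))) sequentially"
      by (intro Limsup_lessD) simp
    then obtain m where m: "\<And>n. n \<ge> m \<Longrightarrow> ?f n < ereal (- (r + \<eta>))"
      by (auto simp: eventually_sequentially)
    \<comment> \<open>\<open>Suc m\<close> keeps \<open>n\<close> positive for the division.\<close>
    obtain n where n: "n \<ge> Suc m" "exp (- (r + \<eta>) * real n) \<le> finite_cluster_tail E p v n"
      using assms[OF \<eta>] by blast
    have t: "0 < finite_cluster_tail E p v n" using n(2) by (rule less_le_trans[OF exp_gt_zero])
    have "- (r + \<eta>) * real n \<le> ln (finite_cluster_tail E p v n)"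
      using n(2) t by (simp add: ln_ge_iff)
    then have "- (r + \<eta>) \<le> ln (finite_cluster_tail E p v n) / real n"
      using n(1) by (subst pos_le_divide_eq) auto
    then have "ereal (- (r + \<eta>)) \<le> ?f n" using t by (simp add: extended_log_def)
    then show False using m[of n] n(1) by simp
  qed
  then show "zeta E v p \<le> ereal r + ereal \<eta>"
    unfolding zeta_def by (simp add: ereal_uminus_le_reorder)
qed

context l2_graph
begin

text \<open>The rate function counts edges and the moment bound vertices;
  \<open>|E(K)| \<le> d |K|\<close> costs the factor \<open>d\<close>.\<close>

lemma tail_le_of_exp_bound:
  assumes p: "0 \<le> p" "p \<le> 1" and v: "v \<in> V" and m: "0 \<le> m"
    and C: "\<And>\<H>. finite \<H> \<Longrightarrow> (\<And>H. H \<in> \<H> \<Longrightarrow> finite H \<and> H \<subseteq> V) \<Longrightarrow>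
      (\<Sum>H\<in>\<H>. clprob p v H * exp (m * real (card H))) \<le> C"
  shows "finite_cluster_tail E p v n \<le> C * exp (- (m / real d) * real n)"
proof (rule tail_le[OF p v])
  fix \<H> assume \<H>: "finite \<H>" "\<And>H. H \<in> \<H> \<Longrightarrow> finite H \<and> H \<subseteq> V \<and> n \<le> card (touching_edges E H)"
  have "(\<Sum>H\<in>\<H>. clprob p v H) \<le> (\<Sum>H\<in>\<H>. (clprob p v H * exp (m * real (card H))) * exp (- (m / real d) * real n))"
  proof (rule sum_mono)
    fix H assume H: "H \<in> \<H>"
    have "n \<le> d * card H" using card_touching_E_le[of H] \<H>(2)[OF H] by linarith
    then have "real n \<le> real d * real (card H)" by (metis of_nat_le_iff of_nat_mult)
    then have "m / real d * real n \<le> m / real d * (real d * real (card H))"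
      using m by (intro mult_left_mono) auto
    then have "1 \<le> exp (m * real (card H)) * exp (- (m / real d) * real n)"
      using d by (simp flip: exp_add)
    then have "clprob p v H * 1 \<le> clprob p v H * (exp (m * real (card H)) * exp (- (m / real d) * real n))"
      by (rule mult_left_mono) (rule clprob_nonneg[OF p])
    then show "clprob p v H \<le> (clprob p v H * exp (m * real (card H))) * exp (- (m / real d) * real n)"
      by (simp add: mult.assoc)
  qed
  also have "\<dots> = (\<Sum>H\<in>\<H>. clprob p v H * exp (m * real (card H))) * exp (- (m / real d) * real n)"
    by (simp add: sum_distrib_right)
  also have "\<dots> \<le> C * exp (- (m / real d) * real n)"
    using \<H> by (intro mult_right_mono C) auto
  finally show "(\<Sum>H\<in>\<H>. clprob p v H) \<le> C * exp (- (m / real d) * real n)" .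
qed

section \<open>Sharpness of the transition and mean-field bounds on the susceptibility\<close>

lemma le_crit:
  assumes "0 \<le> p" "p \<le> 1" "ae_finite p"
  shows "p \<le> pc"
  unfolding critical_probability_def using assms by (intro cSup_upper) (auto intro: bdd_aboveI)

lemma less_crit:
  assumes "r < pc"
  obtains q where "r < q" "q \<le> pc" "0 \<le> q" "q \<le> 1" "ae_finite q"
proof -
  have "{p \<in> {0..1}. ae_finite p} \<noteq> {}"
    using fin_susc_imp_AE[of 0] fin_susc_zero by (auto intro!: exI[of _ 0])
  then obtain q where "q \<in> {p \<in> {0..1}. ae_finite p}" "r < q"
    using assms unfolding critical_probability_def by (meson less_cSupD)
  then show ?thesis using that[of q] le_crit[of q] by auto
qed

lemma fin_susc_le_crit: "0 \<le> p \<Longrightarrow> p \<le> 1 \<Longrightarrow> fin_susc p \<Longrightarrow> p \<le> pc"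
  by (intro le_crit fin_susc_imp_AE)

text \<open>The susceptibility is 1 at density 0, and perturbing from there is allowed while
  \<open>p * d\<close> stays below 1.\<close>

lemma fin_susc_small: "0 \<le> p \<Longrightarrow> p \<le> 1 / (2 * real d) \<Longrightarrow> fin_susc p"
proof (rule fin_susc_perturb[of 0])
  assume p: "0 \<le> p" "p \<le> 1 / (2 * real d)"
  have "1 / (2 * real d) \<le> 1" using d by simp
  then show "p \<le> 1" using p by linarith
  have "(p - 0) * susc 0 * real d \<le> 1 / (2 * real d) * 1 * real d"
    using p susc_zero_le susc_ge_1[OF fin_susc_zero] by (intro mult_mono) auto
  then show "(p - 0) * susc 0 * real d < 1" using d by simp
qed (auto intro: fin_susc_zero)

lemma crit_ge: "1 / (2 * real d) \<le> pc"
proof (rule fin_susc_le_crit)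
  show "fin_susc (1 / (2 * real d))" by (rule fin_susc_small) auto
qed (use d in auto)

lemma crit_pos: "0 < pc"
  using crit_ge d by (smt (verit) divide_pos_pos of_nat_0_less_iff less_le_trans zero_less_one)

text \<open>By the perturbation bound, finiteness cannot be lost within a distance smaller than
  \<open>1 / (d * susc p)\<close>.\<close>

lemma susc_lower:
  assumes "0 \<le> p" "p < r" "r \<le> 1" "fin_susc p" "\<not> fin_susc r"
  shows "1 / (real d * (r - p)) \<le> susc p"
proof -
  have "1 \<le> (r - p) * susc p * real d"
    using fin_susc_perturb[of p r] assms by force
  then show ?thesis using assms d by (simp add: pos_divide_le_eq mult_ac)
qed

text \<open>Constants of the sprinkling argument, uniform in \<open>p \<ge> 1 / (4 d)\<close>.\<close>

definition "a0 = (1 / (4 * real d)) ^ D / 2"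
definition "X0 = 2 * B / a0"
definition "K1 = 256 * (real d)\<^sup>2 * B ^ 3 / a0 ^ 3"
definition "c1 = a0 / (128 * (real d)\<^sup>2 * B)"

lemma constants_pos: "0 < a0" "0 < X0" "0 < K1" "0 < c1"
proof -
  show a0: "0 < a0" using d by (simp add: a0_def)
  show "0 < X0" "0 < K1" "0 < c1" using a0 B d by (auto simp: X0_def K1_def c1_def)
qed

lemma sprinkling:
  assumes p: "1 / (4 * real d) \<le> p" "p < r" "p \<le> pc" "r \<le> 1" and fin: "fin_susc p"
    and large: "X0 \<le> susc p" and big: "K1 \<le> (r - p) * susc p"
    and \<H>: "finite \<H>" "\<And>H. H \<in> \<H> \<Longrightarrow> finite H \<and> H \<subseteq> V"
  shows "(\<Sum>H\<in>\<H>. clprob r v H * exp (c1 / (susc p)\<^sup>2 * real (card H))) \<le> exp (- (c1 / (susc p)\<^sup>2))"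
proof -
  have p0: "0 < p" using p(1) d by (smt (verit) divide_pos_pos mult_pos_pos of_nat_0_less_iff less_le_trans zero_less_one)
  \<comment> \<open>The solution of \<open>p + s - p * s = r\<close>; it is at least
    \<open>r - p\<close>.\<close>
  define s where "s = (r - p) / (1 - p)"
  have p1: "p < 1" using p by linarith
  have s: "0 \<le> s" "s \<le> 1" "r - p \<le> s"
  proof -
    show "0 \<le> s" "s \<le> 1" using p p1 by (auto simp: s_def)
    have "(r - p) * (1 - p) \<le> (r - p) * 1" using p p0 by (intro mult_left_mono) auto
    then show "r - p \<le> s" using p1 by (simp add: s_def pos_le_divide_eq)
  qed
  have sr: "p + s - p * s = r"
  proof -
    have "s * (1 - p) = r - p" using p1 by (simp add: s_def)
    then show ?thesis by (simp add: algebra_simps)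
  qed
  have a: "a0 \<le> p ^ D / 2"
    unfolding a0_def using p d by (intro divide_right_mono power_mono) auto
  have "2 * B \<le> a0 * susc p"
    using large constants_pos(1) by (simp add: X0_def pos_divide_le_eq mult.commute)
  moreover have "256 * (real d)\<^sup>2 * B ^ 3 / a0 ^ 3 \<le> s * susc p"
  proof -
    have "(r - p) * susc p \<le> s * susc p" using s susc_ge_1[OF fin] by (intro mult_right_mono) auto
    then show ?thesis using big by (simp add: K1_def)
  qed
  ultimately have "(\<Sum>H\<in>\<H>. clprob (p + s - p * s) v H * exp (a0 / (128 * (real d)\<^sup>2 * B * (susc p)\<^sup>2) * real (card H)))
     \<le> exp (- (a0 / (128 * (real d)\<^sup>2 * B * (susc p)\<^sup>2)))"
    using p p0 p1 s fin constants_pos(1) a \<H> by (intro sprinkled_clprob_bound) auto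
  then show ?thesis unfolding sr c1_def by simp
qed

text \<open>Otherwise the finite clusters at \<open>r\<close> would have total mass at most
  \<open>exp (- l) < 1\<close>. Together with \<open>susc_lower\<close> this yields both sharpness
  and the mean-field rate.\<close>

lemma sprinkling_infinite:
  assumes p: "1 / (4 * real d) \<le> p" "p < r" "p \<le> pc" "r \<le> 1" and fin: "fin_susc p"
    and large: "X0 \<le> susc p" and AE: "ae_finite r"
  shows "(r - p) * susc p < K1"
proof (rule ccontr)
  assume "\<not> ?thesis"
  then have big: "K1 \<le> (r - p) * susc p" by simp
  obtain v where v: "v \<in> V" using connected by (auto simp: connected_graph_def)
  let ?l = "c1 / (susc p)\<^sup>2"
  have l: "0 < ?l" using constants_pos(4) susc_ge_1[OF fin] by auto
  have r0: "0 \<le> r" using p by (smt (verit) divide_nonneg_nonneg of_nat_0_le_iff)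
  have "(\<Sum>H\<in>\<H>. clprob r v H) \<le> exp (- ?l)"
    if \<H>: "finite \<H>" "\<And>H. H \<in> \<H> \<Longrightarrow> finite H \<and> H \<subseteq> V" for \<H>
  proof -
    have "(\<Sum>H\<in>\<H>. clprob r v H) \<le> (\<Sum>H\<in>\<H>. clprob r v H * exp (?l * real (card H)))"
    proof (rule sum_mono)
      fix H
      have "clprob r v H * 1 \<le> clprob r v H * exp (?l * real (card H))"
        using l r0 p constants_pos(4) by (intro mult_left_mono clprob_nonneg) auto
      then show "clprob r v H \<le> clprob r v H * exp (?l * real (card H))" by simp
    qed
    also have "\<dots> \<le> exp (- ?l)" using sprinkling[OF p fin large big \<H>] .
    finally show ?thesis .
  qed
  then have "1 \<le> exp (- ?l)" using r0 p(4) v AE by (intro measure_finite_cluster_AE) auto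
  then show False using l by simp
qed

text \<open>If finiteness broke down at some \<open>P \<le> q0\<close>, the susceptibility would be
  arbitrarily large just below \<open>P\<close>; but clusters are almost surely finite at some
  \<open>r > q0\<close>, and the fixed distance to \<open>r\<close> keeps it below
  \<open>K1 / (r - p)\<close>.\<close>

lemma fin_susc_below_crit:
  assumes "0 \<le> q0" "q0 < pc"
  shows "fin_susc q0"
proof (rule ccontr)
  assume nf: "\<not> fin_susc q0"
  define A where "A = {p \<in> {0..1}. fin_susc p}"
  have A: "p \<le> q0" if "p \<in> A" for p
  proof (rule ccontr)
    assume "\<not> p \<le> q0"
    then have "fin_susc q0" using fin_susc_mono[of q0 p] that assms by (auto simp: A_def)
    then show False using nf by simp
  qed
  define P where "P = Sup A"
  have bdd: "bdd_above A" using A by (rule bdd_aboveI)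
  have A0: "1 / (2 * real d) \<in> A" using fin_susc_small[of "1 / (2 * real d)"] d by (auto simp: A_def)
  then have P: "1 / (2 * real d) \<le> P" "P \<le> q0"
    using bdd A unfolding P_def by (auto intro: cSup_upper cSup_least)
  obtain r where r: "q0 < r" "r \<le> pc" "0 \<le> r" "r \<le> 1" "ae_finite r"
    using less_crit[OF assms(2)] by blast
  \<comment> \<open>The entries secure, in order, \<open>p \<ge> 1 / (4 d)\<close>,
    \<open>P + \<delta> \<le> 1\<close>, \<open>X0 \<le> susc p\<close> and
    \<open>K1 \<le> (r - P) * susc p\<close>.\<close>
  define \<delta> where "\<delta> = Min {1 / (4 * real d), 1 - pc, 1 / (2 * real d * X0), (r - P) / (2 * real d * K1)}"
  have \<delta>: "0 < \<delta>" "\<delta> \<le> 1 / (4 * real d)" "\<delta> \<le> 1 - pc" "\<delta> \<le> 1 / (2 * real d * X0)"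
    "\<delta> \<le> (r - P) / (2 * real d * K1)"
    using constants_pos d crit_less_1 P r unfolding \<delta>_def by auto
  define p where "p = P - \<delta>"
  have half: "1 / (4 * real d) + 1 / (4 * real d) = 1 / (2 * real d)" using d by (simp add: field_simps)
  have p4: "1 / (4 * real d) \<le> p" using P \<delta> half by (simp add: p_def)
  then have p0: "0 \<le> p" by (smt (verit) divide_nonneg_nonneg of_nat_0_le_iff)
  have "p < Sup A" using \<delta> by (simp add: p_def P_def)
  then obtain p' where p': "p' \<in> A" "p < p'" using A0 less_cSupD[of A p] by blast
  then have fin: "fin_susc p" using fin_susc_mono[of p p'] p0 by (auto simp: A_def)
  \<comment> \<open>Finiteness at \<open>P\<close> itself is left undecided; stepping beyond
    \<open>P\<close> costs a factor 2.\<close>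
  have "P + \<delta> \<notin> A"
    using bdd \<delta>(1) cSup_upper[of "P + \<delta>" A] by (auto simp: P_def)
  then have "\<not> fin_susc (P + \<delta>)" using P \<delta> p0 assms by (auto simp: A_def p_def)
  then have "1 / (real d * (P + \<delta> - p)) \<le> susc p"
    using p0 \<delta> fin P assms by (intro susc_lower) (auto simp: p_def)
  then have low: "1 / (2 * real d * \<delta>) \<le> susc p" by (simp add: p_def mult_ac)
  have "X0 \<le> 1 / (2 * real d * \<delta>)"
    using \<delta>(1,4) constants_pos(2) d by (simp add: field_simps)
  then have large: "X0 \<le> susc p" using low by linarith
  have "K1 \<le> (r - P) * (1 / (2 * real d * \<delta>))"
    using \<delta>(1,5) constants_pos(3) d by (simp add: field_simps)
  also have "\<dots> \<le> (r - p) * susc p"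
    using low P r \<delta>(1) d by (intro mult_mono) (auto simp: p_def)
  also have "\<dots> < K1"
    using p4 P r assms \<delta>(1) fin large by (intro sprinkling_infinite) (auto simp: p_def)
  finally show False by simp
qed

text \<open>The reflected density \<open>2 * pc - p\<close> exceeds \<open>pc\<close>, so the
  susceptibility is not finite there. Using it in place of \<open>pc\<close>, where finiteness is
  undecided at this point, costs a factor 2.\<close>

lemma susc_near_crit:
  assumes p: "0 \<le> p" "p < pc" "2 * pc - p \<le> 1"
  shows "1 / (2 * real d * (pc - p)) \<le> susc p"
proof -
  have "\<not> fin_susc (2 * pc - p)" using fin_susc_le_crit[of "2 * pc - p"] p by auto
  then have "1 / (real d * (2 * pc - p - p)) \<le> susc p"
    using p by (intro susc_lower fin_susc_below_crit) auto
  then show ?thesis by (simp add: algebra_simps)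
qed

definition "\<delta>1 = Min {1 / (4 * real d), 1 - pc, 1 / (2 * real d * X0)}"

lemma \<delta>1: "0 < \<delta>1" "\<delta>1 \<le> 1 / (4 * real d)" "\<delta>1 \<le> 1 - pc" "\<delta>1 \<le> 1 / (2 * real d * X0)"
  using constants_pos d crit_less_1 unfolding \<delta>1_def by auto

lemma susc_bounds:
  assumes p: "p < pc" "pc - p \<le> \<delta>1"
  shows "1 / (4 * real d) \<le> p" "fin_susc p" "X0 \<le> susc p"
    "1 / (2 * real d * (pc - p)) \<le> susc p" "susc p \<le> 2 * K1 / (pc - p)"
proof -
  have half: "1 / (4 * real d) + 1 / (4 * real d) = 1 / (2 * real d)" using d by (simp add: field_simps)
  show p4: "1 / (4 * real d) \<le> p" using crit_ge \<delta>1(2) half p by linarith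
  then have p0: "0 \<le> p" by (smt (verit) divide_nonneg_nonneg of_nat_0_le_iff)
  show fin: "fin_susc p" using p0 p(1) by (rule fin_susc_below_crit)
  show low: "1 / (2 * real d * (pc - p)) \<le> susc p"
    using p0 p \<delta>1(3) by (intro susc_near_crit) auto
  have "X0 \<le> 1 / (2 * real d * \<delta>1)"
    using \<delta>1(1,4) constants_pos(2) d by (simp add: field_simps)
  also have "\<dots> \<le> 1 / (2 * real d * (pc - p))"
    using p d \<delta>1(1) by (intro divide_left_mono mult_left_mono) auto
  finally show large: "X0 \<le> susc p" using low by linarith
  have "(p + pc) / 2 < pc" using p by simp
  \<comment> \<open>Almost sure finiteness at \<open>pc\<close> itself is not known here, so
    \<open>r\<close> is taken beyond the midpoint, which costs a factor 2.\<close>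
  then obtain r where r: "(p + pc) / 2 < r" "r \<le> pc" "0 \<le> r" "r \<le> 1"
    "ae_finite r"
    by (rule less_crit)
  have "(pc - p) / 2 * susc p \<le> (r - p) * susc p"
    using r(1) susc_ge_1[OF fin] by (intro mult_right_mono) (auto simp: field_simps)
  also have "\<dots> < K1"
  proof (rule sprinkling_infinite[OF p4 _ _ r(4) fin large r(5)])
    show "p < r" using r(1) p(1) by (simp add: field_simps)
  qed (use p in auto)
  finally show "susc p \<le> 2 * K1 / (pc - p)" using p by (simp add: pos_le_divide_eq mult_ac)
qed

section \<open>Quadratic lower bounds on either side of the critical point\<close>

lemma zeta_lower_subcritical:
  assumes v: "v \<in> V" and p: "p < pc" "pc - p \<le> \<delta>1"
  shows "ereal (1 / (16 * (real d)\<^sup>2 * K1\<^sup>2) * (pc - p)\<^sup>2) \<le> zeta E v p"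
proof -
  note b = susc_bounds[OF p]
  have p01: "0 \<le> p" "p \<le> 1" using b(1) p crit_less_1 by (smt (verit) divide_nonneg_nonneg of_nat_0_le_iff)+
  let ?m = "1 / (4 * real d * (susc p)\<^sup>2)"
  have "ereal (?m / real d) \<le> zeta E v p"
  proof (rule zeta_ge)
    show "finite_cluster_tail E p v n \<le> exp (2 * ?m * susc p) * exp (- (?m / real d) * real n)" for n
      using clprob_exp_bound[OF p01 b(2)] by (intro tail_le_of_exp_bound[OF p01 v]) auto
  qed simp
  moreover have "1 / (16 * (real d)\<^sup>2 * K1\<^sup>2) * (pc - p)\<^sup>2 \<le> ?m / real d"
  proof -
    have s1: "1 \<le> susc p" using susc_ge_1[OF b(2)] .
    have "(pc - p) * susc p \<le> 2 * K1" using b(5) p by (simp add: pos_le_divide_eq mult.commute)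
    then have "((pc - p) * susc p)\<^sup>2 \<le> (2 * K1)\<^sup>2" using p s1 by (intro power_mono) auto
    then have "(pc - p)\<^sup>2 * (susc p)\<^sup>2 \<le> 4 * K1\<^sup>2" by (simp add: power_mult_distrib)
    then have "(pc - p)\<^sup>2 \<le> 4 * K1\<^sup>2 / (susc p)\<^sup>2"
      using s1 by (subst pos_le_divide_eq) auto
    then have "1 / (16 * (real d)\<^sup>2 * K1\<^sup>2) * (pc - p)\<^sup>2 \<le> 1 / (16 * (real d)\<^sup>2 * K1\<^sup>2) * (4 * K1\<^sup>2 / (susc p)\<^sup>2)"
      by (intro mult_left_mono) auto
    also have "\<dots> = ?m / real d" using constants_pos(3) d by (simp add: power2_eq_square field_simps)
    finally show ?thesis .
  qed
  ultimately show ?thesis by (meson ereal_less_eq(3) order_trans)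
qed

text \<open>At \<open>p = pc - \<kappa> * (r - pc)\<close> the lower bound
  \<open>1 / (2 d (pc - p))\<close> on the susceptibility, times \<open>r - pc\<close>, equals
  \<open>K1\<close>.\<close>

definition "\<kappa> = 1 / (2 * real d * K1)"

lemma \<kappa>_pos: "0 < \<kappa>" using constants_pos(3) d by (simp add: \<kappa>_def)

lemma zeta_lower_supercritical:
  assumes v: "v \<in> V" and r: "pc < r" "r \<le> 1" "\<kappa> * (r - pc) \<le> \<delta>1"
  shows "ereal (c1 * \<kappa>\<^sup>2 / (4 * K1\<^sup>2 * real d) * (r - pc)\<^sup>2) \<le> zeta E v r"
proof -
  let ?e = "r - pc"
  define p where "p = pc - \<kappa> * ?e"
  have e: "0 < \<kappa> * ?e" using r \<kappa>_pos by simp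
  have p: "p < pc" "pc - p \<le> \<delta>1" using e r by (auto simp: p_def)
  note b = susc_bounds[OF p]
  have s1: "1 \<le> susc p" using susc_ge_1[OF b(2)] .
  have r0: "0 \<le> r" using r crit_pos by linarith
  have "K1 = ?e * (1 / (2 * real d * (\<kappa> * ?e)))"
    using r d constants_pos(3) by (simp add: \<kappa>_def)
  also have "\<dots> \<le> (r - p) * susc p"
  proof (rule mult_mono)
    show "1 / (2 * real d * (\<kappa> * ?e)) \<le> susc p" using b(4) by (simp add: p_def)
  qed (use p r e in auto)
  finally have big: "K1 \<le> (r - p) * susc p" .
  let ?l = "c1 / (susc p)\<^sup>2"
  have l: "0 < ?l" using constants_pos(4) s1 by auto
  have "ereal (?l / real d) \<le> zeta E v r"
  proof (rule zeta_ge)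
    show "finite_cluster_tail E r v n \<le> exp (- ?l) * exp (- (?l / real d) * real n)" for n
      using sprinkling[OF b(1) _ _ r(2) b(2,3) big] p r l r0
      by (intro tail_le_of_exp_bound v) auto
  qed simp
  moreover have "c1 * \<kappa>\<^sup>2 / (4 * K1\<^sup>2 * real d) * ?e\<^sup>2 \<le> ?l / real d"
  proof -
    have "(\<kappa> * ?e) * susc p \<le> 2 * K1" using b(5) e by (simp add: p_def pos_le_divide_eq mult.commute)
    then have "((\<kappa> * ?e) * susc p)\<^sup>2 \<le> (2 * K1)\<^sup>2" using e s1 by (intro power_mono) auto
    then have "\<kappa>\<^sup>2 * ?e\<^sup>2 * (susc p)\<^sup>2 \<le> 4 * K1\<^sup>2" by (simp add: power_mult_distrib)
    then have "\<kappa>\<^sup>2 * ?e\<^sup>2 \<le> 4 * K1\<^sup>2 / (susc p)\<^sup>2"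
      using s1 by (subst pos_le_divide_eq) auto
    then have "c1 / (4 * K1\<^sup>2 * real d) * (\<kappa>\<^sup>2 * ?e\<^sup>2) \<le> c1 / (4 * K1\<^sup>2 * real d) * (4 * K1\<^sup>2 / (susc p)\<^sup>2)"
      using constants_pos by (intro mult_left_mono) auto
    also have "\<dots> = ?l / real d" using constants_pos(3) d by (simp add: field_simps)
    finally show ?thesis by simp
  qed
  ultimately show ?thesis by (meson ereal_less_eq(3) order_trans)
qed

lemma zeta_nonneg:
  assumes "v \<in> V"
  shows "0 \<le> zeta E v p"
proof -
  interpret P: prob_space "perc p" by (rule prob_space_perc)
  have "ereal 0 \<le> zeta E v p"
    by (rule zeta_ge[of 1]) (auto simp: finite_cluster_tail_def)
  then show ?thesis by (simp add: zero_ereal_def)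
qed

end

section \<open>The upper bound\<close>

lemma sum_powers_le:
  fixes t :: real
  assumes t: "0 \<le> t" "t < 1" and M: "finite M" "\<And>m. m \<in> M \<Longrightarrow> n \<le> m"
  shows "(\<Sum>m\<in>M. t ^ m) \<le> t ^ n / (1 - t)"
proof -
  obtain N where N: "M \<subseteq> {..<n + N}"
  proof
    show "M \<subseteq> {..<n + Suc (Max M)}" using M(1) by (auto simp: less_Suc_eq_le intro!: trans_le_add2)
  qed
  have "(\<Sum>m\<in>M. t ^ m) \<le> (\<Sum>m\<in>{n..<n + N}. t ^ m)"
    using N M t by (intro sum_mono2) auto
  also have "\<dots> = (\<Sum>i<N. t ^ (n + i))"
    by (rule sum.reindex_bij_witness[of _ "\<lambda>i. n + i" "\<lambda>m. m - n"]) auto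
  also have "\<dots> = t ^ n * ((1 - t ^ N) / (1 - t))"
    using t by (simp add: power_add sum_gp_strict flip: sum_distrib_left)
  also have "\<dots> \<le> t ^ n * (1 / (1 - t))"
    using t by (intro mult_left_mono divide_right_mono) auto
  finally show ?thesis by simp
qed

context lf_graph
begin

text \<open>An open edge is at least as likely at \<open>q\<close> and a closed one loses the factor
  \<open>(1 - q) / (1 - p)\<close>; the bound pays for this on every edge.\<close>

lemma expect_weight_mono:
  assumes p: "0 \<le> p" "p \<le> q" "q < 1" and f: "\<And>S. 0 \<le> f S" and F: "finite F"
  shows "expect F p f \<le> ((1 - p) / (1 - q)) ^ card F * expect F q f"
  unfolding expect_def sum_distrib_left
proof (rule sum_mono)
  fix S assume "S \<in> Pow F"
  then have S: "S \<subseteq> F" by simp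
  have card: "card F = card S + card (F - S)"
    using F S by (metis card_Diff_subset card_mono finite_subset le_add_diff_inverse)
  have r: "1 \<le> (1 - p) / (1 - q)" using p by simp
  have "p ^ card S \<le> ((1 - p) / (1 - q)) ^ card S * q ^ card S"
  proof -
    have "1 * p ^ card S \<le> ((1 - p) / (1 - q)) ^ card S * q ^ card S"
      using r p by (intro mult_mono power_mono one_le_power) auto
    then show ?thesis by simp
  qed
  moreover have "(1 - p) ^ card (F - S) = ((1 - p) / (1 - q)) ^ card (F - S) * (1 - q) ^ card (F - S)"
    using p by (simp add: power_divide)
  ultimately have "p ^ card S * (1 - p) ^ card (F - S)
    \<le> (((1 - p) / (1 - q)) ^ card S * q ^ card S) * (((1 - p) / (1 - q)) ^ card (F - S) * (1 - q) ^ card (F - S))"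
    using p by (intro mult_mono) auto
  also have "\<dots> = ((1 - p) / (1 - q)) ^ card F * (q ^ card S * (1 - q) ^ card (F - S))"
    by (simp add: card power_add mult_ac)
  finally show "p ^ card S * (1 - p) ^ card (F - S) * f S
    \<le> ((1 - p) / (1 - q)) ^ card F * (q ^ card S * (1 - q) ^ card (F - S) * f S)"
    using f[of S] by (simp add: mult_right_mono flip: mult.assoc)
qed

lemma clprob_le_power:
  assumes "0 \<le> p" "p \<le> q" "q < 1" "finite H" "H \<subseteq> V"
  shows "clprob p v H \<le> ((1 - p) / (1 - q)) ^ card (touching_edges E H) * clprob q v H"
  unfolding clprob_def using assms finite_touching_E by (intro expect_weight_mono) auto

text \<open>Each edge covers two vertices, and \<open>v\<close> may be uncovered, so a cluster with
  few touching edges is small. This bounds vertices by edges, opposite to the degree bound.\<close>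

lemma clprob_eq_0:
  assumes H: "finite H" "H \<subseteq> V" and small: "2 * card (touching_edges E H) + 1 < card H"
  shows "clprob p v H = 0"
proof -
  let ?F = "touching_edges E H"
  have fin: "finite ?F" by (rule finite_touching_E[OF H])
  have "reach S {v} \<noteq> H" if S: "S \<subseteq> ?F" for S
  proof
    assume "reach S {v} = H"
    then have "H \<subseteq> {v} \<union> \<Union>?F" using reach_subset_Union[of S "{v}"] S by blast
    moreover have pF: "pairs ?F" by (intro pairs_sub touching_subset)
    then have "finite (\<Union>?F)" using fin by (auto simp: pairs_def)
    ultimately have "card H \<le> card ({v} \<union> \<Union>?F)" by (intro card_mono) auto
    also have "\<dots> \<le> 1 + card (\<Union>?F)" using card_Un_le[of "{v}" "\<Union>?F"] by simp
    also have "card (\<Union>?F) \<le> (\<Sum>e\<in>?F. card e)" using card_Union_le_sum_card .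
    also have "\<dots> \<le> (\<Sum>e\<in>?F. 2)"
      using pF by (intro sum_mono) (auto simp: pairs_def)
    finally show False using small by simp
  qed
  then have "clprob p v H = expect ?F p (\<lambda>_. 0)" unfolding clprob_def by (intro expect_cong) auto
  then show ?thesis using fin by (simp add: expect_const)
qed

text \<open>The tilted weights \<open>(q\<^sup>2 / p)\<^sup>o ((1 - q)\<^sup>2 / (1 - p))\<^sup>c\<close> that appear in the Cauchy--Schwarz inequality are,
  up to the factor \<open>Z\<^sup>m\<close>, again percolation weights.\<close>

lemma sum_clprob_cauchy_schwarz:
  assumes p: "0 < p" "p < 1" and q: "0 \<le> q" "q \<le> 1"
    and \<H>: "finite \<H>" "\<And>H. H \<in> \<H> \<Longrightarrow> finite H \<and> H \<subseteq> V \<and> card (touching_edges E H) = m"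
  shows "(\<Sum>H\<in>\<H>. clprob q v H)\<^sup>2 \<le> (\<Sum>H\<in>\<H>. clprob p v H) * (1 + (p - q)\<^sup>2 / (p * (1 - p))) ^ m"
proof -
  \<comment> \<open>\<open>Z - 1\<close> is the chi-square distance between the Bernoulli laws of
    densities \<open>q\<close> and \<open>p\<close>, and \<open>r\<close> is the density of the
    tilted law.\<close>
  define Z where "Z = q\<^sup>2 / p + (1 - q)\<^sup>2 / (1 - p)"
  define r where "r = (q\<^sup>2 / p) / Z"
  have Z: "Z = 1 + (p - q)\<^sup>2 / (p * (1 - p))"
    using p by (simp add: Z_def field_simps power2_eq_square)
  have Zpos: "0 < Z" unfolding Z using p by (intro add_pos_nonneg) auto
  have rZ: "r * Z = q\<^sup>2 / p" "(1 - r) * Z = (1 - q)\<^sup>2 / (1 - p)"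
    using Zpos by (auto simp: r_def left_diff_distrib) (simp add: Z_def)
  have r: "0 \<le> r" "r \<le> 1"
  proof -
    show "0 \<le> r" using p Zpos by (simp add: r_def)
    have "0 \<le> (1 - r) * Z" unfolding rZ using p by auto
    then show "r \<le> 1" using Zpos by (simp add: zero_le_mult_iff)
  qed
  define w where "w x S = x ^ card S * (1 - x) ^ (m - card S)" for x :: real and S :: "'v set set"
  define I where "I = (SIGMA H:\<H>. {S \<in> Pow (touching_edges E H). reach S {v} = H})"
  have fin: "finite (touching_edges E H)" if "H \<in> \<H>" for H using \<H>(2)[OF that] finite_touching_E by auto
  have cl: "(\<Sum>H\<in>\<H>. clprob x v H) = (\<Sum>(H, S)\<in>I. w x S)" for x
  proof -
    have "clprob x v H = (\<Sum>S\<in>{S \<in> Pow (touching_edges E H). reach S {v} = H}. w x S)" if H: "H \<in> \<H>" for H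
    proof -
      have "clprob x v H = (\<Sum>S\<in>Pow (touching_edges E H). if reach S {v} = H then w x S else 0)"
        unfolding clprob_def expect_def
      proof (rule sum.cong)
        fix S assume "S \<in> Pow (touching_edges E H)"
        then have "card (touching_edges E H - S) = m - card S"
          using fin[OF H] \<H>(2)[OF H] by (auto simp: card_Diff_subset finite_subset)
        then show "x ^ card S * (1 - x) ^ card (touching_edges E H - S) * of_bool (reach S {v} = H)
          = (if reach S {v} = H then w x S else 0)" by (simp add: w_def)
      qed simp
      also have "\<dots> = (\<Sum>S\<in>{S \<in> Pow (touching_edges E H). reach S {v} = H}. w x S)"
        using fin[OF H] by (intro sum.inter_filter[symmetric]) auto
      finally show ?thesis .
    qed
    then show ?thesis unfolding I_def using \<H>(1) fin by (subst sum.Sigma[symmetric]) auto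
  qed
  have w0: "0 \<le> w q S" "0 < w p S" for S using p q by (auto simp: w_def)
  have wr: "(w q S)\<^sup>2 / w p S = Z ^ m * w r S" if "(H, S) \<in> I" for H S
  proof -
    have "card S \<le> m"
      using that \<H>(2)[of H] card_mono[OF fin[of H], of S] by (auto simp: I_def)
    then have "Z ^ m = Z ^ card S * Z ^ (m - card S)" by (simp flip: power_add)
    then have "Z ^ m * w r S = (r * Z) ^ card S * ((1 - r) * Z) ^ (m - card S)"
      by (simp add: w_def power_mult_distrib mult_ac)
    also have "\<dots> = (w q S)\<^sup>2 / w p S"
      unfolding rZ by (simp add: w_def power_divide power_mult_distrib flip: power_mult) (simp add: mult.commute)
    finally show ?thesis by simp
  qed
  have "(\<Sum>H\<in>\<H>. clprob q v H)\<^sup>2 = (\<Sum>(H, S)\<in>I. sqrt (w p S) * (w q S / sqrt (w p S)))\<^sup>2"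
    unfolding cl using w0(2) by (simp add: less_imp_neq[symmetric] less_imp_le)
  also have "\<dots> \<le> (\<Sum>i\<in>I. (sqrt (w p (snd i)))\<^sup>2) * (\<Sum>i\<in>I. (w q (snd i) / sqrt (w p (snd i)))\<^sup>2)"
    unfolding case_prod_unfold by (rule Cauchy_Schwarz_ineq_sum)
  also have "(\<Sum>i\<in>I. (sqrt (w p (snd i)))\<^sup>2) = (\<Sum>H\<in>\<H>. clprob p v H)"
    unfolding cl case_prod_unfold using w0(2) by (intro sum.cong) (auto simp: less_imp_le)
  also have "(\<Sum>i\<in>I. (w q (snd i) / sqrt (w p (snd i)))\<^sup>2) = (\<Sum>i\<in>I. Z ^ m * w r (snd i))"
  proof (rule sum.cong)
    fix i assume "i \<in> I"
    then have "(w q (snd i))\<^sup>2 / w p (snd i) = Z ^ m * w r (snd i)"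
      using wr[of "fst i" "snd i"] by simp
    then show "(w q (snd i) / sqrt (w p (snd i)))\<^sup>2 = Z ^ m * w r (snd i)"
      using w0(2)[of "snd i"] by (simp add: power_divide)
  qed simp
  also have "\<dots> = Z ^ m * (\<Sum>H\<in>\<H>. clprob r v H)"
    unfolding cl case_prod_unfold by (simp add: sum_distrib_left)
  \<comment> \<open>The tilted law is \<open>r\<close>-percolation, whose cluster probabilities sum
    to at most 1.\<close>
  also have "\<dots> \<le> Z ^ m * 1"
    using Zpos \<H> r by (intro mult_left_mono sum_clprob_le_1) auto
  finally show ?thesis
    using p by (simp add: Z mult_left_mono sum_nonneg clprob_nonneg)
qed

end

context l2_graph
begin

text \<open>If the finite clusters had an exponential tail at \<open>pc\<close>, then the tail would be uniformly
  exponential just below \<open>pc\<close>, and the susceptibility would stay bounded there.\<close>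

lemma critical_subexponential:
  assumes v: "v \<in> V" and \<eta>: "0 < \<eta>"
  shows "\<exists>m\<ge>m0. \<exists>\<H>. finite \<H> \<and> (\<forall>H\<in>\<H>. finite H \<and> H \<subseteq> V \<and> card (touching_edges E H) = m)
    \<and> exp (- \<eta> * real m) < (\<Sum>H\<in>\<H>. clprob pc v H)"
proof (rule ccontr)
  assume "\<not> ?thesis"
  then have small: "(\<Sum>H\<in>\<H>. clprob pc v H) \<le> exp (- \<eta> * real m)"
    if "m0 \<le> m" "finite \<H>" "\<And>H. H \<in> \<H> \<Longrightarrow> finite H \<and> H \<subseteq> V \<and> card (touching_edges E H) = m" for m \<H>
    using that by (meson not_le)
  \<comment> \<open>Passing from \<open>pc\<close> to \<open>p\<close> costs at most
    \<open>exp (\<eta> / 2)\<close> per edge, which leaves the decay \<open>t\<close> per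
    edge.\<close>
  define t where "t = exp (- \<eta> / 2)"
  have t: "0 < t" "t < 1" using \<eta> by (auto simp: t_def)
  define \<delta> where "\<delta> = Min {\<delta>1, (1 - pc) * (exp (\<eta> / 2) - 1), pc / 2}"
  have \<delta>: "0 < \<delta>" "\<delta> \<le> \<delta>1" "\<delta> \<le> (1 - pc) * (exp (\<eta> / 2) - 1)" "\<delta> \<le> pc / 2"
    using \<delta>1(1) crit_less_1 crit_pos \<eta> unfolding \<delta>_def by auto
  \<comment> \<open>A cluster of at least \<open>k\<close> vertices has about \<open>k / 2\<close>
    touching edges or more, so the decay per vertex is the square root of \<open>t\<close>.\<close>
  define u where "u = sqrt t"
  have u: "0 < u" "u < 1" "u\<^sup>2 = t" using t by (auto simp: u_def)
  \<comment> \<open>Large enough both for the trivial bound 1 when \<open>k \<le> 2 * m0 + 2\<close>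
    and for the geometric series beyond.\<close>
  define G where "G = 1 / (u ^ (2 * m0 + 2) * (1 - t))"
  have G1: "1 \<le> u ^ (2 * m0 + 2) * G" using u t by (simp add: G_def)
  have G0: "0 < G" using u t by (simp add: G_def)
  have tail: "(\<Sum>H\<in>\<H>. clprob p v H) \<le> G * u ^ k"
    if p: "pc - \<delta> \<le> p" "p < pc" and \<H>: "finite \<H>" "\<And>H. H \<in> \<H> \<Longrightarrow> finite H \<and> H \<subseteq> V \<and> k \<le> card H"
    for p \<H> k
  proof (cases "k \<le> 2 * m0 + 2")
    case True
    have "(\<Sum>H\<in>\<H>. clprob p v H) \<le> 1"
      using \<H> p \<delta> crit_less_1 crit_pos by (intro sum_clprob_le_1) auto
    also have "\<dots> \<le> u ^ (2 * m0 + 2) * G" by (rule G1)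
    also have "\<dots> \<le> u ^ k * G" using True u G0 by (intro mult_right_mono power_decreasing) auto
    finally show ?thesis by (simp add: mult.commute)
  next
    case False
    have p01: "0 \<le> p" "p \<le> 1" using p \<delta> crit_less_1 crit_pos by auto
    define n where "n = k div 2"
    define c where "c H = card (touching_edges E H)" for H
    define \<H>' where "\<H>' = {H \<in> \<H>. k \<le> 2 * c H + 1}"
    have n: "m0 \<le> n" "k \<le> 2 * n + 1" using False by (auto simp: n_def)
    have ratio: "(1 - p) / (1 - pc) \<le> exp (\<eta> / 2)"
    proof -
      have "1 - p \<le> exp (\<eta> / 2) * (1 - pc)"
        using p \<delta>(3) by (simp add: algebra_simps)
      then show ?thesis using crit_less_1 by (simp add: pos_divide_le_eq)
    qed
    have "(\<Sum>H\<in>\<H>. clprob p v H) = (\<Sum>H\<in>\<H>'. clprob p v H)"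
    proof (rule sum.mono_neutral_right)
      show "\<forall>H\<in>\<H> - \<H>'. clprob p v H = 0"
      proof
        fix H assume H: "H \<in> \<H> - \<H>'"
        then have "finite H \<and> H \<subseteq> V \<and> k \<le> card H" "2 * c H + 1 < k" using \<H>(2) by (auto simp: \<H>'_def)
        then show "clprob p v H = 0" by (intro clprob_eq_0) (auto simp: c_def)
      qed
    qed (use \<H> in \<open>auto simp: \<H>'_def\<close>)
    also have "\<dots> \<le> (\<Sum>H\<in>\<H>'. exp (\<eta> / 2) ^ c H * clprob pc v H)"
    proof (rule sum_mono)
      fix H assume "H \<in> \<H>'"
      then have "finite H" "H \<subseteq> V" using \<H> by (auto simp: \<H>'_def)
      then have "clprob p v H \<le> ((1 - p) / (1 - pc)) ^ c H * clprob pc v H"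
        unfolding c_def using p p01 crit_less_1 by (intro clprob_le_power) auto
      also have "\<dots> \<le> exp (\<eta> / 2) ^ c H * clprob pc v H"
        using ratio p p01 crit_less_1 crit_pos
        by (intro mult_right_mono power_mono clprob_nonneg) auto
      finally show "clprob p v H \<le> exp (\<eta> / 2) ^ c H * clprob pc v H" .
    qed
    also have "\<dots> = (\<Sum>m\<in>c ` \<H>'. \<Sum>H\<in>{H \<in> \<H>'. c H = m}. exp (\<eta> / 2) ^ c H * clprob pc v H)"
      using \<H>(1) by (intro sum.image_gen) (auto simp: \<H>'_def)
    also have "\<dots> \<le> (\<Sum>m\<in>c ` \<H>'. t ^ m)"
    proof (rule sum_mono)
      fix m assume "m \<in> c ` \<H>'"
      then have "m0 \<le> m" using n by (auto simp: \<H>'_def n_def)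
      have "(\<Sum>H\<in>{H \<in> \<H>'. c H = m}. exp (\<eta> / 2) ^ c H * clprob pc v H)
        = exp (\<eta> / 2) ^ m * (\<Sum>H\<in>{H \<in> \<H>'. c H = m}. clprob pc v H)"
        by (simp add: sum_distrib_left)
      also have "\<dots> \<le> exp (\<eta> / 2) ^ m * exp (- \<eta> * real m)"
        using \<open>m0 \<le> m\<close> \<H> by (intro mult_left_mono small) (auto simp: \<H>'_def c_def)
      also have "\<dots> = t ^ m"
        by (simp add: t_def exp_of_nat_mult[symmetric] exp_add[symmetric] algebra_simps)
      finally show "(\<Sum>H\<in>{H \<in> \<H>'. c H = m}. exp (\<eta> / 2) ^ c H * clprob pc v H) \<le> t ^ m" .
    qed
    also have "\<dots> \<le> t ^ n / (1 - t)"
      using t \<H>(1) by (intro sum_powers_le) (auto simp: \<H>'_def n_def)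
    also have "\<dots> = u ^ (2 * n) / (1 - t)" by (simp add: u(3)[symmetric] power_mult)
    also have "\<dots> \<le> (u ^ k / u ^ (2 * m0 + 2)) / (1 - t)"
    proof (intro divide_right_mono)
      have "u ^ (2 * n) * u ^ (2 * m0 + 2) \<le> u ^ k"
        unfolding power_add[symmetric] using u n by (intro power_decreasing) auto
      then show "u ^ (2 * n) \<le> u ^ k / u ^ (2 * m0 + 2)" using u by (simp add: pos_le_divide_eq)
    qed (use t in auto)
    also have "\<dots> = G * u ^ k" by (simp add: G_def)
    finally show ?thesis .
  qed
  \<comment> \<open>Summing the tail over \<open>k\<close> bounds the expected size, uniformly in
    the volume and in \<open>p\<close>.\<close>
  have bounded: "esize F p {v} \<le> G / (1 - u)"
    if p: "pc - \<delta> \<le> p" "p < pc" and F: "finite F" "F \<subseteq> E" for p F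
  proof -
    have p01: "0 \<le> p" "p \<le> 1" using p \<delta> crit_less_1 crit_pos by auto
    have fin: "fin_susc p" using p01(1) p(2) by (rule fin_susc_below_crit)
    define N where "N = Suc (card ({v} \<union> \<Union>F))"
    have finU: "finite ({v} \<union> \<Union>F)" using F pairs_sub[OF F(2)] by (auto simp: pairs_def)
    have "esize F p {v} = expect F p (\<lambda>S. \<Sum>k\<in>{1..<N}. of_bool (k \<le> card (reach S {v})))"
      unfolding esize_def
    proof (rule expect_cong)
      fix S assume "S \<subseteq> F"
      then have "reach S {v} \<subseteq> {v} \<union> \<Union>F" using reach_subset_Union[of S "{v}"] by blast
      then have "card (reach S {v}) < N" unfolding N_def using finU by (simp add: card_mono less_Suc_eq_le)
      then have "{1..<N} \<inter> {k. k \<le> card (reach S {v})} = {1..card (reach S {v})}" by auto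
      then show "rsize S {v} = (\<Sum>k\<in>{1..<N}. of_bool (k \<le> card (reach S {v})))"
        by (simp add: of_bool_def sum.If_cases)
    qed
    also have "\<dots> = (\<Sum>k\<in>{1..<N}. expect F p (\<lambda>S. of_bool (k \<le> card (reach S {v}))))"
      by (rule expect_sum)
    also have "\<dots> \<le> (\<Sum>k\<in>{1..<N}. G * u ^ k)"
    proof (rule sum_mono)
      fix k
      show "expect F p (\<lambda>S. of_bool (k \<le> card (reach S {v}))) \<le> G * u ^ k"
        using tail[OF p] by (intro expect_card_ge_le[OF p01 v F fin_susc_imp_AE[OF p01 fin]]) auto
    qed
    also have "\<dots> = G * (\<Sum>k\<in>{1..<N}. u ^ k)" by (simp add: sum_distrib_left)
    also have "\<dots> \<le> G * (u ^ 0 / (1 - u))"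
      using u G0 by (intro mult_left_mono sum_powers_le) auto
    finally show ?thesis by simp
  qed
  \<comment> \<open>The power of \<open>pc / 2\<close>, a lower bound for \<open>p\<close>,
    transfers the estimate from \<open>v\<close> to all vertices.\<close>
  define X where "X = G / (1 - u) / (pc / 2) ^ D"
  have "susc p \<le> X" if p: "pc - \<delta> \<le> p" "p < pc" for p
  proof (rule ccontr)
    assume "\<not> susc p \<le> X"
    have p01: "0 \<le> p" "p \<le> 1" using p \<delta> crit_less_1 crit_pos by auto
    have fin: "fin_susc p" using p01(1) p(2) by (rule fin_susc_below_crit)
    have "X < susc p" using \<open>\<not> susc p \<le> X\<close> by simp
    then obtain F w where F: "w \<in> V" "finite F" "F \<subseteq> E" "X < esize F p {w}"
      by (rule susc_approx[OF fin])
    obtain F' where F': "finite F'" "F' \<subseteq> E" "p ^ D * esize F p {w} \<le> esize F' p {v}"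
      using comparable[OF p01 F(1) v F(2,3)] by blast
    have X0: "0 \<le> X" using G0 u crit_pos by (simp add: X_def)
    have "G / (1 - u) = (pc / 2) ^ D * X" using crit_pos by (simp add: X_def)
    also have "\<dots> \<le> p ^ D * X"
      using p \<delta> crit_pos X0 by (intro mult_right_mono power_mono) auto
    also have "\<dots> < p ^ D * esize F p {w}"
      using F(4) p \<delta> crit_pos by (intro mult_strict_left_mono) auto
    also have "\<dots> \<le> G / (1 - u)" using F'(3) bounded[OF p F'(1,2)] by linarith
    finally show False by simp
  qed
  note susc_le = this
  have Xpos: "0 < X" using G0 u crit_pos by (simp add: X_def)
  \<comment> \<open>At this distance the divergence bound would force the susceptibility to be at
    least \<open>2 * X\<close>.\<close>
  define \<epsilon> where "\<epsilon> = min \<delta> (1 / (4 * real d * X))"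
  have \<epsilon>: "0 < \<epsilon>" "\<epsilon> \<le> \<delta>" "\<epsilon> \<le> 1 / (4 * real d * X)" using \<delta> Xpos d by (auto simp: \<epsilon>_def)
  have "1 / (2 * real d * \<epsilon>) \<le> susc (pc - \<epsilon>)"
    using susc_bounds(4)[of "pc - \<epsilon>"] \<epsilon> \<delta> by simp
  also have "\<dots> \<le> X" using \<epsilon> by (intro susc_le) auto
  finally have "1 \<le> X * (2 * real d * \<epsilon>)" using \<epsilon> d by (simp add: pos_divide_le_eq)
  moreover have "X * (2 * real d * \<epsilon>) \<le> X * (2 * real d * (1 / (4 * real d * X)))"
    using \<epsilon> Xpos by (intro mult_left_mono) auto
  moreover have "X * (2 * real d * (1 / (4 * real d * X))) = 1 / 2" using Xpos d by simp
  ultimately show False by simp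
qed

lemma zeta_upper:
  assumes v: "v \<in> V" and p: "0 < p" "p < 1"
  shows "zeta E v p \<le> ereal ((p - pc)\<^sup>2 / (p * (1 - p)))"
proof (rule zeta_le)
  fix \<eta> :: real and m0 assume \<eta>: "0 < \<eta>"
  let ?x = "(p - pc)\<^sup>2 / (p * (1 - p))"
  \<comment> \<open>\<open>\<eta> / 2\<close>, because the critical probability enters
    squared.\<close>
  obtain m \<H> where m: "m0 \<le> m" and \<H>: "finite \<H>" "\<And>H. H \<in> \<H> \<Longrightarrow> finite H \<and> H \<subseteq> V \<and> card (touching_edges E H) = m"
    and low: "exp (- (\<eta> / 2) * real m) < (\<Sum>H\<in>\<H>. clprob pc v H)"
    using critical_subexponential[OF v, of "\<eta> / 2" m0] \<eta> by auto
  have Z: "(1 + ?x) ^ m \<le> exp (?x * real m)"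
  proof -
    have "(1 + ?x) ^ m \<le> exp ?x ^ m" using p by (intro power_mono) auto
    then show ?thesis by (simp add: exp_of_nat_mult[symmetric] mult.commute)
  qed
  have "exp (- \<eta> * real m) = (exp (- (\<eta> / 2) * real m))\<^sup>2"
    by (simp add: power2_eq_square flip: exp_add)
  also have "\<dots> \<le> (\<Sum>H\<in>\<H>. clprob pc v H)\<^sup>2"
    using low by (intro power_mono) auto
  also have "\<dots> \<le> (\<Sum>H\<in>\<H>. clprob p v H) * (1 + ?x) ^ m"
    using p \<H> crit_pos crit_less_1 by (intro sum_clprob_cauchy_schwarz) auto
  also have "\<dots> \<le> finite_cluster_tail E p v m * exp (?x * real m)"
    using Z \<H> p v by (intro mult_mono tail_ge) (auto simp: finite_cluster_tail_def)
  finally have "exp (- \<eta> * real m) * exp (- (?x * real m))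
      \<le> finite_cluster_tail E p v m * exp (?x * real m) * exp (- (?x * real m))"
    by (rule mult_right_mono) simp
  then have "exp (- (?x + \<eta>) * real m) \<le> finite_cluster_tail E p v m"
    by (simp add: mult.assoc algebra_simps flip: exp_add)
  then show "\<exists>n\<ge>m0. exp (- (?x + \<eta>) * real n) \<le> finite_cluster_tail E p v n"
    using m by blast
qed

lemma zeta_bounds:
  "\<exists>\<delta> c C :: real. \<delta> > 0 \<and> c > 0 \<and> C > 0 \<and>
     (\<forall>v\<in>V. \<forall>p\<in>{pc - \<delta> <..< pc + \<delta>}.
        ereal (c * \<bar>p - pc\<bar>\<^sup>2) \<le> zeta E v p \<and> zeta E v p \<le> ereal (C * \<bar>p - pc\<bar>\<^sup>2))"
proof -
  \<comment> \<open>\<open>\<delta>1 / \<kappa>\<close> keeps the base point of the supercritical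
    bound within \<open>\<delta>1\<close> of \<open>pc\<close>; the last two entries keep
    \<open>p * (1 - p)\<close> above a quarter of \<open>pc * (1 - pc)\<close>.\<close>
  define \<delta> where "\<delta> = Min {\<delta>1, \<delta>1 / \<kappa>, pc / 2, (1 - pc) / 2}"
  have \<delta>: "\<delta> \<le> \<delta>1" "\<delta> \<le> \<delta>1 / \<kappa>" "\<delta> \<le> pc / 2" "\<delta> \<le> (1 - pc) / 2"
    unfolding \<delta>_def by (rule Min_le; simp)+
  have \<delta>0: "0 < \<delta>"
    using \<delta>1(1) \<kappa>_pos crit_pos crit_less_1 unfolding \<delta>_def by auto
  define c where "c = min (1 / (16 * (real d)\<^sup>2 * K1\<^sup>2)) (c1 * \<kappa>\<^sup>2 / (4 * K1\<^sup>2 * real d))"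
  define C where "C = 4 / (pc * (1 - pc))"
  have c: "0 < c" using constants_pos \<kappa>_pos d by (simp add: c_def)
  have C: "0 < C" using crit_pos crit_less_1 by (simp add: C_def)
  have "ereal (c * \<bar>p - pc\<bar>\<^sup>2) \<le> zeta E v p \<and> zeta E v p \<le> ereal (C * \<bar>p - pc\<bar>\<^sup>2)"
    if v: "v \<in> V" and p: "p \<in> {pc - \<delta> <..< pc + \<delta>}" for v p
  proof
    have p2: "pc / 2 \<le> p" "(1 - pc) / 2 \<le> 1 - p" using p \<delta> by auto
    then have p01: "0 < p" "p < 1" using crit_pos crit_less_1 by auto
    consider "p < pc" | "p = pc" | "pc < p" by linarith
    then show "ereal (c * \<bar>p - pc\<bar>\<^sup>2) \<le> zeta E v p"
    proof cases
      case 1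
      have "\<bar>p - pc\<bar>\<^sup>2 = (pc - p)\<^sup>2" by (simp add: power2_commute)
      moreover have "c * (pc - p)\<^sup>2 \<le> 1 / (16 * (real d)\<^sup>2 * K1\<^sup>2) * (pc - p)\<^sup>2"
        by (intro mult_right_mono) (auto simp: c_def)
      ultimately have "ereal (c * \<bar>p - pc\<bar>\<^sup>2) \<le> ereal (1 / (16 * (real d)\<^sup>2 * K1\<^sup>2) * (pc - p)\<^sup>2)"
        by (simp only: ereal_less_eq)
      also have "\<dots> \<le> zeta E v p" using p \<delta>(1) by (intro zeta_lower_subcritical v 1) auto
      finally show ?thesis .
    next
      case 2
      then show ?thesis using zeta_nonneg[OF v, of p] by (simp flip: zero_ereal_def)
    next
      case 3
      have "\<kappa> * (p - pc) \<le> \<kappa> * (\<delta>1 / \<kappa>)" using p \<delta>(2) \<kappa>_pos by (intro mult_left_mono) auto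
      then have "\<kappa> * (p - pc) \<le> \<delta>1" using \<kappa>_pos by simp
      then have "ereal (c1 * \<kappa>\<^sup>2 / (4 * K1\<^sup>2 * real d) * (p - pc)\<^sup>2) \<le> zeta E v p"
        using v 3 p01 by (intro zeta_lower_supercritical) auto
      moreover have "c * \<bar>p - pc\<bar>\<^sup>2 \<le> c1 * \<kappa>\<^sup>2 / (4 * K1\<^sup>2 * real d) * (p - pc)\<^sup>2"
        unfolding power2_abs by (intro mult_right_mono) (auto simp: c_def)
      ultimately show ?thesis by (meson ereal_less_eq(3) order_trans)
    qed
    have "zeta E v p \<le> ereal ((p - pc)\<^sup>2 / (p * (1 - p)))" using v p01 by (rule zeta_upper)
    also have "(p - pc)\<^sup>2 / (p * (1 - p)) \<le> (p - pc)\<^sup>2 / (pc / 2 * ((1 - pc) / 2))"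
      using p2 p01 crit_pos crit_less_1 by (intro divide_left_mono mult_mono mult_pos_pos) auto
    then have "ereal ((p - pc)\<^sup>2 / (p * (1 - p))) \<le> ereal (C * \<bar>p - pc\<bar>\<^sup>2)"
      by (simp add: C_def mult.commute)
    finally show "zeta E v p \<le> ereal (C * \<bar>p - pc\<bar>\<^sup>2)" .
  qed
  then show ?thesis using \<delta>0 c C by blast
qed

end

section \<open>The two-point matrix at density 0, and the conclusion\<close>

context lf_graph
begin

lemma two_point_zero:
  assumes "u \<in> V"
  shows "two_point E 0 u v = (if v = u then 1 else 0)"
proof -
  interpret P: prob_space "perc 0" by (rule prob_space_perc)
  have F: "finite (touching_edges E {u})" using assms by (intro finite_touching_E) auto
  have "clprob 0 u {u} = 1"
    using F reach_no_touch[of "{}" "{u}"] by (simp add: clprob_def expect_prob_0)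
  let ?A = "{\<omega> \<in> space (perc 0). cluster E \<omega> u = {u}}"
  have A: "?A \<in> sets (perc 0)" "measure (perc 0) ?A = 1"
    using measure_cluster_eq[of 0 "{u}" u] assms \<open>clprob 0 u {u} = 1\<close> by auto
  show ?thesis
  proof (cases "v = u")
    case True
    have "u \<in> cluster E \<omega> u" for \<omega> by (simp add: cluster_def)
    then show ?thesis using True P.prob_space by (simp add: two_point_def)
  next
    case False
    let ?B = "{\<omega> \<in> space (perc 0). v \<in> cluster E \<omega> u}"
    have "measure (perc 0) ?B = 0"
    \<comment> \<open>\<open>measure\<close> is 0 on non-measurable sets, so only the measurable
      case has content.\<close>
    proof (cases "?B \<in> sets (perc 0)")
      case True
      have "?B \<subseteq> space (perc 0) - ?A" using \<open>v \<noteq> u\<close> by auto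
      then have "measure (perc 0) ?B \<le> measure (perc 0) (space (perc 0) - ?A)"
        using A by (intro P.finite_measure_mono) auto
      also have "\<dots> = 0" using A by (subst P.prob_compl) auto
      finally show ?thesis using measure_nonneg[of "perc 0" ?B] by linarith
    qed (simp add: measure_notin_sets)
    then show ?thesis using False by (simp add: two_point_def)
  qed
qed

text \<open>At density 0 the matrix acts as the identity on \<open>V\<close>. This makes the set in
  the definition of \<open>p_two_to_two\<close> nonempty, so that a density with finite norm can be
  found above the critical one.\<close>

lemma l2_norm_zero: "l2_operator_norm V (two_point E 0) < \<infinity>"
proof -
  have app: "(\<lambda>v. two_point E 0 u v * f v) summable_on V" "matrix_apply V (two_point E 0) f u = f u"
    if u: "u \<in> V" for u f
  proof -
    have z: "\<And>v. v \<in> V - {u} \<Longrightarrow> two_point E 0 u v * f v = 0" using two_point_zero[OF u] by simp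
    show "(\<lambda>v. two_point E 0 u v * f v) summable_on V"
      using infsum_finite_support(1)[of "{u}" V] z u by auto
    show "matrix_apply V (two_point E 0) f u = f u"
      unfolding matrix_apply_def using infsum_finite_support(2)[of "{u}" V "\<lambda>v. two_point E 0 u v * f v"] z u
      by (simp add: two_point_zero[OF u])
  qed
  have "square_summable V (matrix_apply V (two_point E 0) f) = square_summable V f"
    "l2_norm V (matrix_apply V (two_point E 0) f) = l2_norm V f" for f
    unfolding square_summable_def l2_norm_def using app(2)
    by (simp_all cong: summable_on_cong infsum_cong)
  then have "l2_operator_norm V (two_point E 0) \<le> ereal 1"
    unfolding l2_operator_norm_def using app(1) by (intro Inf_lower) auto
  then show ?thesis by (rule le_less_trans) simp
qed

end

theorem corollary1p3:
  fixes V :: "'v set" and E :: "'v set set"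
  assumes "simple_graph V E"
    and "connected_graph V E"
    and "locally_finite_graph V E"
    and "quasi_transitive_graph V E"
    and "critical_probability V E < p_two_to_two V E"
  shows "\<exists>\<delta> c C :: real. \<delta> > 0 \<and> c > 0 \<and> C > 0 \<and>
           (\<forall>v\<in>V. \<forall>p\<in>{critical_probability V E - \<delta> <..< critical_probability V E + \<delta>}.
              ereal (c * \<bar>p - critical_probability V E\<bar>\<^sup>2) \<le> zeta E v p \<and>
              zeta E v p \<le> ereal (C * \<bar>p - critical_probability V E\<bar>\<^sup>2))"
proof -
  interpret qt_graph V E using assms by unfold_locales
  let ?pc = "critical_probability V E"
  have "{p \<in> {0..1}. l2_operator_norm V (two_point E p) < \<infinity>} \<noteq> {}"
    using l2_norm_zero by (auto intro!: exI[of _ 0])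
  then obtain q where q: "0 \<le> q" "q \<le> 1" "l2_operator_norm V (two_point E q) < \<infinity>" "?pc < q"
    using less_cSupD[OF _ assms(5)[unfolded p_two_to_two_def]] by auto
  obtain d where d: "1 \<le> d" "\<forall>F\<subseteq>E. \<forall>v. card {e \<in> F. v \<in> e} \<le> d" using bounded_degree by blast
  obtain D where D: "\<forall>p v x F. 0 \<le> p \<longrightarrow> p \<le> 1 \<longrightarrow> v \<in> V \<longrightarrow> x \<in> V \<longrightarrow> finite F \<longrightarrow> F \<subseteq> E \<longrightarrow>
    (\<exists>F'. finite F' \<and> F' \<subseteq> E \<and> p ^ D * esize F p {v} \<le> esize F' p {x})"
    using esize_comparable by blast
  obtain B where B: "0 < B" "\<forall>p. 0 \<le> p \<longrightarrow> p \<le> q \<longrightarrow> l2_bdd B p" using l2_bdd_exists[OF q(1-3)] by blast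
  interpret l2_graph V E d D B
    by unfold_locales (use d D B q in auto)
  show ?thesis by (rule zeta_bounds)
qed

end
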